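(* Let $k$ be an algebraically closed field of characteristic $0$, and let $\pi:\operatorname{Spec}L\to\operatorname{Spec}K$ correspond to a finite Galois extension $L/K$ of fields finitely generated over $k$, with cyclic Galois group $G$. Let $M$ be a simple $\mathcal D_L$-module (of finite dimension over $L$) such that $G_M=G$. Then $M=\pi^!(N)$ for some simple $\mathcal D_K$-module $N$.
   Context: $\mathcal D_L$, $\mathcal D_K$ are the rings of $k$-linear differential operators of $L$ and $K$. $\pi^!(N)=L\otimes_KN$ with its natural $\mathcal D_L=L\otimes_K\mathcal D_K$-module structure. For $g\in G$ the twisted module $M_g$ equals $M$ as a set, with action $P\cdot m=(g^{-1}Pg)m$ for $P\in\mathcal D_L$. The inertia group of $M$ is $G_M=\{g\in G\mid M_g\cong M\}$. *)

theory Defs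
  imports "HOL-Algebra.Algebra" "Jordan_Normal_Form.Missing_VectorSpace"
begin

section \<open>Left modules over a not necessarily commutative ring\<close>

text \<open>The library locale \<^locale>\<open>module\<close> requires a commutative ring of scalars. We keep
  its records and its axioms and only drop commutativity. The fields \<open>mult\<close> and \<open>one\<close> of a
  module record are never looked at.\<close>

locale left_module = R?: ring R + M?: abelian_group M
  for R :: "('r, 'c) ring_scheme" (structure) and M :: "('r, 'm, 'd) module_scheme" (structure) +
  assumes smult_closed [simp, intro]:
      "\<lbrakk>a \<in> carrier R; x \<in> carrier M\<rbrakk> \<Longrightarrow> a \<odot>\<^bsub>M\<^esub> x \<in> carrier M"
    and smult_l_distr:
      "\<lbrakk>a \<in> carrier R; b \<in> carrier R; x \<in> carrier M\<rbrakk> \<Longrightarrow>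
        (a \<oplus> b) \<odot>\<^bsub>M\<^esub> x = a \<odot>\<^bsub>M\<^esub> x \<oplus>\<^bsub>M\<^esub> b \<odot>\<^bsub>M\<^esub> x"
    and smult_r_distr:
      "\<lbrakk>a \<in> carrier R; x \<in> carrier M; y \<in> carrier M\<rbrakk> \<Longrightarrow>
        a \<odot>\<^bsub>M\<^esub> (x \<oplus>\<^bsub>M\<^esub> y) = a \<odot>\<^bsub>M\<^esub> x \<oplus>\<^bsub>M\<^esub> a \<odot>\<^bsub>M\<^esub> y"
    and smult_assoc1:
      "\<lbrakk>a \<in> carrier R; b \<in> carrier R; x \<in> carrier M\<rbrakk> \<Longrightarrow>
        (a \<otimes> b) \<odot>\<^bsub>M\<^esub> x = a \<odot>\<^bsub>M\<^esub> (b \<odot>\<^bsub>M\<^esub> x)"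
    and smult_one [simp]:
      "x \<in> carrier M \<Longrightarrow> \<one> \<odot>\<^bsub>M\<^esub> x = x"

definition simple_module :: "('r, 'c) ring_scheme \<Rightarrow> ('r, 'm, 'd) module_scheme \<Rightarrow> bool"
  where "simple_module R M \<longleftrightarrow>
    left_module R M \<and> carrier M \<noteq> {\<zero>\<^bsub>M\<^esub>} \<and>
    (\<forall>H. Module.submodule H R M \<longrightarrow> H = {\<zero>\<^bsub>M\<^esub>} \<or> H = carrier M)"

definition module_iso ::
    "('r, 'c) ring_scheme \<Rightarrow> ('r, 'm, 'd) module_scheme \<Rightarrow> ('r, 'n, 'e) module_scheme \<Rightarrow> ('m \<Rightarrow> 'n) set"
  where "module_iso R M N =
    {h \<in> iso (add_monoid M) (add_monoid N).
       \<forall>a\<in>carrier R. \<forall>x\<in>carrier M. h (a \<odot>\<^bsub>M\<^esub> x) = a \<odot>\<^bsub>N\<^esub> h x}"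

definition modules_isomorphic ::
    "('r, 'c) ring_scheme \<Rightarrow> ('r, 'm, 'd) module_scheme \<Rightarrow> ('r, 'n, 'e) module_scheme \<Rightarrow> bool"
  where "modules_isomorphic R M N \<longleftrightarrow> module_iso R M N \<noteq> {}"


section \<open>Fields\<close>

definition char_zero :: "('a, 'b) ring_scheme \<Rightarrow> bool"
  where "char_zero F \<longleftrightarrow> (\<forall>n::nat. 0 < n \<longrightarrow> [n] \<cdot>\<^bsub>F\<^esub> \<one>\<^bsub>F\<^esub> \<noteq> \<zero>\<^bsub>F\<^esub>)"

definition finitely_generated_field :: "('a, 'b) ring_scheme \<Rightarrow> 'a set \<Rightarrow> bool"
  where "finitely_generated_field F k \<longleftrightarrow>
    (\<exists>S. finite S \<and> S \<subseteq> carrier F \<and> generate_field F (k \<union> S) = carrier F)"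

text \<open>Automorphisms are taken extensional on the carrier, so that each is counted once.\<close>

definition galois_group :: "('a, 'b) ring_scheme \<Rightarrow> 'a set \<Rightarrow> ('a \<Rightarrow> 'a) monoid"
  where "galois_group L K =
    BijGroup (carrier L) \<lparr>carrier :=
      {g \<in> ring_iso L L \<inter> extensional (carrier L). \<forall>x\<in>K. g x = x}\<rparr>"

definition finite_galois :: "('a, 'b) ring_scheme \<Rightarrow> 'a set \<Rightarrow> bool"
  where "finite_galois L K \<longleftrightarrow>
    ring.finite_dimension L K (carrier L) \<and>
    {x \<in> carrier L. \<forall>g\<in>carrier (galois_group L K). g x = x} = K"


section \<open>Differential operators\<close>

definition linear_endos :: "('a, 'b) ring_scheme \<Rightarrow> 'a set \<Rightarrow> ('a \<Rightarrow> 'a) set"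
  where "linear_endos R k =
    {P \<in> extensional (carrier R) \<inter> hom (add_monoid R) (add_monoid R).
       \<forall>c\<in>k. \<forall>x\<in>carrier R. P (c \<otimes>\<^bsub>R\<^esub> x) = c \<otimes>\<^bsub>R\<^esub> P x}"

definition commutator :: "('a, 'b) ring_scheme \<Rightarrow> ('a \<Rightarrow> 'a) \<Rightarrow> 'a \<Rightarrow> ('a \<Rightarrow> 'a)"
  where "commutator R P a = (\<lambda>x\<in>carrier R. P (a \<otimes>\<^bsub>R\<^esub> x) \<ominus>\<^bsub>R\<^esub> a \<otimes>\<^bsub>R\<^esub> P x)"

text \<open>Grothendieck's definition of the \<open>k\<close>-linear differential operators of order at most \<open>n\<close>.\<close>

primrec diff_ops_upto :: "('a, 'b) ring_scheme \<Rightarrow> 'a set \<Rightarrow> nat \<Rightarrow> ('a \<Rightarrow> 'a) set"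
  where
    "diff_ops_upto R k 0 =
      {P \<in> linear_endos R k. \<forall>a\<in>carrier R. commutator R P a = (\<lambda>x\<in>carrier R. \<zero>\<^bsub>R\<^esub>)}"
  | "diff_ops_upto R k (Suc n) =
      {P \<in> linear_endos R k. \<forall>a\<in>carrier R. commutator R P a \<in> diff_ops_upto R k n}"

definition diff_ops :: "('a, 'b) ring_scheme \<Rightarrow> 'a set \<Rightarrow> ('a \<Rightarrow> 'a) ring"
  where "diff_ops R k =
    \<lparr>carrier = (\<Union>n. diff_ops_upto R k n),
     monoid.mult = compose (carrier R),
     one = (\<lambda>x\<in>carrier R. x),
     ring.zero = (\<lambda>x\<in>carrier R. \<zero>\<^bsub>R\<^esub>),
     add = (\<lambda>P Q. \<lambda>x\<in>carrier R. P x \<oplus>\<^bsub>R\<^esub> Q x)\<rparr>"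

definition mult_op :: "('a, 'b) ring_scheme \<Rightarrow> 'a \<Rightarrow> ('a \<Rightarrow> 'a)"
  where "mult_op R a = (\<lambda>x\<in>carrier R. a \<otimes>\<^bsub>R\<^esub> x)"

text \<open>Restriction of scalars along \<open>R \<rightarrow> \<D>\<^sub>R\<close>, \<open>a \<mapsto> mult_op R a\<close>.\<close>

definition underlying_module ::
    "('a, 'b) ring_scheme \<Rightarrow> ('a \<Rightarrow> 'a, 'm, 'd) module_scheme \<Rightarrow> ('a, 'm) module"
  where "underlying_module R M =
    \<lparr>carrier = carrier M, monoid.mult = monoid.mult M, one = one M, ring.zero = ring.zero M, add = add M,
     smult = (\<lambda>a x. mult_op R a \<odot>\<^bsub>M\<^esub> x)\<rparr>"


section \<open>Twists and the inertia group\<close>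

definition twist ::
    "('a, 'b) ring_scheme \<Rightarrow> 'a set \<Rightarrow> ('a \<Rightarrow> 'a) \<Rightarrow> ('a \<Rightarrow> 'a, 'm) module \<Rightarrow> ('a \<Rightarrow> 'a, 'm) module"
  where "twist L K g M =
    M \<lparr>smult := (\<lambda>P m.
      compose (carrier L) (inv\<^bsub>galois_group L K\<^esub> g) (compose (carrier L) P g) \<odot>\<^bsub>M\<^esub> m)\<rparr>"

definition inertia_group ::
    "('a, 'b) ring_scheme \<Rightarrow> 'a set \<Rightarrow> 'a set \<Rightarrow> ('a \<Rightarrow> 'a, 'm) module \<Rightarrow> ('a \<Rightarrow> 'a) set"
  where "inertia_group L K k M =
    {g \<in> carrier (galois_group L K). modules_isomorphic (diff_ops L k) (twist L K g M) M}"


section \<open>Tensor products and the inverse image\<close>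

text \<open>The tensor product \<open>A \<otimes>\<^sub>R B\<close> over a commutative ring is the free abelian group on
  \<open>A \<times> B\<close> modulo the usual relations. As a group it is written multiplicatively
  (\<open>\<otimes>\<close> is the sum and \<open>finprod\<close> the finite sum), as are \<^const>\<open>free_Abelian_group\<close>
  and \<^const>\<open>FactGroup\<close>.\<close>

definition tensor_relations ::
    "('r, 'c) ring_scheme \<Rightarrow> ('r, 'a, 'd) module_scheme \<Rightarrow> ('r, 'b, 'e) module_scheme \<Rightarrow>
      ('a \<times> 'b \<Rightarrow>\<^sub>0 int) set"
  where "tensor_relations R A B =
    {frag_of (a \<oplus>\<^bsub>A\<^esub> a', b) - frag_of (a, b) - frag_of (a', b) | a a' b.
       a \<in> carrier A \<and> a' \<in> carrier A \<and> b \<in> carrier B} \<union>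
    {frag_of (a, b \<oplus>\<^bsub>B\<^esub> b') - frag_of (a, b) - frag_of (a, b') | a b b'.
       a \<in> carrier A \<and> b \<in> carrier B \<and> b' \<in> carrier B} \<union>
    {frag_of (r \<odot>\<^bsub>A\<^esub> a, b) - frag_of (a, r \<odot>\<^bsub>B\<^esub> b) | r a b.
       r \<in> carrier R \<and> a \<in> carrier A \<and> b \<in> carrier B}"

definition tensor_kernel ::
    "('r, 'c) ring_scheme \<Rightarrow> ('r, 'a, 'd) module_scheme \<Rightarrow> ('r, 'b, 'e) module_scheme \<Rightarrow>
      ('a \<times> 'b \<Rightarrow>\<^sub>0 int) set"
  where "tensor_kernel R A B =
    generate (free_Abelian_group (carrier A \<times> carrier B)) (tensor_relations R A B)"

definition tensor_group ::
    "('r, 'c) ring_scheme \<Rightarrow> ('r, 'a, 'd) module_scheme \<Rightarrow> ('r, 'b, 'e) module_scheme \<Rightarrow>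
      ('a \<times> 'b \<Rightarrow>\<^sub>0 int) set monoid"
  where "tensor_group R A B =
    free_Abelian_group (carrier A \<times> carrier B) Mod tensor_kernel R A B"

definition pure_tensor ::
    "('r, 'c) ring_scheme \<Rightarrow> ('r, 'a, 'd) module_scheme \<Rightarrow> ('r, 'b, 'e) module_scheme \<Rightarrow>
      'a \<Rightarrow> 'b \<Rightarrow> ('a \<times> 'b \<Rightarrow>\<^sub>0 int) set"
  where "pure_tensor R A B a b =
    tensor_kernel R A B #>\<^bsub>free_Abelian_group (carrier A \<times> carrier B)\<^esub> frag_of (a, b)"

text \<open>\<open>L\<close> as a \<open>K\<close>-module; the scalars are understood to range over a subfield \<open>K\<close>.\<close>

definition self_module :: "('a, 'b) ring_scheme \<Rightarrow> ('a, 'a) module"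
  where "self_module L =
    \<lparr>carrier = carrier L, monoid.mult = monoid.mult L, one = one L, ring.zero = ring.zero L, add = add L,
     smult = monoid.mult L\<rparr>"

definition base_change ::
    "('a, 'b) ring_scheme \<Rightarrow> 'a set \<Rightarrow> ('a \<Rightarrow> 'a, 'm) module \<Rightarrow> ('a \<times> 'm \<Rightarrow>\<^sub>0 int) set monoid"
  where "base_change L K N =
    tensor_group (L\<lparr>carrier := K\<rparr>) (self_module L) (underlying_module (L\<lparr>carrier := K\<rparr>) N)"

definition base_change_tensor ::
    "('a, 'b) ring_scheme \<Rightarrow> 'a set \<Rightarrow> ('a \<Rightarrow> 'a, 'm) module \<Rightarrow> 'a \<Rightarrow> 'm \<Rightarrow> ('a \<times> 'm \<Rightarrow>\<^sub>0 int) set"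
  where "base_change_tensor L K N =
    pure_tensor (L\<lparr>carrier := K\<rparr>) (self_module L) (underlying_module (L\<lparr>carrier := K\<rparr>) N)"

text \<open>The identification \<open>\<D>\<^sub>L = L \<otimes>\<^sub>K \<D>\<^sub>K\<close>: the element \<open>\<Sum>\<^sub>i\<^sub><\<^sub>r l\<^sub>i \<otimes> Q\<^sub>i\<close> corresponds to the
  operator \<open>P\<close> of \<open>L\<close> whose restriction to \<open>K\<close> is \<open>x \<mapsto> \<Sum>\<^sub>i\<^sub><\<^sub>r l\<^sub>i Q\<^sub>i(x)\<close>. (An operator on \<open>L\<close> is
  determined by its restriction to \<open>K\<close>, and \<open>1 \<otimes> Q\<close> corresponds to the unique extension of
  \<open>Q\<close> to \<open>L\<close>.)\<close>

definition corresponds ::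
    "('a, 'b) ring_scheme \<Rightarrow> 'a set \<Rightarrow> 'a set \<Rightarrow> ('a \<Rightarrow> 'a) \<Rightarrow>
      nat \<Rightarrow> (nat \<Rightarrow> 'a) \<Rightarrow> (nat \<Rightarrow> ('a \<Rightarrow> 'a)) \<Rightarrow> bool"
  where "corresponds L K k P r l Q \<longleftrightarrow>
    l \<in> {..<r} \<rightarrow> carrier L \<and>
    Q \<in> {..<r} \<rightarrow> carrier (diff_ops (L\<lparr>carrier := K\<rparr>) k) \<and>
    (\<forall>x\<in>K. P x = finsum L (\<lambda>i. l i \<otimes>\<^bsub>L\<^esub> Q i x) {..<r})"

text \<open>The action on \<open>L \<otimes>\<^sub>K N\<close>: if the product \<open>P \<cdot> a\<close> in \<open>\<D>\<^sub>L\<close> of \<open>P\<close> and the scalar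
  \<open>a \<in> L\<close> is \<open>\<Sum>\<^sub>i l\<^sub>i \<otimes> Q\<^sub>i\<close> in \<open>L \<otimes>\<^sub>K \<D>\<^sub>K\<close>, then \<open>P (a \<otimes> n) = \<Sum>\<^sub>i l\<^sub>i \<otimes> Q\<^sub>i n\<close>. This is the
  action on \<open>\<D>\<^sub>L \<otimes> N\<close> (over \<open>\<D>\<^sub>K\<close>) transported to \<open>(L \<otimes>\<^sub>K \<D>\<^sub>K) \<otimes> N = L \<otimes>\<^sub>K N\<close>. The additive
  map is unique because pure tensors generate.\<close>

definition pullback_action ::
    "('a, 'b) ring_scheme \<Rightarrow> 'a set \<Rightarrow> 'a set \<Rightarrow> ('a \<Rightarrow> 'a, 'm) module \<Rightarrow> ('a \<Rightarrow> 'a) \<Rightarrow>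
      ('a \<times> 'm \<Rightarrow>\<^sub>0 int) set \<Rightarrow> ('a \<times> 'm \<Rightarrow>\<^sub>0 int) set"
  where "pullback_action L K k N P =
    (THE f. f \<in> extensional (carrier (base_change L K N)) \<inter>
                hom (base_change L K N) (base_change L K N) \<and>
      (\<forall>a\<in>carrier L. \<forall>n\<in>carrier N. \<forall>r l Q.
         corresponds L K k (compose (carrier L) P (mult_op L a)) r l Q \<longrightarrow>
         f (base_change_tensor L K N a n) =
           finprod (base_change L K N) (\<lambda>i. base_change_tensor L K N (l i) (Q i \<odot>\<^bsub>N\<^esub> n)) {..<r}))"

definition pullback ::
    "('a, 'b) ring_scheme \<Rightarrow> 'a set \<Rightarrow> 'a set \<Rightarrow> ('a \<Rightarrow> 'a, 'm) module \<Rightarrow>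
      ('a \<Rightarrow> 'a, ('a \<times> 'm \<Rightarrow>\<^sub>0 int) set) module"
  where "pullback L K k N =
    \<lparr>carrier = carrier (base_change L K N), monoid.mult = undefined, one = undefined,
     ring.zero = \<one>\<^bsub>base_change L K N\<^esub>, add = monoid.mult (base_change L K N),
     smult = pullback_action L K k N\<rparr>"

end

theory Submission
  imports Defs
begin

text \<open>Let \<open>g\<close> generate the Galois group and let \<open>d\<close> be its order. An isomorphism \<open>M\<^sub>g \<cong> M\<close> is a
  \<open>g\<close>-semilinear bijection \<open>\<phi>\<close> of \<open>M\<close> with \<open>\<phi> P = (g P g\<inverse>) \<phi>\<close>, so \<open>\<phi>\<^sup>d\<close> commutes with \<open>\<D>\<^sub>L\<close>.
  By Schur's lemma \<open>\<phi>\<^sup>d\<close> is a constant in \<open>k\<close>, and after division by a \<open>d\<close>-th root of it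
  \<open>\<phi>\<^sup>d = 1\<close>. The module is \<open>N = M\<^sup>\<phi>\<close>: an operator on \<open>K\<close> extends uniquely to \<open>L\<close>, the
  extension commutes with \<open>g\<close> and so preserves \<open>N\<close>, and \<open>L \<otimes>\<^sub>K N \<cong> M\<close> by Galois descent.
  Uniqueness and existence of extensions as well as descent all come from elements \<open>a\<^sub>i, b\<^sub>i\<close> of \<open>L\<close> with
  \<open>\<Sum>\<^sub>i a\<^sub>i g\<^sup>j(b\<^sub>i) = 0\<close> for \<open>0 < j < d\<close> and \<open>\<Sum>\<^sub>i a\<^sub>i b\<^sub>i = 1\<close>.\<close>

text \<open>\<open>M\<close> has finite dimension over \<open>L\<close>, but in general not over
  \<open>k\<close>, so an endomorphism has a minimal polynomial only over \<open>L\<close>. If a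
  coefficient \<open>c\<close> lies outside \<open>k\<close>, a \<open>k\<close>-derivation \<delta>
  of \<open>L\<close> with \<delta> c = 1 differentiates this polynomial to a nonzero one of smaller
  degree that still annihilates. Producing \<delta> is where algebraic closedness (\<open>c\<close>
  is transcendental over \<open>k\<close>), characteristic zero (derivations extend through
  algebraic elements) and finite generation (finitely many steps) enter. The other obstacle is that
  differential operators are given by Grothendieck's condition on commutators, not as polynomials in
  derivations, so an operator of \<open>K\<close> cannot be extended generator by generator. The
  elements a_i, b_i represent the idempotent that makes \<open>L\<close> separable over
  \<open>K\<close>; averaging an operator with them reduces commutators with elements of
  \<open>L\<close> to commutators with elements of \<open>K\<close>. \<open>N\<close> is simple
  because \<open>H\<close> \<mapsto> \<open>L H\<close> takes submodules of \<open>N\<close> to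
  submodules of \<open>M\<close> and detects the zero and the full one.\<close>

context abelian_monoid
begin

section \<open>Finite sums over initial segments of the natural numbers\<close>

lemma sum_closed: "(\<And>i. i < n \<Longrightarrow> f i \<in> carrier G) \<Longrightarrow> (\<Oplus>i\<in>{..<n::nat}. f i) \<in> carrier G"
  by (rule finsum_closed) auto

lemma sum_cong:
  "\<lbrakk>\<And>i. i < n \<Longrightarrow> f i = h i; \<And>i. i < n \<Longrightarrow> h i \<in> carrier G\<rbrakk>
    \<Longrightarrow> (\<Oplus>i\<in>{..<n::nat}. f i) = (\<Oplus>i\<in>{..<n}. h i)"
  by (rule finsum_cong') auto

lemma sum_Suc:
  "(\<And>i. i \<le> n \<Longrightarrow> f i \<in> carrier G) \<Longrightarrow> (\<Oplus>i\<in>{..<Suc n}. f i) = (\<Oplus>i\<in>{..<n}. f i) \<oplus> f n"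
  unfolding lessThan_Suc by (subst finsum_insert) (auto intro: a_comm sum_closed)

lemma sum_Suc_shift:
  "(\<And>i. i \<le> n \<Longrightarrow> f i \<in> carrier G) \<Longrightarrow> (\<Oplus>i\<in>{..<Suc n}. f i) = f 0 \<oplus> (\<Oplus>i\<in>{..<n}. f (Suc i))"
proof (induction n)
  case 0
  then show ?case by (subst sum_Suc) simp_all
next
  case (Suc n)
  have "(\<Oplus>i\<in>{..<Suc (Suc n)}. f i) = (f 0 \<oplus> (\<Oplus>i\<in>{..<n}. f (Suc i))) \<oplus> f (Suc n)"
    using Suc by (subst sum_Suc) auto
  also have "\<dots> = f 0 \<oplus> (\<Oplus>i\<in>{..<Suc n}. f (Suc i))"
    using Suc.prems by (subst sum_Suc) (auto simp: a_assoc intro!: sum_closed)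
  finally show ?case .
qed

text \<open>This makes traces over a cyclic group invariant: the generator shifts the index of the
  sum of all g^j y by one, and the assumption \<open>f n = f 0\<close> closes the cycle.\<close>

lemma sum_rotate:
  assumes "\<And>i. i \<le> n \<Longrightarrow> f i \<in> carrier G" "f n = f 0"
  shows "(\<Oplus>i\<in>{..<n}. f (Suc i)) = (\<Oplus>i\<in>{..<n}. f i)"
proof (cases n)
  case (Suc m)
  have "(\<Oplus>i\<in>{..<Suc m}. f (Suc i)) = (\<Oplus>i\<in>{..<m}. f (Suc i)) \<oplus> f 0"
    using assms Suc by (subst sum_Suc) auto
  also have "\<dots> = (\<Oplus>i\<in>{..<Suc m}. f i)"
    using assms(1) Suc by (subst sum_Suc_shift) (auto intro!: a_comm sum_closed)
  finally show ?thesis using Suc by simp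
qed simp

lemma sum_append:
  "(\<And>i. i < m + n \<Longrightarrow> f i \<in> carrier G) \<Longrightarrow>
    (\<Oplus>i\<in>{..<m + n::nat}. f i) = (\<Oplus>i\<in>{..<m}. f i) \<oplus> (\<Oplus>i\<in>{..<n}. f (m + i))"
proof (induction n)
  case 0
  then show ?case by (simp add: sum_closed)
next
  case (Suc n)
  then show ?case by (simp add: sum_Suc sum_closed a_assoc)
qed

lemma sum_delta:
  "\<lbrakk>j < n; v \<in> carrier G\<rbrakk> \<Longrightarrow> (\<Oplus>i\<in>{..<n::nat}. if i = j then v else \<zero>) = v"
proof (induction n)
  case (Suc n)
  have "(\<Oplus>i\<in>{..<n}. if i = j then v else \<zero>) = \<zero>" if "j = n"
    using that by (subst sum_cong[where h = "\<lambda>_. \<zero>"]) (auto simp: finsum_zero)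
  then show ?case using Suc by (subst sum_Suc) (auto simp: less_Suc_eq)
qed simp

text \<open>Between monoids an element of \<open>hom\<close> is only multiplicative, so the
  preservation of zero is a separate assumption.\<close>

lemma hom_sum:
  assumes "abelian_monoid H" "h \<in> hom (add_monoid G) (add_monoid H)" "h \<zero> = \<zero>\<^bsub>H\<^esub>"
    "\<And>i. i < n \<Longrightarrow> f i \<in> carrier G"
  shows "h (\<Oplus>i\<in>{..<n::nat}. f i) = (\<Oplus>\<^bsub>H\<^esub>i\<in>{..<n}. h (f i))"
  using assms(4)
proof (induction n)
  case 0
  interpret H: abelian_monoid H by fact
  show ?case using assms(3) by simp
next
  case (Suc n)
  interpret H: abelian_monoid H by fact
  have "h x \<in> carrier H" if "x \<in> carrier G" for x using assms(2) that by (auto simp: hom_def)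
  moreover have "h (x \<oplus> y) = h x \<oplus>\<^bsub>H\<^esub> h y" if "x \<in> carrier G" "y \<in> carrier G" for x y
    using assms(2) that by (auto simp: hom_def)
  ultimately show ?case using Suc by (simp add: sum_Suc H.sum_Suc sum_closed)
qed

end

lemma (in abelian_group) sum_minus:
  "\<lbrakk>\<And>i. i < n \<Longrightarrow> f i \<in> carrier G; \<And>i. i < n \<Longrightarrow> h i \<in> carrier G\<rbrakk> \<Longrightarrow>
    (\<Oplus>i\<in>{..<n::nat}. f i \<ominus> h i) = (\<Oplus>i\<in>{..<n}. f i) \<ominus> (\<Oplus>i\<in>{..<n}. h i)"
proof (induction n)
  case 0
  have "\<zero> \<ominus> \<zero> = \<zero>" unfolding minus_eq by (rule r_neg) simp
  then show ?case by (simp only: lessThan_0 finsum_empty)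
next
  case (Suc n)
  then show ?case by (simp add: sum_Suc sum_closed minus_eq minus_add a_ac)
qed

lemma (in abelian_monoid) sum_swap:
  "(\<And>i j. \<lbrakk>i < m; j < n\<rbrakk> \<Longrightarrow> f i j \<in> carrier G) \<Longrightarrow>
    (\<Oplus>i\<in>{..<m::nat}. \<Oplus>j\<in>{..<n::nat}. f i j) = (\<Oplus>j\<in>{..<n}. \<Oplus>i\<in>{..<m}. f i j)"
proof (induction m)
  case 0
  have "(\<Oplus>j\<in>{..<n}. \<Oplus>i\<in>{..<0}. f i j) = (\<Oplus>j\<in>{..<n}. \<zero>)" by (rule sum_cong) simp_all
  then show ?case by (simp add: finsum_zero)
next
  case (Suc m)
  have "(\<Oplus>i\<in>{..<Suc m}. \<Oplus>j\<in>{..<n}. f i j) = (\<Oplus>i\<in>{..<m}. \<Oplus>j\<in>{..<n}. f i j) \<oplus> (\<Oplus>j\<in>{..<n}. f m j)"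
    using Suc.prems by (intro sum_Suc sum_closed) auto
  also have "\<dots> = (\<Oplus>j\<in>{..<n}. \<Oplus>i\<in>{..<m}. f i j) \<oplus> (\<Oplus>j\<in>{..<n}. f m j)"
    using Suc by simp
  also have "\<dots> = (\<Oplus>j\<in>{..<n}. (\<Oplus>i\<in>{..<m}. f i j) \<oplus> f m j)"
    using Suc.prems by (intro finsum_addf[symmetric]) (auto intro!: sum_closed)
  also have "\<dots> = (\<Oplus>j\<in>{..<n}. \<Oplus>i\<in>{..<Suc m}. f i j)"
    using Suc.prems by (intro sum_cong sum_Suc[symmetric] sum_closed) auto
  finally show ?case .
qed

lemma restrict_eqD: "restrict f A = h \<Longrightarrow> x \<in> A \<Longrightarrow> f x = h x"
  by (drule fun_cong[of _ _ x]) simp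

section \<open>Differential operators on a field\<close>

text \<open>Operators are extensional functions built by nested restrictions. The conditional rule
  evaluates them only at points known to lie in the domain and leaves no case distinctions.\<close>

declare restrict_apply [simp del] restrict_apply' [simp]

text \<open>The locale is used for \<open>L\<close> and interpreted a second time for
  \<open>K\<close> as a field of its own, so that both rings of differential operators come from one
  development.\<close>

locale k_field = field L for L :: "'a ring" (structure) +
  fixes k :: "'a set"
  assumes k_carrier: "k \<subseteq> carrier L"
begin

definition k_subring :: "'a set \<Rightarrow> bool"
  where "k_subring A \<longleftrightarrow> subring A L \<and> k \<subseteq> A"

text \<open>The values range over all of \<open>L\<close> and not just over \<open>A\<close>,
  because an operator on \<open>L\<close> restricted to \<open>K\<close> takes values in
  \<open>L\<close>, and it is with such restrictions that operators are extended and
  compared.\<close>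

definition lin :: "'a set \<Rightarrow> ('a \<Rightarrow> 'a) set"
  where "lin A = {P \<in> extensional A \<inter> (A \<rightarrow> carrier L).
    (\<forall>x\<in>A. \<forall>y\<in>A. P (x \<oplus> y) = P x \<oplus> P y) \<and> (\<forall>c\<in>k. \<forall>x\<in>A. P (c \<otimes> x) = c \<otimes> P x)}"

definition com :: "'a set \<Rightarrow> ('a \<Rightarrow> 'a) \<Rightarrow> 'a \<Rightarrow> 'a \<Rightarrow> 'a"
  where "com A P a = (\<lambda>x\<in>A. P (a \<otimes> x) \<ominus> a \<otimes> P x)"

text \<open>The index is shifted: \<open>dop A (Suc n)\<close> are the operators \<open>A \<rightarrow> L\<close> of order at most \<open>n\<close>.\<close>

primrec dop :: "'a set \<Rightarrow> nat \<Rightarrow> ('a \<Rightarrow> 'a) set"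
  where
    "dop A 0 = {\<lambda>x\<in>A. \<zero>}"
  | "dop A (Suc n) = {P \<in> lin A. \<forall>a\<in>A. com A P a \<in> dop A n}"

lemma k_subringD:
  assumes "k_subring A"
  shows "\<And>x. x \<in> A \<Longrightarrow> x \<in> carrier L" "\<And>c. c \<in> k \<Longrightarrow> c \<in> A"
    "\<And>x y. \<lbrakk>x \<in> A; y \<in> A\<rbrakk> \<Longrightarrow> x \<oplus> y \<in> A" "\<And>x y. \<lbrakk>x \<in> A; y \<in> A\<rbrakk> \<Longrightarrow> x \<otimes> y \<in> A"
    "\<And>x. x \<in> A \<Longrightarrow> \<ominus> x \<in> A" "\<zero> \<in> A" "\<one> \<in> A"
  using assms subringE[of A L] unfolding k_subring_def by blast+

lemma k_subring_carrier: "k_subring (carrier L)"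
  using carrier_is_subring k_carrier by (simp add: k_subring_def)

lemma k_in_carrier: "c \<in> k \<Longrightarrow> c \<in> carrier L"
  using k_carrier by blast

lemma linI:
  assumes "P \<in> extensional A" "\<And>x. x \<in> A \<Longrightarrow> P x \<in> carrier L"
    "\<And>x y. \<lbrakk>x \<in> A; y \<in> A\<rbrakk> \<Longrightarrow> P (x \<oplus> y) = P x \<oplus> P y"
    "\<And>c x. \<lbrakk>c \<in> k; x \<in> A\<rbrakk> \<Longrightarrow> P (c \<otimes> x) = c \<otimes> P x"
  shows "P \<in> lin A"
  using assms by (auto simp: lin_def)

lemma linD:
  assumes "P \<in> lin A"
  shows "P \<in> extensional A" "\<And>x. x \<in> A \<Longrightarrow> P x \<in> carrier L"
    "\<And>x y. \<lbrakk>x \<in> A; y \<in> A\<rbrakk> \<Longrightarrow> P (x \<oplus> y) = P x \<oplus> P y"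
    "\<And>c x. \<lbrakk>c \<in> k; x \<in> A\<rbrakk> \<Longrightarrow> P (c \<otimes> x) = c \<otimes> P x"
  using assms by (auto simp: lin_def)

lemma additive_zero:
  assumes "P \<in> lin A" "k_subring A" shows "P \<zero> = \<zero>"
proof -
  have "P (\<zero> \<oplus> \<zero>) = P \<zero> \<oplus> P \<zero>" using linD(3)[OF assms(1)] k_subringD(6)[OF assms(2)] by blast
  moreover have "P \<zero> \<in> carrier L" using linD(2)[OF assms(1)] k_subringD(6)[OF assms(2)] by blast
  ultimately show ?thesis by simp
qed

lemma additive_neg:
  assumes "P \<in> lin A" "k_subring A" "x \<in> A" shows "P (\<ominus> x) = \<ominus> P x"
proof -
  note [simp] = k_subringD[OF assms(2)] assms(3) linD[OF assms(1)]
  have "P (\<ominus> x) \<oplus> P x = P (\<ominus> x \<oplus> x)" by simp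
  also have "\<dots> = \<zero>" using additive_zero[OF assms(1,2)] by (simp add: l_neg)
  finally show ?thesis by (simp add: minus_equality)
qed

lemma additive_minus:
  assumes "P \<in> lin A" "k_subring A" "x \<in> A" "y \<in> A" shows "P (x \<ominus> y) = P x \<ominus> P y"
  using assms additive_neg[OF assms(1,2,4)] linD(3)[OF assms(1)] k_subringD[OF assms(2)]
  by (simp add: minus_eq)

lemma additive_sum:
  fixes f :: "nat \<Rightarrow> 'a"
  assumes "P \<in> lin A" "k_subring A" "\<And>i. i < r \<Longrightarrow> f i \<in> A"
  shows "(\<Oplus>i\<in>{..<r}. f i) \<in> A" "P (\<Oplus>i\<in>{..<r}. f i) = (\<Oplus>i\<in>{..<r}. P (f i))"
proof -
  note [simp] = k_subringD[OF assms(2)] linD[OF assms(1)] additive_zero[OF assms(1,2)]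
  have "(\<Oplus>i\<in>{..<r}. f i) \<in> A \<and> P (\<Oplus>i\<in>{..<r}. f i) = (\<Oplus>i\<in>{..<r}. P (f i))"
    using assms(3)
  proof (induction r)
    case (Suc r)
    have 1: "(\<Oplus>i\<in>{..<Suc r}. f i) = f r \<oplus> (\<Oplus>i\<in>{..<r}. f i)"
      unfolding lessThan_Suc using Suc.prems by (intro finsum_insert) auto
    have 2: "(\<Oplus>i\<in>{..<Suc r}. P (f i)) = P (f r) \<oplus> (\<Oplus>i\<in>{..<r}. P (f i))"
      unfolding lessThan_Suc using Suc.prems by (intro finsum_insert) auto
    show ?case unfolding 1 2 using Suc by simp
  qed simp
  then show "(\<Oplus>i\<in>{..<r}. f i) \<in> A" "P (\<Oplus>i\<in>{..<r}. f i) = (\<Oplus>i\<in>{..<r}. P (f i))" by auto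
qed

lemma lin_zero: "k_subring A \<Longrightarrow> (\<lambda>x\<in>A. \<zero>) \<in> lin A"
  by (rule linI) (auto simp: k_subringD k_in_carrier)

lemma lin_add: "\<lbrakk>k_subring A; P \<in> lin A; Q \<in> lin A\<rbrakk> \<Longrightarrow> (\<lambda>x\<in>A. P x \<oplus> Q x) \<in> lin A"
  by (rule linI) (auto simp: k_subringD k_in_carrier linD r_distr a_ac)

lemma lin_lmult: "\<lbrakk>k_subring A; P \<in> lin A; l \<in> carrier L\<rbrakk> \<Longrightarrow> (\<lambda>x\<in>A. l \<otimes> P x) \<in> lin A"
  by (rule linI) (auto simp: k_subringD k_in_carrier linD r_distr m_ac)

lemma lin_rmult:
  assumes "k_subring A" "P \<in> lin A" "a \<in> A" shows "(\<lambda>x\<in>A. P (a \<otimes> x)) \<in> lin A"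
proof (rule linI)
  note [simp] = k_subringD[OF assms(1)] linD[OF assms(2)] assms(3)
  show "(\<lambda>x\<in>A. P (a \<otimes> x)) (x \<oplus> y) = (\<lambda>x\<in>A. P (a \<otimes> x)) x \<oplus> (\<lambda>x\<in>A. P (a \<otimes> x)) y"
    if "x \<in> A" "y \<in> A" for x y using that by (simp add: r_distr)
  show "(\<lambda>x\<in>A. P (a \<otimes> x)) (c \<otimes> x) = c \<otimes> (\<lambda>x\<in>A. P (a \<otimes> x)) x"
    if "c \<in> k" "x \<in> A" for c x
  proof -
    have "a \<otimes> (c \<otimes> x) = c \<otimes> (a \<otimes> x)" using that by (simp add: m_lcomm)
    then show ?thesis using that by simp
  qed
qed (use assms in \<open>auto simp: k_subringD linD\<close>)

lemma dop_zero: "k_subring A \<Longrightarrow> (\<lambda>x\<in>A. \<zero>) \<in> dop A n"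
proof (induction n)
  case (Suc n)
  have "com A (\<lambda>x\<in>A. \<zero>) a = (\<lambda>x\<in>A. \<zero>)" if "a \<in> A" for a
    unfolding com_def by (rule restrict_ext) (use that Suc.prems in \<open>simp add: k_subringD\<close>)
  then show ?case using Suc lin_zero by simp
qed simp

lemma dop_lin: "\<lbrakk>k_subring A; P \<in> dop A n\<rbrakk> \<Longrightarrow> P \<in> lin A"
  by (cases n) (auto simp: lin_zero)

lemma dop_com: "\<lbrakk>P \<in> dop A (Suc n); a \<in> A\<rbrakk> \<Longrightarrow> com A P a \<in> dop A n"
  by simp

lemma dop_SucI: "\<lbrakk>P \<in> lin A; \<And>a. a \<in> A \<Longrightarrow> com A P a \<in> dop A n\<rbrakk> \<Longrightarrow> P \<in> dop A (Suc n)"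
  by simp

lemma dop_Suc_mono:
  assumes "k_subring A" shows "P \<in> dop A n \<Longrightarrow> P \<in> dop A (Suc n)"
proof (induction n arbitrary: P)
  case 0
  then show ?case using dop_zero[OF assms, of "Suc 0"] by simp
next
  case (Suc n)
  then show ?case by (intro dop_SucI) (auto simp del: dop.simps(2) intro: dop_lin[OF assms] dop_com)
qed

lemma dop_mono: "\<lbrakk>k_subring A; P \<in> dop A m; m \<le> n\<rbrakk> \<Longrightarrow> P \<in> dop A n"
  by (rule lift_Suc_mono_le[of "dop A" m n, THEN subsetD]) (auto simp del: dop.simps intro: dop_Suc_mono)

lemma dop_add:
  assumes "k_subring A"
  shows "\<lbrakk>P \<in> dop A n; Q \<in> dop A n\<rbrakk> \<Longrightarrow> (\<lambda>x\<in>A. P x \<oplus> Q x) \<in> dop A n"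
proof (induction n arbitrary: P Q)
  case 0
  then show ?case by (auto intro!: restrict_ext)
next
  case (Suc n)
  have l: "P \<in> lin A" "Q \<in> lin A" using Suc.prems by auto
  note [simp] = k_subringD[OF assms] linD[OF l(1)] linD[OF l(2)]
  show ?case
  proof (rule dop_SucI[OF lin_add[OF assms l]])
    fix a assume [simp]: "a \<in> A"
    have "com A (\<lambda>x\<in>A. P x \<oplus> Q x) a = (\<lambda>x\<in>A. com A P a x \<oplus> com A Q a x)"
      unfolding com_def by (rule restrict_ext) (simp add: minus_eq r_distr minus_add a_ac)
    then show "com A (\<lambda>x\<in>A. P x \<oplus> Q x) a \<in> dop A n"
      using Suc.IH[OF dop_com[OF Suc.prems(1)] dop_com[OF Suc.prems(2)]] by simp
  qed
qed

lemma dop_lmult: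
  assumes "k_subring A" "l \<in> carrier L"
  shows "P \<in> dop A n \<Longrightarrow> (\<lambda>x\<in>A. l \<otimes> P x) \<in> dop A n"
proof (induction n arbitrary: P)
  case 0
  then show ?case using assms by (auto intro!: restrict_ext)
next
  case (Suc n)
  have l: "P \<in> lin A" using Suc.prems by auto
  note [simp] = k_subringD[OF assms(1)] linD[OF l] assms(2)
  show ?case
  proof (rule dop_SucI[OF lin_lmult[OF assms(1) l assms(2)]])
    fix a assume [simp]: "a \<in> A"
    have "com A (\<lambda>x\<in>A. l \<otimes> P x) a = (\<lambda>x\<in>A. l \<otimes> com A P a x)"
      unfolding com_def by (rule restrict_ext) (simp add: minus_eq r_distr r_minus m_lcomm)
    then show "com A (\<lambda>x\<in>A. l \<otimes> P x) a \<in> dop A n"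
      using Suc.IH[OF dop_com[OF Suc.prems(1)]] by simp
  qed
qed

lemma dop_rmult:
  assumes "k_subring A" "b \<in> A"
  shows "P \<in> dop A n \<Longrightarrow> (\<lambda>x\<in>A. P (b \<otimes> x)) \<in> dop A n"
proof (induction n arbitrary: P)
  case 0
  then show ?case using assms by (auto intro!: restrict_ext simp: k_subringD)
next
  case (Suc n)
  have l: "P \<in> lin A" using Suc.prems by auto
  note [simp] = k_subringD[OF assms(1)] linD[OF l] assms(2)
  show ?case
  proof (rule dop_SucI[OF lin_rmult[OF assms(1) l assms(2)]])
    fix a assume [simp]: "a \<in> A"
    have "com A (\<lambda>x\<in>A. P (b \<otimes> x)) a = (\<lambda>x\<in>A. com A P a (b \<otimes> x))"
      unfolding com_def by (rule restrict_ext) (simp add: m_lcomm)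
    then show "com A (\<lambda>x\<in>A. P (b \<otimes> x)) a \<in> dop A n"
      using Suc.IH[OF dop_com[OF Suc.prems(1)]] by simp
  qed
qed

lemma dop_minus:
  assumes "k_subring A" "P \<in> dop A n" "Q \<in> dop A n"
  shows "(\<lambda>x\<in>A. P x \<ominus> Q x) \<in> dop A n"
proof -
  note [simp] = k_subringD[OF assms(1)] linD[OF dop_lin[OF assms(1,2)]] linD[OF dop_lin[OF assms(1,3)]]
  have "(\<lambda>x\<in>A. P x \<ominus> Q x) = (\<lambda>x\<in>A. P x \<oplus> (\<lambda>x\<in>A. (\<ominus> \<one>) \<otimes> Q x) x)"
    by (rule restrict_ext) (simp add: minus_eq l_minus)
  then show ?thesis using dop_add[OF assms(1,2) dop_lmult[OF assms(1) _ assms(3), of "\<ominus> \<one>"]] by simp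
qed

lemma dop_sum:
  assumes "k_subring A" "\<And>i. i < r \<Longrightarrow> P i \<in> dop A n"
  shows "(\<lambda>x\<in>A. \<Oplus>i\<in>{..<r::nat}. P i x) \<in> dop A n"
  using assms(2)
proof (induction r)
  case 0
  then show ?case using dop_zero[OF assms(1)] by simp
next
  case (Suc r)
  have l: "\<And>i x. \<lbrakk>i < Suc r; x \<in> A\<rbrakk> \<Longrightarrow> P i x \<in> carrier L"
    using linD(2) dop_lin[OF assms(1) Suc.prems] by blast
  have "(\<lambda>x\<in>A. \<Oplus>i\<in>{..<Suc r}. P i x) = (\<lambda>x\<in>A. P r x \<oplus> (\<lambda>x\<in>A. \<Oplus>i\<in>{..<r}. P i x) x)"
    by (rule restrict_ext) (use l in \<open>simp add: lessThan_Suc finsum_insert Pi_def\<close>)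
  then show ?case using dop_add[OF assms(1) Suc.prems[of r] Suc.IH] Suc.prems by simp
qed

lemma com_restrict:
  assumes "B \<subseteq> A" "\<And>x. x \<in> B \<Longrightarrow> a \<otimes> x \<in> B"
  shows "com B (restrict P B) a = restrict (com A P a) B"
  unfolding com_def using assms by (auto simp: Int_absorb1 intro!: restrict_ext)

lemma dop_restrict:
  assumes "k_subring A" "k_subring B" "B \<subseteq> A"
  shows "P \<in> dop A n \<Longrightarrow> restrict P B \<in> dop B n"
proof (induction n arbitrary: P)
  case 0
  then show ?case using assms(3) by (simp add: Int_absorb1)
next
  case (Suc n)
  have l: "P \<in> lin A" using Suc.prems by auto
  note [simp] = linD[OF l] k_subringD[OF assms(2)] subsetD[OF assms(3)]
  show ?case
  proof (rule dop_SucI)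
    show "restrict P B \<in> lin B" by (rule linI) simp_all
    fix a assume [simp]: "a \<in> B"
    show "com B (restrict P B) a \<in> dop B n"
      using Suc.IH[OF dop_com[OF Suc.prems, of a]] by (simp add: com_restrict[OF assms(3)])
  qed
qed

section \<open>The ring of differential operators\<close>

abbreviation "CL \<equiv> carrier L"
abbreviation "DL \<equiv> carrier (diff_ops L k)"

lemma minus_telescope:
  assumes "x \<in> carrier L" "y \<in> carrier L" "z \<in> carrier L"
  shows "x \<ominus> z = (x \<ominus> y) \<oplus> (y \<ominus> z)"
  using assms by algebra

lemma lin_compose:
  assumes "P \<in> lin CL" "Q \<in> lin CL" shows "compose CL P Q \<in> lin CL"
  by (rule linI) (use assms in \<open>simp_all add: linD compose_def k_in_carrier\<close>)

text \<open>Leibniz rule \<open>[PQ, a] = P[Q, a] + [P, a]Q\<close> and induction on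
  \<open>m + n\<close>. Because of the index shift \<open>m + n\<close> is one more than the sharp
  bound for positive \<open>m\<close> and \<open>n\<close>; in exchange the cases of index 0, where
  an operator is zero, need no separate statement.\<close>

lemma dop_compose:
  "\<lbrakk>P \<in> dop CL m; Q \<in> dop CL n\<rbrakk> \<Longrightarrow> compose CL P Q \<in> dop CL (m + n)"
proof (induction "m + n" arbitrary: P Q m n)
  case 0
  then show ?case by (auto simp: compose_def intro!: restrict_ext)
next
  case (Suc s)
  note A = k_subring_carrier
  have l: "P \<in> lin CL" "Q \<in> lin CL" using Suc.prems dop_lin[OF A] by blast+
  note [simp] = linD[OF l(1)] linD[OF l(2)]
  have "com CL (compose CL P Q) a \<in> dop CL s" if [simp]: "a \<in> CL" for a
  proof -
    have "com CL (compose CL P Q) a =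
        (\<lambda>x\<in>CL. compose CL P (com CL Q a) x \<oplus> compose CL (com CL P a) Q x)"
      unfolding com_def compose_def
      by (rule restrict_ext)
        (simp add: additive_minus[OF l(1) A] minus_telescope[symmetric])
    moreover have "compose CL P (com CL Q a) \<in> dop CL s"
    proof (cases n)
      case 0
      then have "compose CL P (com CL Q a) = (\<lambda>x\<in>CL. \<zero>)"
        using Suc.prems(2) unfolding compose_def com_def
        by (intro restrict_ext) (simp add: minus_eq additive_zero[OF l(1) A])
      then show ?thesis using dop_zero[OF A] by simp
    next
      case (Suc n')
      then show ?thesis using Suc.hyps(1)[of m n'] Suc.hyps(2) Suc.prems dop_com[of Q CL n' a]
        by (simp del: dop.simps)
    qed
    moreover have "compose CL (com CL P a) Q \<in> dop CL s"
    proof (cases m)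
      case 0
      then have "compose CL (com CL P a) Q = (\<lambda>x\<in>CL. \<zero>)"
        using Suc.prems(1) unfolding compose_def com_def
        by (intro restrict_ext) (simp add: minus_eq)
      then show ?thesis using dop_zero[OF A] by simp
    next
      case (Suc m')
      then show ?thesis using Suc.hyps(1)[of m' n] Suc.hyps(2) Suc.prems dop_com[of P CL m' a]
        by (simp del: dop.simps)
    qed
    ultimately show ?thesis using dop_add[OF A] by simp
  qed
  then show ?case using lin_compose[OF l] Suc.hyps(2) by (metis dop_SucI)
qed

lemma linear_endos_eq_lin: "linear_endos L k = lin CL"
  unfolding linear_endos_def lin_def hom_def by auto

lemma diff_ops_upto_eq: "diff_ops_upto L k n = dop CL (Suc n)"
proof (induction n)
  case 0
  then show ?case by (auto simp: linear_endos_eq_lin commutator_def com_def)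
next
  case (Suc n)
  then show ?case by (simp add: linear_endos_eq_lin commutator_def com_def)
qed

lemma diff_ops_carrier: "carrier (diff_ops L k) = (\<Union>n. dop CL n)"
proof -
  have "(\<Union>n. dop CL (Suc n)) = (\<Union>n. dop CL n)"
    using dop_Suc_mono[OF k_subring_carrier] by (force simp del: dop.simps)
  then show ?thesis by (simp add: diff_ops_def diff_ops_upto_eq del: dop.simps)
qed

lemma diff_ops_lin: "P \<in> carrier (diff_ops L k) \<Longrightarrow> P \<in> lin CL"
  using dop_lin[OF k_subring_carrier] by (auto simp: diff_ops_carrier)

lemma mult_op_dop: "a \<in> CL \<Longrightarrow> mult_op L a \<in> dop CL (Suc 0)"
  unfolding mult_op_def
  by (auto intro!: linI restrict_ext simp: com_def r_distr m_ac k_in_carrier minus_eq r_neg)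

lemma mult_op_diff_ops: "a \<in> CL \<Longrightarrow> mult_op L a \<in> carrier (diff_ops L k)"
  using mult_op_dop by (auto simp: diff_ops_carrier simp del: dop.simps)

lemma diff_ops_add:
  assumes "P \<in> carrier (diff_ops L k)" "Q \<in> carrier (diff_ops L k)"
  shows "(\<lambda>x\<in>CL. P x \<oplus> Q x) \<in> carrier (diff_ops L k)"
proof -
  obtain m n where "P \<in> dop CL m" "Q \<in> dop CL n" using assms by (auto simp: diff_ops_carrier)
  then have "P \<in> dop CL (max m n)" "Q \<in> dop CL (max m n)" using dop_mono[OF k_subring_carrier] by auto
  then show ?thesis using dop_add[OF k_subring_carrier] by (auto simp: diff_ops_carrier)
qed

lemma diff_ops_compose:
  assumes "P \<in> carrier (diff_ops L k)" "Q \<in> carrier (diff_ops L k)"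
  shows "compose CL P Q \<in> carrier (diff_ops L k)"
  using assms dop_compose by (fastforce simp: diff_ops_carrier)

lemma diff_ops_simps:
  "monoid.mult (diff_ops L k) = compose CL" "one (diff_ops L k) = (\<lambda>x\<in>CL. x)"
  "ring.zero (diff_ops L k) = (\<lambda>x\<in>CL. \<zero>)" "add (diff_ops L k) = (\<lambda>P Q. \<lambda>x\<in>CL. P x \<oplus> Q x)"
  by (simp_all add: diff_ops_def)

lemma ring_diff_ops: "ring (diff_ops L k)"
proof (rule ringI)
  have lmult: "(\<lambda>x\<in>CL. l \<otimes> P x) \<in> carrier (diff_ops L k)"
    if "P \<in> carrier (diff_ops L k)" "l \<in> CL" for P l
    using that dop_lmult[OF k_subring_carrier] by (fastforce simp: diff_ops_carrier)
  have zero: "(\<lambda>x\<in>CL. \<zero>) \<in> carrier (diff_ops L k)"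
    using dop_zero[OF k_subring_carrier] by (auto simp: diff_ops_carrier)
  have one: "(\<lambda>x\<in>CL. x) \<in> carrier (diff_ops L k)"
    using mult_op_diff_ops[of \<one>] by (simp add: mult_op_def cong: restrict_cong)
  show "abelian_group (diff_ops L k)"
  proof (rule abelian_groupI, goal_cases)
    case (6 P)
    have "(\<lambda>x\<in>CL. (\<lambda>x\<in>CL. (\<ominus> \<one>) \<otimes> P x) x \<oplus> P x) = (\<lambda>x\<in>CL. \<zero>)"
      by (rule restrict_ext) (use linD[OF diff_ops_lin[OF 6]] in \<open>simp add: l_minus l_neg\<close>)
    then show ?case using lmult[OF 6, of "\<ominus> \<one>"] by (auto simp: diff_ops_simps)
  qed (auto simp: diff_ops_simps diff_ops_add zero linD[OF diff_ops_lin] a_ac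
         intro!: restrict_ext extensionalityI[of _ CL])
  show "monoid (diff_ops L k)"
  proof (rule monoidI, goal_cases)
    case (1 P Q)
    then show ?case using diff_ops_compose by (simp add: diff_ops_simps)
  qed (auto simp: diff_ops_simps one compose_def linD[OF diff_ops_lin]
         intro!: restrict_ext extensionalityI[of _ CL])
qed (auto simp: diff_ops_simps compose_def linD[OF diff_ops_lin] intro!: restrict_ext)

lemma diff_ops_sum:
  assumes "\<And>i. i < n \<Longrightarrow> P i \<in> DL"
  shows "(\<lambda>x\<in>CL. \<Oplus>i\<in>{..<n::nat}. P i x) \<in> DL"
  using assms
proof (induction n)
  case 0
  then show ?case using dop_zero[OF k_subring_carrier] by (auto simp: diff_ops_carrier simp del: dop.simps)
next
  case (Suc n)
  have c: "P i x \<in> CL" if "i < Suc n" "x \<in> CL" for i x using linD(2)[OF diff_ops_lin] Suc.prems that by blast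
  have "(\<lambda>x\<in>CL. \<Oplus>i\<in>{..<Suc n}. P i x) = (\<lambda>x\<in>CL. (\<lambda>x\<in>CL. \<Oplus>i\<in>{..<n}. P i x) x \<oplus> P n x)"
    by (rule restrict_ext) (use c in \<open>simp add: sum_Suc\<close>)
  then show ?case using diff_ops_add[OF Suc.IH] Suc.prems by simp
qed

lemma mult_minus:
  "\<lbrakk>x \<in> CL; y \<in> CL; z \<in> CL\<rbrakk> \<Longrightarrow> x \<otimes> (y \<ominus> z) = x \<otimes> y \<ominus> x \<otimes> z"
  by (simp add: minus_eq r_distr r_minus)

lemma minus_telescope_rev:
  "\<lbrakk>x \<in> CL; y \<in> CL; z \<in> CL\<rbrakk> \<Longrightarrow> (y \<ominus> z) \<oplus> (x \<ominus> y) = x \<ominus> z"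
  using minus_telescope[of x y z] by (simp add: a_comm)

lemma minus_minus_cancel:
  assumes "x \<in> CL" "y \<in> CL" shows "x \<ominus> (x \<ominus> y) = y"
  using assms by algebra

end

section \<open>Separating elements of a cyclic extension\<close>

text \<open>The Galois group is replaced by a generator \<open>g\<close> acting on \<open>L\<close>,
  its exact order \<open>d\<close> and its fixed field \<open>K\<close>. The assumption
  \<open>g_less\<close> supplies the elements moved by the smaller powers, from which the separating
  elements are built.\<close>

locale cyclic_extension = k_field +
  fixes K :: "'a set" and g :: "'a \<Rightarrow> 'a" and d :: nat
  assumes K_subfield: "subfield K L" and k_sub_K: "k \<subseteq> K"
    and g_iso: "g \<in> ring_iso L L"
    and d_pos: "0 < d" and g_d: "\<And>x. x \<in> carrier L \<Longrightarrow> (g ^^ d) x = x"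
    and g_less: "\<And>j. \<lbrakk>0 < j; j < d\<rbrakk> \<Longrightarrow> \<exists>x\<in>carrier L. (g ^^ j) x \<noteq> x"
    and K_eq: "K = {x \<in> carrier L. g x = x}"
begin

lemma k_subring_K: "k_subring K"
  using K_subfield k_sub_K subfieldE(1) by (auto simp: k_subring_def)

lemma K_carrier: "x \<in> K \<Longrightarrow> x \<in> CL"
  using K_eq by blast

lemma pow_g:
  shows pow_closed: "x \<in> CL \<Longrightarrow> (g ^^ j) x \<in> CL"
    and pow_add: "\<lbrakk>x \<in> CL; y \<in> CL\<rbrakk> \<Longrightarrow> (g ^^ j) (x \<oplus> y) = (g ^^ j) x \<oplus> (g ^^ j) y"
    and pow_mult: "\<lbrakk>x \<in> CL; y \<in> CL\<rbrakk> \<Longrightarrow> (g ^^ j) (x \<otimes> y) = (g ^^ j) x \<otimes> (g ^^ j) y"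
    and pow_one: "(g ^^ j) \<one> = \<one>"
    and pow_K: "x \<in> K \<Longrightarrow> (g ^^ j) x = x"
proof -
  have *: "\<And>x. x \<in> CL \<Longrightarrow> g x \<in> CL" "\<And>x y. \<lbrakk>x \<in> CL; y \<in> CL\<rbrakk> \<Longrightarrow> g (x \<oplus> y) = g x \<oplus> g y"
    "\<And>x y. \<lbrakk>x \<in> CL; y \<in> CL\<rbrakk> \<Longrightarrow> g (x \<otimes> y) = g x \<otimes> g y" "g \<one> = \<one>"
    "\<And>x. x \<in> K \<Longrightarrow> g x = x"
    using g_iso K_eq by (auto simp: ring_iso_def ring_hom_def)
  show c: "x \<in> CL \<Longrightarrow> (g ^^ j) x \<in> CL" for x j by (induction j) (simp_all add: *)
  show "\<lbrakk>x \<in> CL; y \<in> CL\<rbrakk> \<Longrightarrow> (g ^^ j) (x \<oplus> y) = (g ^^ j) x \<oplus> (g ^^ j) y"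
    "\<lbrakk>x \<in> CL; y \<in> CL\<rbrakk> \<Longrightarrow> (g ^^ j) (x \<otimes> y) = (g ^^ j) x \<otimes> (g ^^ j) y"
    "(g ^^ j) \<one> = \<one>" "x \<in> K \<Longrightarrow> (g ^^ j) x = x"
    by (induction j) (simp_all add: * c)
qed

lemma pow_lin: "restrict (g ^^ j) CL \<in> lin CL"
  using k_sub_K by (intro linI) (auto simp: pow_g k_in_carrier)

lemma pow_zero: "(g ^^ j) \<zero> = \<zero>"
  using additive_zero[OF pow_lin k_subring_carrier, of j] by simp

lemma pow_sum:
  "(\<And>i. i < n \<Longrightarrow> f i \<in> CL) \<Longrightarrow> (g ^^ j) (\<Oplus>i\<in>{..<n::nat}. f i) = (\<Oplus>i\<in>{..<n}. (g ^^ j) (f i))"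
  by (rule hom_sum) (auto simp: pow_zero hom_def pow_g abelian_monoid_axioms)

text \<open>The Chase--Harrison--Rosenberg elements: \<open>\<Sum>\<^sub>i a\<^sub>i \<otimes> b\<^sub>i\<close> is the idempotent of \<open>L \<otimes>\<^sub>K L\<close> that
  cuts out the diagonal. It is built as a product over \<open>j\<close> of elements
  \<open>(g\<^sup>j y \<otimes> 1 - 1 \<otimes> y) / (g\<^sup>j y - y)\<close>.\<close>

definition separating :: "nat \<times> (nat \<Rightarrow> 'a) \<times> (nat \<Rightarrow> 'a) \<Rightarrow> bool"
  where "separating = (\<lambda>(r, a, b). (\<forall>i<r. a i \<in> CL \<and> b i \<in> CL) \<and>
    (\<forall>j<d. (\<Oplus>i\<in>{..<r}. a i \<otimes> (g ^^ j) (b i)) = (if j = 0 then \<one> else \<zero>)))"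

lemma exists_separating: "\<exists>f. separating f"
proof -
  have "m < d \<Longrightarrow> \<exists>r a b. (\<forall>i<r. a i \<in> CL \<and> b i \<in> CL) \<and>
    (\<forall>j\<le>m. (\<Oplus>i\<in>{..<r::nat}. a i \<otimes> (g ^^ j) (b i)) = (if j = 0 then \<one> else \<zero>))" for m
  proof (induction m)
    case 0
    show ?case
      by (rule exI[of _ "Suc 0"], rule exI[of _ "\<lambda>_. \<one>"], rule exI[of _ "\<lambda>_. \<one>"]) (simp add: sum_Suc)
  next
    case (Suc m)
    then obtain r a b where ab: "\<And>i. i < r \<Longrightarrow> a i \<in> CL" "\<And>i. i < r \<Longrightarrow> b i \<in> CL"
      and s: "\<And>j. j \<le> m \<Longrightarrow> (\<Oplus>i\<in>{..<r::nat}. a i \<otimes> (g ^^ j) (b i)) = (if j = 0 then \<one> else \<zero>)"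
      by auto
    obtain y where y: "y \<in> CL" "(g ^^ Suc m) y \<noteq> y" using g_less Suc.prems by blast
    define z where "z = (g ^^ Suc m) y"
    define w where "w = inv (z \<ominus> y)"
    have z: "z \<in> CL" unfolding z_def using pow_closed[OF y(1)] .
    have "z \<ominus> y \<noteq> \<zero>" using y z r_right_minus_eq unfolding z_def by blast
    then have w: "w \<in> CL" "w \<otimes> (z \<ominus> y) = \<one>"
      unfolding w_def using y(1) z field_Units by auto
    \<comment> \<open>In \<open>L \<otimes> L\<close> the old element is multiplied by
      \<open>w z \<otimes> 1 - w \<otimes> y\<close>. Under \<open>1 \<otimes> g^j\<close> followed
      by multiplication this factor becomes \<open>w (z - g^j y)\<close>, which is 1 for
      \<open>j = 0\<close> by the choice of \<open>w\<close> and 0 for \<open>j = Suc m\<close> by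
      the choice of \<open>z\<close>; the indices in between stay 0.\<close>
    define a' where "a' i = (if i < r then w \<otimes> z \<otimes> a i else \<ominus> (w \<otimes> a (i - r)))" for i
    define b' where "b' i = (if i < r then b i else y \<otimes> b (i - r))" for i
    have sum: "(\<Oplus>i\<in>{..<r + r}. a' i \<otimes> (g ^^ j) (b' i)) =
      w \<otimes> (z \<ominus> (g ^^ j) y) \<otimes> (\<Oplus>i\<in>{..<r}. a i \<otimes> (g ^^ j) (b i))" for j
    proof -
      note [simp] = ab y(1) z w(1) pow_closed pow_mult
      have "(\<Oplus>i\<in>{..<r + r}. a' i \<otimes> (g ^^ j) (b' i)) =
        (\<Oplus>i\<in>{..<r}. w \<otimes> z \<otimes> a i \<otimes> (g ^^ j) (b i)) \<oplus>
        (\<Oplus>i\<in>{..<r}. \<ominus> (w \<otimes> a i) \<otimes> (g ^^ j) (y \<otimes> b i))"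
        by (subst sum_append) (auto simp: a'_def b'_def intro!: arg_cong2[of _ _ _ _ "add L"] sum_cong)
      also have "\<dots> = (\<Oplus>i\<in>{..<r}. w \<otimes> z \<otimes> a i \<otimes> (g ^^ j) (b i) \<oplus> \<ominus> (w \<otimes> a i) \<otimes> (g ^^ j) (y \<otimes> b i))"
        by (subst finsum_addf) auto
      also have "\<dots> = (\<Oplus>i\<in>{..<r}. w \<otimes> (z \<ominus> (g ^^ j) y) \<otimes> (a i \<otimes> (g ^^ j) (b i)))"
        by (rule sum_cong) (simp_all add: minus_eq l_distr r_distr l_minus r_minus m_ac)
      also have "\<dots> = w \<otimes> (z \<ominus> (g ^^ j) y) \<otimes> (\<Oplus>i\<in>{..<r}. a i \<otimes> (g ^^ j) (b i))"
        by (subst finsum_rdistr) auto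
      finally show ?thesis .
    qed
    show ?case
    proof (rule exI[of _ "r + r"], rule exI[of _ a'], rule exI[of _ b'], intro conjI allI impI)
      fix j assume j: "j \<le> Suc m"
      show "(\<Oplus>i\<in>{..<r + r}. a' i \<otimes> (g ^^ j) (b' i)) = (if j = 0 then \<one> else \<zero>)"
      proof (cases "j = Suc m")
        case True
        have "z \<ominus> (g ^^ j) y = \<zero>" unfolding True z_def[symmetric] using z by (simp add: minus_eq r_neg)
        moreover have "(\<Oplus>i\<in>{..<r}. a i \<otimes> (g ^^ j) (b i)) \<in> CL" using ab by (intro sum_closed) (simp add: pow_closed)
        ultimately show ?thesis unfolding sum using True w by simp
      next
        case False
        then have "(\<Oplus>i\<in>{..<r}. a i \<otimes> (g ^^ j) (b i)) = (if j = 0 then \<one> else \<zero>)" using s j by simp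
        then show ?thesis unfolding sum using w y(1) z by (auto simp: pow_closed)
      qed
    qed (use ab y(1) z w(1) in \<open>auto simp: a'_def b'_def\<close>)
  qed
  note * = this[of "d - 1"]
  have "j < d \<longleftrightarrow> j \<le> d - 1" for j using d_pos by auto
  then show ?thesis using * unfolding separating_def by auto
qed

definition "family = (SOME f. separating f)"
definition "sn = fst family"
definition "sa = fst (snd family)"
definition "sb = snd (snd family)"

lemma ab: "separating (sn, sa, sb)"
  unfolding sn_def sa_def sb_def family_def using someI_ex[OF exists_separating] by simp

lemma sa_closed: "i < sn \<Longrightarrow> sa i \<in> CL" and sb_closed: "i < sn \<Longrightarrow> sb i \<in> CL"
  and ab_sum: "j < d \<Longrightarrow> (\<Oplus>i\<in>{..<sn}. sa i \<otimes> (g ^^ j) (sb i)) = (if j = 0 then \<one> else \<zero>)"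
  using ab unfolding separating_def by auto

text \<open>The idempotent is symmetric: for \<open>j > 0\<close> the sum arises from the one with
  exponent \<open>d - j\<close> by applying \<open>g^j\<close>. With this every element can be
  expanded in the b_i as well as in the a_i.\<close>

lemma ba_sum:
  assumes "j < d" shows "(\<Oplus>i\<in>{..<sn}. sb i \<otimes> (g ^^ j) (sa i)) = (if j = 0 then \<one> else \<zero>)"
proof (cases "j = 0")
  case True
  then have "(\<Oplus>i\<in>{..<sn}. sb i \<otimes> (g ^^ j) (sa i)) = (\<Oplus>i\<in>{..<sn}. sa i \<otimes> (g ^^ 0) (sb i))"
    by (intro sum_cong) (auto simp: sa_closed sb_closed m_comm)
  then show ?thesis using ab_sum[of 0] True d_pos by simp
next
  case False
  have "(\<Oplus>i\<in>{..<sn}. sb i \<otimes> (g ^^ j) (sa i)) = (\<Oplus>i\<in>{..<sn}. (g ^^ j) (sa i \<otimes> (g ^^ (d - j)) (sb i)))"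
  proof (rule sum_cong)
    fix i assume i: "i < sn"
    have "(g ^^ j) ((g ^^ (d - j)) (sb i)) = sb i"
      using g_d[OF sb_closed[OF i]] assms funpow_add[of j "d - j" g] by simp
    then show "sb i \<otimes> (g ^^ j) (sa i) = (g ^^ j) (sa i \<otimes> (g ^^ (d - j)) (sb i))"
      using i by (simp add: pow_g sa_closed sb_closed m_comm)
  qed (simp add: pow_g sa_closed sb_closed)
  also have "\<dots> = (g ^^ j) (\<Oplus>i\<in>{..<sn}. sa i \<otimes> (g ^^ (d - j)) (sb i))"
    by (rule pow_sum[symmetric]) (simp add: pow_g sa_closed sb_closed)
  also have "\<dots> = \<zero>" using ab_sum[of "d - j"] False assms by (simp add: pow_zero)
  finally show ?thesis using False by simp
qed

section \<open>The trace and expansions with trace coefficients\<close>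

definition tr :: "'a \<Rightarrow> 'a" where "tr y = (\<Oplus>j\<in>{..<d}. (g ^^ j) y)"

lemma tr_K: assumes "y \<in> CL" shows "tr y \<in> K"
proof -
  have c: "tr y \<in> CL" unfolding tr_def using assms by (simp add: sum_closed pow_closed)
  have "g (tr y) = (\<Oplus>j\<in>{..<d}. (g ^^ Suc j) y)"
    unfolding tr_def using pow_sum[of d "\<lambda>j. (g ^^ j) y" 1] assms by (simp add: pow_closed)
  also have "\<dots> = tr y"
    unfolding tr_def using assms g_d by (intro sum_rotate) (auto simp: pow_closed simp del: funpow.simps)
  finally show ?thesis using c K_eq by simp
qed

lemma tr_closed: "y \<in> CL \<Longrightarrow> tr y \<in> CL"
  using tr_K K_carrier by blast

lemma tr_add: "\<lbrakk>x \<in> CL; y \<in> CL\<rbrakk> \<Longrightarrow> tr (x \<oplus> y) = tr x \<oplus> tr y"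
  unfolding tr_def by (simp add: pow_g finsum_addf)

lemma tr_K_mult: "\<lbrakk>x \<in> K; y \<in> CL\<rbrakk> \<Longrightarrow> tr (x \<otimes> y) = x \<otimes> tr y"
  unfolding tr_def by (simp add: pow_g K_carrier finsum_rdistr)

lemma tr_zero: "tr \<zero> = \<zero>"
  unfolding tr_def by (simp add: pow_zero finsum_zero)

lemma tr_minus: assumes "x \<in> CL" "y \<in> CL" shows "tr (x \<ominus> y) = tr x \<ominus> tr y"
proof -
  have "restrict tr CL \<in> lin CL"
    using k_sub_K by (intro linI) (auto simp: tr_closed tr_add tr_K_mult k_in_carrier)
  from additive_minus[OF this k_subring_carrier assms] assms show ?thesis by simp
qed

text \<open>After exchanging the sums the coefficient of g^j y is the sum of the u_i g^j(v_i), which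
  is 1 for \<open>j = 0\<close> and 0 otherwise. So the u_i and the functionals tr(v_i y) behave
  like dual bases of \<open>L\<close> over \<open>K\<close>, although the u_i may be
  dependent.\<close>

lemma expand:
  assumes "\<And>i. i < sn \<Longrightarrow> u i \<in> CL" "\<And>i. i < sn \<Longrightarrow> v i \<in> CL" "y \<in> CL"
    "\<And>j. j < d \<Longrightarrow> (\<Oplus>i\<in>{..<sn}. u i \<otimes> (g ^^ j) (v i)) = (if j = 0 then \<one> else \<zero>)"
  shows "(\<Oplus>i\<in>{..<sn}. u i \<otimes> tr (v i \<otimes> y)) = y"
proof -
  note [simp] = assms(1-3) pow_g
  have "(\<Oplus>i\<in>{..<sn}. u i \<otimes> tr (v i \<otimes> y)) = (\<Oplus>i\<in>{..<sn}. \<Oplus>j\<in>{..<d}. u i \<otimes> (g ^^ j) (v i) \<otimes> (g ^^ j) y)"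
    unfolding tr_def by (intro sum_cong) (auto simp: finsum_rdistr m_assoc intro!: sum_closed sum_cong)
  also have "\<dots> = (\<Oplus>j\<in>{..<d}. \<Oplus>i\<in>{..<sn}. u i \<otimes> (g ^^ j) (v i) \<otimes> (g ^^ j) y)"
    by (rule finsum_finsum_swap) auto
  also have "\<dots> = (\<Oplus>j\<in>{..<d}. if j = 0 then y else \<zero>)"
  proof (rule sum_cong)
    fix j assume "j < d"
    have "(\<Oplus>i\<in>{..<sn}. u i \<otimes> (g ^^ j) (v i) \<otimes> (g ^^ j) y) = (\<Oplus>i\<in>{..<sn}. u i \<otimes> (g ^^ j) (v i)) \<otimes> (g ^^ j) y"
      by (subst finsum_ldistr) auto
    then show "(\<Oplus>i\<in>{..<sn}. u i \<otimes> (g ^^ j) (v i) \<otimes> (g ^^ j) y) = (if j = 0 then y else \<zero>)"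
      using assms(4)[OF \<open>j < d\<close>] by simp
  qed simp
  also have "\<dots> = y" using d_pos by (simp add: sum_delta)
  finally show ?thesis .
qed

lemma expand_a: "y \<in> CL \<Longrightarrow> (\<Oplus>i\<in>{..<sn}. sa i \<otimes> tr (sb i \<otimes> y)) = y"
  by (rule expand) (auto simp: sa_closed sb_closed ab_sum)

lemma expand_b: "y \<in> CL \<Longrightarrow> (\<Oplus>i\<in>{..<sn}. sb i \<otimes> tr (sa i \<otimes> y)) = y"
  by (rule expand) (auto simp: sa_closed sb_closed ba_sum)

text \<open>If the trace vanished, the expansion of 1 would give 1 = 0. An invertible trace is what
  later recovers an invariant vector from its trace multiples.\<close>

lemma tr_nonzero: "\<exists>y\<in>CL. tr y \<noteq> \<zero>"
proof (rule ccontr)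
  assume "\<not> ?thesis"
  then have "(\<Oplus>i\<in>{..<sn}. sa i \<otimes> tr (sb i \<otimes> \<one>)) = (\<Oplus>i\<in>{..<sn}. \<zero>)"
    by (intro sum_cong) (auto simp: sa_closed sb_closed)
  then show False using expand_a[of \<one>] by (simp add: finsum_zero)
qed

end

section \<open>Extension of differential operators\<close>

context cyclic_extension
begin

text \<open>The separability idempotent applied to \<open>P\<close>, with the a_i multiplying on the
  left and the b_i on the right. It fixes \<open>L\<close>-linear maps, since the a_i b_i sum to 1,
  and turns \<open>K\<close>-linear maps into \<open>L\<close>-linear ones.\<close>

definition avg :: "('a \<Rightarrow> 'a) \<Rightarrow> 'a \<Rightarrow> 'a"
  where "avg P = (\<lambda>x\<in>CL. \<Oplus>i\<in>{..<sn}. sa i \<otimes> P (sb i \<otimes> x))"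

lemma lin_avg: assumes "P \<in> lin CL" shows "avg P \<in> lin CL"
proof (rule linI)
  note [simp] = linD[OF assms] sa_closed sb_closed k_in_carrier
  show "avg P x \<in> CL" if "x \<in> CL" for x using that by (simp add: avg_def sum_closed)
  show "avg P (x \<oplus> y) = avg P x \<oplus> avg P y" if "x \<in> CL" "y \<in> CL" for x y
  proof -
    have "(\<Oplus>i\<in>{..<sn}. sa i \<otimes> P (sb i \<otimes> (x \<oplus> y))) =
        (\<Oplus>i\<in>{..<sn}. sa i \<otimes> P (sb i \<otimes> x) \<oplus> sa i \<otimes> P (sb i \<otimes> y))"
      using that by (intro sum_cong) (simp_all add: r_distr)
    also have "\<dots> = (\<Oplus>i\<in>{..<sn}. sa i \<otimes> P (sb i \<otimes> x)) \<oplus> (\<Oplus>i\<in>{..<sn}. sa i \<otimes> P (sb i \<otimes> y))"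
      using that by (intro finsum_addf) auto
    finally show ?thesis using that by (simp add: avg_def)
  qed
  show "avg P (c \<otimes> x) = c \<otimes> avg P x" if "c \<in> k" "x \<in> CL" for c x
  proof -
    have "sa i \<otimes> P (sb i \<otimes> (c \<otimes> x)) = c \<otimes> (sa i \<otimes> P (sb i \<otimes> x))" if "i < sn" for i
    proof -
      have "sb i \<otimes> (c \<otimes> x) = c \<otimes> (sb i \<otimes> x)"
        using that \<open>c \<in> k\<close> \<open>x \<in> CL\<close> by (simp add: m_lcomm)
      then show ?thesis using that \<open>c \<in> k\<close> \<open>x \<in> CL\<close> by (simp add: m_lcomm)
    qed
    then have "(\<Oplus>i\<in>{..<sn}. sa i \<otimes> P (sb i \<otimes> (c \<otimes> x))) = (\<Oplus>i\<in>{..<sn}. c \<otimes> (sa i \<otimes> P (sb i \<otimes> x)))"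
      using that by (intro sum_cong) auto
    also have "\<dots> = c \<otimes> (\<Oplus>i\<in>{..<sn}. sa i \<otimes> P (sb i \<otimes> x))"
      using that by (subst finsum_rdistr) auto
    finally show ?thesis using that by (simp add: avg_def)
  qed
qed (simp add: avg_def)

text \<open>The same coefficients \<open>t i j\<close> in \<open>K\<close> express b_i y through the
  b_j and y a_j through the a_i. Hence both terms of the commutator become double sums that can be
  compared term by term, and a commutator with an arbitrary element of \<open>L\<close> is reduced
  to commutators of \<open>P\<close> with elements of \<open>K\<close>.\<close>

lemma com_avg:
  assumes "P \<in> lin CL" "x \<in> CL" "y \<in> CL"
  shows "com CL (avg P) y x =
    (\<Oplus>i\<in>{..<sn}. \<Oplus>j\<in>{..<sn}. sa i \<otimes> com CL P (tr (sa j \<otimes> (sb i \<otimes> y))) (sb j \<otimes> x))"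
proof -
  note [simp] = linD[OF assms(1)] assms(2,3) sa_closed sb_closed tr_closed
  define t where "t i j = tr (sa j \<otimes> (sb i \<otimes> y))" for i j
  have t [simp]: "\<lbrakk>i < sn; j < sn\<rbrakk> \<Longrightarrow> t i j \<in> CL" for i j by (simp add: t_def)
  have e1: "P (sb i \<otimes> (y \<otimes> x)) = (\<Oplus>j\<in>{..<sn}. P (t i j \<otimes> (sb j \<otimes> x)))" if i: "i < sn" for i
  proof -
    have "sb i \<otimes> (y \<otimes> x) = (\<Oplus>j\<in>{..<sn}. sb j \<otimes> t i j) \<otimes> x"
      unfolding t_def using i by (subst expand_b) (simp_all add: m_assoc)
    also have "\<dots> = (\<Oplus>j\<in>{..<sn}. t i j \<otimes> (sb j \<otimes> x))"
      using i by (subst finsum_ldistr) (auto intro!: sum_cong simp: m_ac)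
    finally show ?thesis using additive_sum(2)[OF assms(1) k_subring_carrier, of sn "\<lambda>j. t i j \<otimes> (sb j \<otimes> x)"] i by simp
  qed
  have e2: "y \<otimes> sa j = (\<Oplus>i\<in>{..<sn}. sa i \<otimes> t i j)" if j: "j < sn" for j
  proof -
    have "(\<Oplus>i\<in>{..<sn}. sa i \<otimes> t i j) = (\<Oplus>i\<in>{..<sn}. sa i \<otimes> tr (sb i \<otimes> (y \<otimes> sa j)))"
      using j by (intro sum_cong) (auto simp: t_def m_ac)
    then show ?thesis using expand_a[of "y \<otimes> sa j"] j by simp
  qed
  have "(\<Oplus>i\<in>{..<sn}. sa i \<otimes> P (sb i \<otimes> (y \<otimes> x))) =
      (\<Oplus>i\<in>{..<sn}. \<Oplus>j\<in>{..<sn}. sa i \<otimes> P (t i j \<otimes> (sb j \<otimes> x)))"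
    by (intro sum_cong) (auto simp: e1 finsum_rdistr intro!: sum_closed)
  moreover have "y \<otimes> (\<Oplus>j\<in>{..<sn}. sa j \<otimes> P (sb j \<otimes> x)) =
      (\<Oplus>i\<in>{..<sn}. \<Oplus>j\<in>{..<sn}. sa i \<otimes> (t i j \<otimes> P (sb j \<otimes> x)))"
  proof -
    have "y \<otimes> (\<Oplus>j\<in>{..<sn}. sa j \<otimes> P (sb j \<otimes> x)) = (\<Oplus>j\<in>{..<sn}. (y \<otimes> sa j) \<otimes> P (sb j \<otimes> x))"
      by (subst finsum_rdistr) (auto simp: m_assoc intro!: sum_cong)
    also have "\<dots> = (\<Oplus>j\<in>{..<sn}. \<Oplus>i\<in>{..<sn}. sa i \<otimes> (t i j \<otimes> P (sb j \<otimes> x)))"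
      by (rule sum_cong) (auto simp: e2 finsum_ldistr m_assoc intro!: sum_closed sum_cong)
    also have "\<dots> = (\<Oplus>i\<in>{..<sn}. \<Oplus>j\<in>{..<sn}. sa i \<otimes> (t i j \<otimes> P (sb j \<otimes> x)))"
      by (rule finsum_finsum_swap) auto
    finally show ?thesis .
  qed
  ultimately have "com CL (avg P) y x =
      (\<Oplus>i\<in>{..<sn}. (\<Oplus>j\<in>{..<sn}. sa i \<otimes> P (t i j \<otimes> (sb j \<otimes> x))) \<ominus>
        (\<Oplus>j\<in>{..<sn}. sa i \<otimes> (t i j \<otimes> P (sb j \<otimes> x))))"
    unfolding com_def avg_def by (subst sum_minus) (auto intro!: sum_closed)
  also have "\<dots> = (\<Oplus>i\<in>{..<sn}. \<Oplus>j\<in>{..<sn}. sa i \<otimes> com CL P (t i j) (sb j \<otimes> x))"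
  proof (rule sum_cong)
    fix i assume i: "i < sn"
    show "(\<Oplus>j\<in>{..<sn}. sa i \<otimes> P (t i j \<otimes> (sb j \<otimes> x))) \<ominus>
        (\<Oplus>j\<in>{..<sn}. sa i \<otimes> (t i j \<otimes> P (sb j \<otimes> x))) =
      (\<Oplus>j\<in>{..<sn}. sa i \<otimes> com CL P (t i j) (sb j \<otimes> x))"
      using i by (subst sum_minus[symmetric]) (auto intro!: sum_cong simp: com_def mult_minus)
  qed (auto simp: com_def intro!: sum_closed)
  finally show ?thesis unfolding t_def .
qed

text \<open>An operator that commutes with \<open>K\<close> differs from its average, which is \<open>L\<close>-linear, by
  commutators of smaller order.\<close>

lemma dop_K_linear_imp_linear:
  assumes "P \<in> dop CL n" "\<And>c x. \<lbrakk>c \<in> K; x \<in> CL\<rbrakk> \<Longrightarrow> P (c \<otimes> x) = c \<otimes> P x"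
    "x \<in> CL" "y \<in> CL"
  shows "P (y \<otimes> x) = y \<otimes> P x"
  using assms
proof (induction n arbitrary: P x y)
  case (Suc n)
  note S = k_subring_carrier
  have l: "P \<in> lin CL" using Suc.prems(1) by simp
  note [simp] = linD[OF l] sa_closed sb_closed K_carrier linD[OF lin_avg[OF l]]
  have P: "P x = avg P x \<ominus> (\<Oplus>i\<in>{..<sn}. sa i \<otimes> com CL P (sb i) x)" if [simp]: "x \<in> CL" for x
  proof -
    have "(\<Oplus>i\<in>{..<sn}. sa i \<otimes> com CL P (sb i) x) =
      (\<Oplus>i\<in>{..<sn}. sa i \<otimes> P (sb i \<otimes> x) \<ominus> sa i \<otimes> sb i \<otimes> P x)"
      by (rule sum_cong) (simp_all add: com_def minus_eq r_distr r_minus m_assoc)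
    also have "\<dots> = avg P x \<ominus> (\<Oplus>i\<in>{..<sn}. sa i \<otimes> sb i) \<otimes> P x"
      by (subst sum_minus) (auto simp: avg_def finsum_ldistr)
    also have "(\<Oplus>i\<in>{..<sn}. sa i \<otimes> sb i) = \<one>" using ab_sum[of 0] d_pos by simp
    finally show ?thesis by (simp add: minus_eq minus_add r_neg1 a_ac r_neg)
  qed
  have C: "com CL P (sb i) (y \<otimes> x) = y \<otimes> com CL P (sb i) x" if i: "i < sn" and "x \<in> CL" "y \<in> CL" for i x y
  proof (rule Suc.IH)
    show "com CL P (sb i) \<in> dop CL n" using dop_com[OF Suc.prems(1)] i by simp
    fix c z assume cz: "c \<in> K" "z \<in> CL"
    have "sb i \<otimes> (c \<otimes> z) = c \<otimes> (sb i \<otimes> z)" using i cz by (simp add: m_lcomm)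
    then show "com CL P (sb i) (c \<otimes> z) = c \<otimes> com CL P (sb i) z"
      using i cz Suc.prems(2) by (simp add: com_def minus_eq r_distr r_minus m_lcomm)
  qed fact+
  \<comment> \<open>The commutators of \<open>P\<close> that occur in \<open>com_avg\<close> are
    with traces. These lie in \<open>K\<close>, where \<open>P\<close> is linear, so every term is
    zero.\<close>
  have A: "avg P (y \<otimes> x) = y \<otimes> avg P x" if [simp]: "x \<in> CL" "y \<in> CL" for x y
  proof -
    have "com CL (avg P) y x = (\<Oplus>i\<in>{..<sn}. \<Oplus>j\<in>{..<sn}. \<zero>)"
      unfolding com_avg[OF l that]
      by (intro sum_cong) (auto simp: com_def Suc.prems(2) tr_K minus_eq r_neg)
    then show ?thesis by (simp add: com_def finsum_zero)
  qed
  note [simp] = Suc.prems(3,4)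
  have c: "com CL P (sb i) x \<in> CL" if "i < sn" for i using that by (simp add: com_def)
  have "(\<Oplus>i\<in>{..<sn}. sa i \<otimes> com CL P (sb i) (y \<otimes> x)) = y \<otimes> (\<Oplus>i\<in>{..<sn}. sa i \<otimes> com CL P (sb i) x)"
    by (subst finsum_rdistr) (auto simp: C c m_lcomm intro!: sum_cong)
  then show ?case unfolding P[OF m_closed[OF Suc.prems(4,3)]] P[OF Suc.prems(3)]
    using c by (simp add: A minus_eq r_distr r_minus sum_closed)
qed auto

text \<open>For \<open>c\<close> in \<open>K\<close> the commutator \<open>[P, c]\<close> has
  smaller order and again vanishes on \<open>K\<close>, so it is zero by induction. Thus
  \<open>P\<close> is \<open>K\<close>-linear, hence \<open>L\<close>-linear by the preceding lemma,
  and \<open>P x = x P(1) = 0\<close>.\<close>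

lemma dop_eq_zero:
  assumes "P \<in> dop CL n" "\<And>x. x \<in> K \<Longrightarrow> P x = \<zero>"
  shows "P = (\<lambda>x\<in>CL. \<zero>)"
  using assms
proof (induction n arbitrary: P)
  case (Suc n)
  have l: "P \<in> lin CL" using Suc.prems(1) by simp
  note [simp] = linD[OF l] K_carrier
  note KS = k_subringD[OF k_subring_K]
  have "P (c \<otimes> x) = c \<otimes> P x" if c: "c \<in> K" and x: "x \<in> CL" for c x
  proof -
    have "com CL P c = (\<lambda>x\<in>CL. \<zero>)"
      using c Suc.prems(2) dop_com[OF Suc.prems(1)]
      by (intro Suc.IH) (auto simp: com_def KS minus_eq simp del: dop.simps)
    then have "com CL P c x = \<zero>" using x by simp
    then show ?thesis using c x by (simp add: com_def)
  qed
  note lin = dop_K_linear_imp_linear[OF Suc.prems(1) this]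
  show ?case
  proof (rule extensionalityI[of _ CL])
    fix x assume "x \<in> CL"
    then show "P x = (\<lambda>x\<in>CL. \<zero>) x" using lin[of \<one> x] Suc.prems(2)[of \<one>] KS(7) by simp
  qed auto
qed simp

lemma dop_unique:
  assumes "P \<in> dop CL m" "Q \<in> dop CL n" "\<And>x. x \<in> K \<Longrightarrow> P x = Q x"
  shows "P = Q"
proof -
  note S = k_subring_carrier
  have "P \<in> dop CL (max m n)" "Q \<in> dop CL (max m n)" using assms dop_mono[OF S] by auto
  note PQ = linD[OF dop_lin[OF S assms(1)]] linD[OF dop_lin[OF S assms(2)]] and D = dop_minus[OF S this]
  have "(\<lambda>x\<in>CL. P x \<ominus> Q x) = (\<lambda>x\<in>CL. \<zero>)"
    by (rule dop_eq_zero[OF D]) (use assms(3) PQ in \<open>simp add: K_carrier minus_eq r_neg\<close>)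
  then have "P x \<ominus> Q x = \<zero>" if "x \<in> CL" for x using restrict_eqD[of _ CL] that by fastforce
  then show ?thesis using PQ by (intro extensionalityI[of _ CL]) auto
qed

text \<open>Induction on the order. The extensions \<open>C c\<close> of \<open>[Q, c]\<close> give a map \<open>P\<close> on \<open>L\<close> with
  \<open>[P, c] = C c\<close> for \<open>c \<in> K\<close>. Its average \<open>R\<close> is a differential operator, and the restriction
  of \<open>R\<close> to \<open>K\<close> differs from \<open>Q\<close> by an operator of smaller order.\<close>

lemma exists_extension:
  "Q \<in> dop K n \<Longrightarrow> \<exists>P\<in>dop CL n. restrict P K = Q"
proof (induction n arbitrary: Q)
  case 0
  then show ?case using dop_restrict[OF k_subring_carrier k_subring_K, of _ 0] K_carrier by auto
next
  case (Suc n)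
  note S = k_subring_carrier and KS [simp] = k_subringD[OF k_subring_K] and K_sub = subsetI[of K CL, OF K_carrier]
  have Q: "Q \<in> lin K" using Suc.prems by simp
  note [simp] = linD[OF Q] sa_closed sb_closed tr_K tr_closed
  define C where "C c = (SOME P. P \<in> dop CL n \<and> restrict P K = com K Q c)" for c
  have "C c \<in> dop CL n \<and> restrict (C c) K = com K Q c" if "c \<in> K" for c
  proof -
    have "\<exists>P. P \<in> dop CL n \<and> restrict P K = com K Q c"
      using Suc.IH[OF dop_com[OF Suc.prems that]] by blast
    then show ?thesis unfolding C_def by (rule someI_ex)
  qed
  then have C: "C c \<in> dop CL n" "restrict (C c) K = com K Q c" if "c \<in> K" for c using that by auto
  have CK: "C c x = com K Q c x" if "c \<in> K" "x \<in> K" for c x using restrict_eqD[OF C(2)[OF that(1)] that(2)] .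
  note Cl = dop_lin[OF S C(1)]
  note [simp] = linD[OF Cl]
  \<comment> \<open>The chosen extensions satisfy the identities of commutators, because both sides
    of each identity are differential operators that agree on \<open>K\<close> and so are equal. The
    same principle gives \<open>C_mult\<close> and \<open>C_k\<close>.\<close>
  have C_add: "C (c \<oplus> e) x = C c x \<oplus> C e x" if "c \<in> K" "e \<in> K" "x \<in> CL" for c e x
  proof -
    have "C (c \<oplus> e) = (\<lambda>x\<in>CL. C c x \<oplus> C e x)"
      by (rule dop_unique[OF C(1) dop_add[OF S C(1) C(1)]])
        (use that in \<open>simp_all add: CK com_def l_distr minus_eq minus_add a_ac\<close>)
    then show ?thesis using that by simp
  qed
  have C_mult: "C (c \<otimes> e) x = c \<otimes> C e x \<oplus> C c (e \<otimes> x)" if "c \<in> K" "e \<in> K" "x \<in> CL" for c e x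
  proof -
    have "C (c \<otimes> e) = (\<lambda>x\<in>CL. (\<lambda>x\<in>CL. c \<otimes> C e x) x \<oplus> (\<lambda>x\<in>CL. C c (e \<otimes> x)) x)"
      by (rule dop_unique[OF C(1) dop_add[OF S dop_lmult[OF S _ C(1)] dop_rmult[OF S _ C(1)]]])
        (use that in \<open>simp_all add: CK com_def mult_minus m_assoc minus_telescope_rev\<close>)
    then show ?thesis using that by simp
  qed
  have C_k: "C c x = \<zero>" if "c \<in> k" "x \<in> CL" for c x
  proof -
    have c: "c \<in> K" using that k_sub_K by blast
    have "C c = (\<lambda>x\<in>CL. \<zero>)"
      by (rule dop_eq_zero[OF C(1)]) (use c that in \<open>simp_all add: CK com_def minus_eq r_neg\<close>)
    then show ?thesis using that by simp
  qed
  \<comment> \<open>Writing \<open>y\<close> as the sum of the tr(b_j y) a_j, this is the value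
    forced by \<open>[P, c] = C c\<close> if \<open>P\<close> kills every a_j. As the a_j may be
    dependent, \<open>P\<close> is defined by the formula and the commutator relation is verified
    afterwards.\<close>
  define P where "P = (\<lambda>y\<in>CL. \<Oplus>j\<in>{..<sn}. C (tr (sb j \<otimes> y)) (sa j))"
  have P_closed [simp]: "P y \<in> CL" if "y \<in> CL" for y using that by (simp add: P_def sum_closed)
  have P_mult: "P (c \<otimes> y) = c \<otimes> P y \<oplus> C c y" if [simp]: "c \<in> K" "y \<in> CL" for c y
  proof -
    have "P (c \<otimes> y) = (\<Oplus>j\<in>{..<sn}. c \<otimes> C (tr (sb j \<otimes> y)) (sa j) \<oplus> C c (sa j \<otimes> tr (sb j \<otimes> y)))"
      unfolding P_def
    proof (subst restrict_apply', (simp; fail), rule sum_cong)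
      fix j assume j: "j < sn"
      have "tr (sb j \<otimes> (c \<otimes> y)) = c \<otimes> tr (sb j \<otimes> y)"
        using j by (subst m_lcomm) (simp_all add: tr_K_mult)
      then show "C (tr (sb j \<otimes> (c \<otimes> y))) (sa j) = c \<otimes> C (tr (sb j \<otimes> y)) (sa j) \<oplus> C c (sa j \<otimes> tr (sb j \<otimes> y))"
        using j by (simp add: C_mult m_comm)
    qed simp
    also have "\<dots> = (\<Oplus>j\<in>{..<sn}. c \<otimes> C (tr (sb j \<otimes> y)) (sa j)) \<oplus> (\<Oplus>j\<in>{..<sn}. C c (sa j \<otimes> tr (sb j \<otimes> y)))"
      by (rule finsum_addf) auto
    also have "(\<Oplus>j\<in>{..<sn}. C c (sa j \<otimes> tr (sb j \<otimes> y))) = C c y"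
      using additive_sum(2)[OF Cl[OF that(1)] S, of sn "\<lambda>j. sa j \<otimes> tr (sb j \<otimes> y)"] expand_a[of y] by simp
    finally show ?thesis by (simp add: P_def finsum_rdistr)
  qed
  have Pl: "P \<in> lin CL"
  proof (rule linI)
    show "P (x \<oplus> y) = P x \<oplus> P y" if "x \<in> CL" "y \<in> CL" for x y
    proof -
      have "(\<Oplus>j\<in>{..<sn}. C (tr (sb j \<otimes> (x \<oplus> y))) (sa j)) =
          (\<Oplus>j\<in>{..<sn}. C (tr (sb j \<otimes> x)) (sa j) \<oplus> C (tr (sb j \<otimes> y)) (sa j))"
        using that by (intro sum_cong) (simp_all add: r_distr tr_add C_add)
      also have "\<dots> = (\<Oplus>j\<in>{..<sn}. C (tr (sb j \<otimes> x)) (sa j)) \<oplus> (\<Oplus>j\<in>{..<sn}. C (tr (sb j \<otimes> y)) (sa j))"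
        using that by (intro finsum_addf) auto
      finally show ?thesis using that by (simp add: P_def)
    qed
    show "P (c \<otimes> x) = c \<otimes> P x" if "c \<in> k" "x \<in> CL" for c x
      using that k_sub_K P_mult[of c x] by (auto simp: C_k k_in_carrier)
  qed (simp_all add: P_def sum_closed)
  have com_P: "com CL P c = C c" if "c \<in> K" for c
    by (rule extensionalityI[of _ CL]) (use that in \<open>auto simp: com_def P_mult minus_eq a_ac r_neg1 r_neg\<close>)
  \<comment> \<open>Only the commutators of \<open>P\<close> with \<open>K\<close> are under
    control, so \<open>P\<close> itself is not known to be a differential operator. By
    \<open>com_avg\<close> those commutators determine all commutators of the average with elements
    of \<open>L\<close>.\<close>
  define R where "R = avg P"
  note Rl = lin_avg[OF Pl, folded R_def]
  have R: "R \<in> dop CL (Suc n)"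
  proof (rule dop_SucI[OF Rl])
    fix y assume [simp]: "y \<in> CL"
    have "com CL R y = (\<lambda>x\<in>CL. \<Oplus>i\<in>{..<sn}. (\<lambda>x\<in>CL. \<Oplus>j\<in>{..<sn}.
        (\<lambda>x\<in>CL. sa i \<otimes> (\<lambda>x\<in>CL. C (tr (sa j \<otimes> (sb i \<otimes> y))) (sb j \<otimes> x)) x) x) x)"
    proof (rule extensionalityI[of _ CL])
      fix x assume x [simp]: "x \<in> CL"
      show "com CL R y x = (\<lambda>x\<in>CL. \<Oplus>i\<in>{..<sn}. (\<lambda>x\<in>CL. \<Oplus>j\<in>{..<sn}.
        (\<lambda>x\<in>CL. sa i \<otimes> (\<lambda>x\<in>CL. C (tr (sa j \<otimes> (sb i \<otimes> y))) (sb j \<otimes> x)) x) x) x) x"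
        unfolding R_def com_avg[OF Pl x \<open>y \<in> CL\<close>]
        by (simp, intro sum_cong) (auto simp: com_P intro!: sum_closed)
    qed (auto simp: com_def)
    moreover have "\<dots> \<in> dop CL n"
      by (intro dop_sum[OF S] dop_lmult[OF S] dop_rmult[OF S] C) simp_all
    ultimately show "com CL R y \<in> dop CL n" by simp
  qed
  define D where "D = (\<lambda>x\<in>K. restrict R K x \<ominus> Q x)"
  note RK = dop_restrict[OF S k_subring_K K_sub R]
  have Dl: "D \<in> lin K" unfolding D_def
    using dop_lin[OF k_subring_K dop_minus[OF k_subring_K RK Suc.prems]] .
  \<comment> \<open>\<open>[D, c]\<close> is the sum of the \<open>a_i [C c, b_i]\<close> restricted
    to \<open>K\<close>. Taking the commutator with b_i lowers the index of \<open>C c\<close> below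
    \<open>n\<close>, so the defect \<open>D\<close> has index \<open>n\<close> and is covered by
    the induction hypothesis.\<close>
  have com_D: "com K D c = restrict (\<lambda>x\<in>CL. \<Oplus>i\<in>{..<sn}. (\<lambda>x\<in>CL. sa i \<otimes> com CL (C c) (sb i) x) x) K"
    if c [simp]: "c \<in> K" for c
  proof (rule extensionalityI[of _ K])
    fix x assume [simp]: "x \<in> K"
    have R_mult: "R (c \<otimes> x) = c \<otimes> R x \<oplus> (\<Oplus>i\<in>{..<sn}. sa i \<otimes> C c (sb i \<otimes> x))"
    proof -
      have "R (c \<otimes> x) = (\<Oplus>i\<in>{..<sn}. c \<otimes> (sa i \<otimes> P (sb i \<otimes> x)) \<oplus> sa i \<otimes> C c (sb i \<otimes> x))"
        unfolding R_def avg_def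
      proof (subst restrict_apply', (simp; fail), rule sum_cong)
        fix i assume i: "i < sn"
        have "sb i \<otimes> (c \<otimes> x) = c \<otimes> (sb i \<otimes> x)" using i by (simp add: m_lcomm)
        then show "sa i \<otimes> P (sb i \<otimes> (c \<otimes> x)) = c \<otimes> (sa i \<otimes> P (sb i \<otimes> x)) \<oplus> sa i \<otimes> C c (sb i \<otimes> x)"
          using i by (simp add: P_mult r_distr m_lcomm)
      qed simp
      also have "\<dots> = (\<Oplus>i\<in>{..<sn}. c \<otimes> (sa i \<otimes> P (sb i \<otimes> x))) \<oplus> (\<Oplus>i\<in>{..<sn}. sa i \<otimes> C c (sb i \<otimes> x))"
        by (rule finsum_addf) auto
      also have "\<dots> = c \<otimes> R x \<oplus> (\<Oplus>i\<in>{..<sn}. sa i \<otimes> C c (sb i \<otimes> x))"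
        unfolding R_def avg_def by (simp add: finsum_rdistr)
      finally show ?thesis .
    qed
    have s: "(\<Oplus>i\<in>{..<sn}. sa i \<otimes> sb i) = \<one>" using ab_sum[of 0] d_pos by simp
    have "(\<Oplus>i\<in>{..<sn}. sa i \<otimes> com CL (C c) (sb i) x) =
        (\<Oplus>i\<in>{..<sn}. sa i \<otimes> C c (sb i \<otimes> x) \<ominus> sa i \<otimes> sb i \<otimes> C c x)"
      by (rule sum_cong) (simp_all add: com_def minus_eq r_distr r_minus m_assoc)
    also have "\<dots> = (\<Oplus>i\<in>{..<sn}. sa i \<otimes> C c (sb i \<otimes> x)) \<ominus> (\<Oplus>i\<in>{..<sn}. sa i \<otimes> sb i) \<otimes> C c x"
      by (subst sum_minus) (auto simp: finsum_ldistr)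
    also have "\<dots> = (\<Oplus>i\<in>{..<sn}. sa i \<otimes> C c (sb i \<otimes> x)) \<ominus> C c x" by (simp add: s)
    finally have e: "(\<Oplus>i\<in>{..<sn}. sa i \<otimes> com CL (C c) (sb i) x) =
        (\<Oplus>i\<in>{..<sn}. sa i \<otimes> C c (sb i \<otimes> x)) \<ominus> (Q (c \<otimes> x) \<ominus> c \<otimes> Q x)"
      by (simp add: CK com_def)
    have z: "(\<Oplus>i\<in>{..<sn}. sa i \<otimes> C c (sb i \<otimes> x)) \<in> CL" by (simp add: sum_closed)
    have [simp]: "R x \<in> CL" using linD(2)[OF Rl] by simp
    have *: "(u \<oplus> z) \<ominus> q \<ominus> (u \<ominus> p) = z \<ominus> (q \<ominus> p)"
      if "u \<in> CL" "z \<in> CL" "q \<in> CL" "p \<in> CL" for u z q p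
      using that by algebra
    have "com K D c x = (c \<otimes> R x \<oplus> (\<Oplus>i\<in>{..<sn}. sa i \<otimes> C c (sb i \<otimes> x))) \<ominus> Q (c \<otimes> x) \<ominus> (c \<otimes> R x \<ominus> c \<otimes> Q x)"
      by (simp add: com_def D_def R_mult minus_eq r_distr r_minus)
    also have "\<dots> = (\<Oplus>i\<in>{..<sn}. sa i \<otimes> C c (sb i \<otimes> x)) \<ominus> (Q (c \<otimes> x) \<ominus> c \<otimes> Q x)"
      using z by (intro *) simp_all
    finally show "com K D c x = restrict (\<lambda>x\<in>CL. \<Oplus>i\<in>{..<sn}. (\<lambda>x\<in>CL. sa i \<otimes> com CL (C c) (sb i) x) x) K x"
      using e by simp
  qed (simp_all add: com_def Int_absorb1[OF K_sub])
  show ?case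
  proof (cases n)
    case 0
    \<comment> \<open>For \<open>n = 0\<close> there is no smaller index for \<open>[D, c]\<close>
      to fall into. Here \<open>Q\<close> has order 0, so it is multiplication by
      \<open>Q \<one>\<close> and extends by the same formula.\<close>
    define T where "T = (\<lambda>y\<in>CL. y \<otimes> Q \<one>)"
    have "T = mult_op L (Q \<one>)" unfolding T_def mult_op_def by (rule restrict_ext) (simp add: m_comm)
    then have "T \<in> dop CL (Suc n)" using mult_op_dop 0 by simp
    moreover have "restrict T K = Q"
    proof (rule extensionalityI[of _ K])
      fix x assume [simp]: "x \<in> K"
      have "com K Q x = (\<lambda>x\<in>K. \<zero>)" using dop_com[OF Suc.prems, of x] 0 by simp
      then have "com K Q x \<one> = \<zero>" by simp
      then show "restrict T K x = Q x" by (simp add: com_def T_def)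
    qed simp_all
    ultimately show ?thesis by blast
  next
    case (Suc m)
    have "D \<in> dop K n" unfolding Suc
    proof (rule dop_SucI[OF Dl])
      fix c assume "c \<in> K"
      then show "com K D c \<in> dop K m"
        unfolding com_D[OF \<open>c \<in> K\<close>] using C(1)[OF \<open>c \<in> K\<close>] Suc
        by (intro dop_restrict[OF S k_subring_K K_sub] dop_sum[OF S] dop_lmult[OF S] dop_com) simp_all
    qed
    from Suc.IH[OF this] obtain E where E: "E \<in> dop CL n" "restrict E K = D" by blast
    have "(\<lambda>x\<in>CL. R x \<ominus> E x) \<in> dop CL (Suc n)"
      using dop_minus[OF S R dop_Suc_mono[OF S E(1)]] .
    moreover have "restrict (\<lambda>x\<in>CL. R x \<ominus> E x) K = Q"
    proof (rule extensionalityI[of _ K])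
      fix x assume [simp]: "x \<in> K"
      have "E x = D x" using restrict_eqD[OF E(2)] by simp
      moreover have "R x \<in> CL" using linD(2)[OF Rl] by simp
      ultimately show "restrict (\<lambda>x\<in>CL. R x \<ominus> E x) K x = Q x"
        using minus_minus_cancel by (simp add: D_def)
    qed (simp_all add: Int_absorb1[OF K_sub])
    ultimately show ?thesis by blast
  qed
qed

section \<open>Conjugation by the generator, and operators of \<open>K\<close> as operators of
  \<open>L\<close>\<close>

abbreviation "DK \<equiv> carrier (diff_ops (L\<lparr>carrier := K\<rparr>) k)"

lemma diff_ops_unique:
  "\<lbrakk>P \<in> DL; Q \<in> DL; \<And>x. x \<in> K \<Longrightarrow> P x = Q x\<rbrakk> \<Longrightarrow> P = Q"
  using dop_unique by (auto simp: diff_ops_carrier simp del: dop.simps)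

text \<open>\<open>P \<mapsto> g\<^sup>j P g\<^sup>-\<^sup>j\<close>, where \<open>g\<^sup>-\<^sup>1 = g\<^sup>d\<^sup>-\<^sup>1\<close>.\<close>

definition conjn :: "nat \<Rightarrow> ('a \<Rightarrow> 'a) \<Rightarrow> 'a \<Rightarrow> 'a"
  where "conjn j P = (\<lambda>x\<in>CL. (g ^^ j) (P ((g ^^ (j * (d - 1))) x)))"

lemma pow_mult_d: "x \<in> CL \<Longrightarrow> (g ^^ (j * d)) x = x"
  by (induction j) (simp_all add: funpow_add g_d pow_closed)

lemma pow_pow_inverse:
  assumes "x \<in> CL" shows "(g ^^ j) ((g ^^ (j * (d - 1))) x) = x"
proof -
  have "j + j * (d - 1) = j * d" using d_pos by (cases d) auto
  then have "(g ^^ (j + j * (d - 1))) x = x" using pow_mult_d[OF assms] by simp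
  then show ?thesis by (simp add: funpow_add)
qed

lemma conjn_lin: assumes "P \<in> lin CL" shows "conjn j P \<in> lin CL"
proof (rule linI)
  note [simp] = linD[OF assms] pow_g
  show "conjn j P (c \<otimes> x) = c \<otimes> conjn j P x" if "c \<in> k" "x \<in> CL" for c x
    using that k_sub_K by (auto simp: conjn_def k_in_carrier subsetD)
qed (use linD[OF assms] in \<open>simp_all add: conjn_def pow_g\<close>)

lemma pow_minus: "\<lbrakk>x \<in> CL; y \<in> CL\<rbrakk> \<Longrightarrow> (g ^^ j) (x \<ominus> y) = (g ^^ j) x \<ominus> (g ^^ j) y"
  using additive_minus[OF pow_lin k_subring_carrier, of x y j] by simp

text \<open>Commutators are conjugated along: \<open>[h P h^-1, y] = h [P, h^-1 y] h^-1\<close> for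
  the automorphism \<open>h = g^j\<close>.\<close>

lemma conjn_dop: "P \<in> dop CL n \<Longrightarrow> conjn j P \<in> dop CL n"
proof (induction n arbitrary: P)
  case 0
  then show ?case by (auto simp: conjn_def pow_closed pow_zero intro!: restrict_ext)
next
  case (Suc n)
  have l: "P \<in> lin CL" using Suc.prems by simp
  note [simp] = linD[OF l] pow_g
  show ?case
  proof (rule dop_SucI[OF conjn_lin[OF l]])
    fix y assume y: "y \<in> CL"
    have "com CL (conjn j P) y = conjn j (com CL P ((g ^^ (j * (d - 1))) y))"
      unfolding com_def conjn_def
      by (rule restrict_ext) (use y pow_pow_inverse[OF y] in \<open>simp add: pow_minus del: One_nat_def\<close>)
    then show "com CL (conjn j P) y \<in> dop CL n"
      using Suc.IH[OF dop_com[OF Suc.prems]] y by simp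
  qed
qed

lemma conjn_diff_ops: "P \<in> DL \<Longrightarrow> conjn j P \<in> DL"
  using conjn_dop by (auto simp: diff_ops_carrier simp del: dop.simps)

lemma conjn_Suc: "conjn (Suc j) P = conjn 1 (conjn j P)"
proof -
  have "(g ^^ (Suc j * (d - 1))) x = (g ^^ (j * (d - 1))) ((g ^^ (d - 1)) x)" for x
    by (simp only: mult_Suc add.commute[of "d - 1"] funpow_add o_apply)
  then show ?thesis unfolding conjn_def by (intro restrict_ext) (simp add: pow_closed)
qed

lemma conjn_0: "P \<in> lin CL \<Longrightarrow> conjn 0 P = P"
  by (rule extensionalityI[of _ CL]) (simp_all add: conjn_def linD)

lemma conjn_d: "P \<in> lin CL \<Longrightarrow> conjn d P = P"
  by (rule extensionalityI[of _ CL])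
    (simp_all add: conjn_def linD g_d mult.commute[of d] pow_mult_d)

lemma conjn_mult_op: "c \<in> CL \<Longrightarrow> conjn j (mult_op L c) = mult_op L ((g ^^ j) c)"
  unfolding conjn_def mult_op_def by (rule restrict_ext) (simp add: pow_g pow_pow_inverse del: One_nat_def)

lemma conjn_K: "\<lbrakk>P \<in> DL; x \<in> K\<rbrakk> \<Longrightarrow> conjn j P x = (g ^^ j) (P x)"
  by (simp add: conjn_def K_carrier pow_K)

lemma K_field: "k_field (L\<lparr>carrier := K\<rparr>) k"
  using subfield_iff(2)[OF K_subfield] k_sub_K by (simp add: k_field_def k_field_axioms_def)

lemma K_minus: "\<lbrakk>x \<in> K; y \<in> K\<rbrakk> \<Longrightarrow> x \<ominus>\<^bsub>L\<lparr>carrier := K\<rparr>\<^esub> y = x \<ominus> y"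
proof -
  assume xy: "x \<in> K" "y \<in> K"
  interpret K: k_field "L\<lparr>carrier := K\<rparr>" k by (rule K_field)
  have "\<ominus>\<^bsub>L\<lparr>carrier := K\<rparr>\<^esub> y = \<ominus> y"
    by (rule K.minus_equality) (use xy k_subringD(5)[OF k_subring_K] in \<open>simp_all add: K_carrier l_neg\<close>)
  then show ?thesis by (simp add: a_minus_def)
qed

text \<open>Connects the operators formed inside the field \<open>K\<close> with the operators from
  \<open>K\<close> to \<open>L\<close> to which the extension lemma applies. The commutators agree
  because subtraction in \<open>K\<close> is that of \<open>L\<close>.\<close>

lemma K_dop: "k_field.dop (L\<lparr>carrier := K\<rparr>) k K n = {Q \<in> dop K n. Q \<in> K \<rightarrow> K}"
proof -
  interpret K: k_field "L\<lparr>carrier := K\<rparr>" k by (rule K_field)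
  note KS = k_subringD[OF k_subring_K]
  have lin: "K.lin K = {Q \<in> lin K. Q \<in> K \<rightarrow> K}"
    unfolding K.lin_def lin_def by (auto simp: Pi_def intro: K_carrier)
  have com: "K.com K Q c = com K Q c" if "Q \<in> K \<rightarrow> K" "c \<in> K" for Q c
    unfolding K.com_def com_def
  proof (rule restrict_ext)
    fix x assume "x \<in> K"
    then have "Q (c \<otimes> x) \<in> K" "c \<otimes> Q x \<in> K" using that KS(4) by auto
    then show "Q (c \<otimes>\<^bsub>L\<lparr>carrier := K\<rparr>\<^esub> x) \<ominus>\<^bsub>L\<lparr>carrier := K\<rparr>\<^esub> c \<otimes>\<^bsub>L\<lparr>carrier := K\<rparr>\<^esub> Q x = Q (c \<otimes> x) \<ominus> c \<otimes> Q x"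
      using K_minus by simp
  qed
  have com_K: "com K Q c \<in> K \<rightarrow> K" if "Q \<in> K \<rightarrow> K" "c \<in> K" for Q c
    using that KS(3-5) by (auto simp: com_def minus_eq Pi_def)
  show ?thesis
  proof (induction n)
    case 0
    show ?case using KS(6) by auto
  next
    case (Suc n)
    show ?case
    proof (intro equalityI subsetI)
      fix Q assume Q: "Q \<in> K.dop K (Suc n)"
      then have "Q \<in> lin K" "Q \<in> K \<rightarrow> K" using lin by auto
      moreover have "com K Q c \<in> dop K n" if "c \<in> K" for c
        using Q that Suc com[OF calculation(2) that] by auto
      ultimately show "Q \<in> {Q \<in> dop K (Suc n). Q \<in> K \<rightarrow> K}" by simp
    next
      fix Q assume "Q \<in> {Q \<in> dop K (Suc n). Q \<in> K \<rightarrow> K}"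
      then have Q: "Q \<in> dop K (Suc n)" "Q \<in> K \<rightarrow> K" by auto
      have "K.com K Q c \<in> K.dop K n" if "c \<in> K" for c
        using dop_com[OF Q(1) that] com[OF Q(2) that] com_K[OF Q(2) that] Suc by auto
      then show "Q \<in> K.dop K (Suc n)" using Q lin by simp
    qed
  qed
qed

lemma diff_ops_K_carrier: "DK = {Q \<in> (\<Union>n. dop K n). Q \<in> K \<rightarrow> K}"
proof -
  interpret K: k_field "L\<lparr>carrier := K\<rparr>" k by (rule K_field)
  show ?thesis using K.diff_ops_carrier by (auto simp: K_dop simp del: dop.simps)
qed

lemma diff_ops_K_closed: "\<lbrakk>Q \<in> DK; x \<in> K\<rbrakk> \<Longrightarrow> Q x \<in> K"
  by (auto simp: diff_ops_K_carrier)

text \<open>The embedding \<open>Q \<mapsto> 1 \<otimes> Q\<close> of the operators of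
  \<open>K\<close> into those of \<open>L\<close>. The choice is harmless, since an operator on
  \<open>L\<close> is determined by its restriction to \<open>K\<close>.\<close>

definition lift :: "('a \<Rightarrow> 'a) \<Rightarrow> 'a \<Rightarrow> 'a"
  where "lift Q = (SOME P. P \<in> DL \<and> restrict P K = Q)"

lemma lift: assumes "Q \<in> DK" shows "lift Q \<in> DL" "\<And>x. x \<in> K \<Longrightarrow> lift Q x = Q x"
proof -
  obtain n where "Q \<in> dop K n" using assms by (auto simp: diff_ops_K_carrier simp del: dop.simps)
  then obtain P where "P \<in> dop CL n" "restrict P K = Q" using exists_extension by blast
  then have "\<exists>P. P \<in> DL \<and> restrict P K = Q" by (auto simp: diff_ops_carrier simp del: dop.simps)
  then have "lift Q \<in> DL \<and> restrict (lift Q) K = Q" unfolding lift_def by (rule someI_ex)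
  then show "lift Q \<in> DL" "\<And>x. x \<in> K \<Longrightarrow> lift Q x = Q x" using restrict_eqD by fast+
qed

lemma lift_eqI: "\<lbrakk>Q \<in> DK; P \<in> DL; \<And>x. x \<in> K \<Longrightarrow> P x = Q x\<rbrakk> \<Longrightarrow> lift Q = P"
  by (rule diff_ops_unique) (simp_all add: lift)

text \<open>Both sides restrict to \<open>Q\<close>, because \<open>g\<close> fixes the argument and
  the value of \<open>Q\<close> on \<open>K\<close>; uniqueness of extensions does the rest.\<close>

lemma conjn_lift: "Q \<in> DK \<Longrightarrow> conjn j (lift Q) = lift Q"
  by (rule diff_ops_unique) (simp_all add: conjn_diff_ops lift conjn_K diff_ops_K_closed pow_K)

lemma tr_dop: "P \<in> dop K n \<Longrightarrow> (\<lambda>x\<in>K. tr (P x)) \<in> dop K n"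
proof (induction n arbitrary: P)
  case 0
  then show ?case by (auto simp: tr_zero intro!: restrict_ext)
next
  case (Suc n)
  have l: "P \<in> lin K" using Suc.prems by simp
  note [simp] = linD[OF l] k_subringD[OF k_subring_K] tr_closed
  show ?case
  proof (rule dop_SucI)
    show "(\<lambda>x\<in>K. tr (P x)) \<in> lin K"
      by (rule linI) (use k_sub_K in \<open>auto simp: tr_add tr_K_mult subsetD\<close>)
    fix c assume c: "c \<in> K"
    have "com K (\<lambda>x\<in>K. tr (P x)) c = (\<lambda>x\<in>K. tr (com K P c x))"
      unfolding com_def by (rule restrict_ext) (use c in \<open>simp add: tr_minus tr_K_mult\<close>)
    then show "com K (\<lambda>x\<in>K. tr (P x)) c \<in> dop K n" using Suc.IH[OF dop_com[OF Suc.prems c]] by simp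
  qed
qed

text \<open>With \<open>c\<close> one of the b_i these are the coordinates of \<open>P\<close> on
  \<open>K\<close> in the expansion by the a_i. They realize the decomposition of the operators of
  \<open>L\<close> as \<open>L\<close> tensored with the operators of \<open>K\<close>.\<close>

lemma tr_diff_ops:
  assumes "P \<in> DL" "c \<in> CL" shows "(\<lambda>x\<in>K. tr (c \<otimes> P x)) \<in> DK"
proof -
  obtain n where P: "P \<in> dop CL n" using assms by (auto simp: diff_ops_carrier simp del: dop.simps)
  note l = linD(2)[OF dop_lin[OF k_subring_carrier P]]
  have "(\<lambda>x\<in>K. c \<otimes> restrict P K x) \<in> dop K n"
    using dop_lmult[OF k_subring_K assms(2) dop_restrict[OF k_subring_carrier k_subring_K _ P]] K_carrier by blast
  from tr_dop[OF this] have "(\<lambda>x\<in>K. tr ((\<lambda>x\<in>K. c \<otimes> restrict P K x) x)) \<in> dop K n" .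
  also have "(\<lambda>x\<in>K. tr ((\<lambda>x\<in>K. c \<otimes> restrict P K x) x)) = (\<lambda>x\<in>K. tr (c \<otimes> P x))"
    by (rule restrict_ext) simp
  finally show ?thesis using tr_K assms(2) l K_carrier by (auto simp: diff_ops_K_carrier simp del: dop.simps)
qed

end

section \<open>Polynomials and derivations\<close>

text \<open>Horner evaluation of polynomials given by the list of their coefficients, constant term
  first. In \<open>ev R x p\<close> the polynomial is monic and its leading coefficient is not listed, so its
  degree is the length of \<open>p\<close>; \<open>nev R x p\<close> is for the polynomial with coefficients \<open>p\<close>, and
  \<open>dev R x p\<close> for the derivative of the monic one.\<close>

primrec ev :: "('a, 'b) ring_scheme \<Rightarrow> 'a \<Rightarrow> 'a list \<Rightarrow> 'a"
  where
    "ev R x [] = \<one>\<^bsub>R\<^esub>"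
  | "ev R x (c # p) = c \<oplus>\<^bsub>R\<^esub> x \<otimes>\<^bsub>R\<^esub> ev R x p"

primrec nev :: "('a, 'b) ring_scheme \<Rightarrow> 'a \<Rightarrow> 'a list \<Rightarrow> 'a"
  where
    "nev R x [] = \<zero>\<^bsub>R\<^esub>"
  | "nev R x (c # p) = c \<oplus>\<^bsub>R\<^esub> x \<otimes>\<^bsub>R\<^esub> nev R x p"

primrec dev :: "('a, 'b) ring_scheme \<Rightarrow> 'a \<Rightarrow> 'a list \<Rightarrow> 'a"
  where
    "dev R x [] = \<zero>\<^bsub>R\<^esub>"
  | "dev R x (c # p) = ev R x p \<oplus>\<^bsub>R\<^esub> x \<otimes>\<^bsub>R\<^esub> dev R x p"

text \<open>The quotient of the monic polynomial by \<open>X - z\<close>.\<close>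

fun quo :: "('a, 'b) ring_scheme \<Rightarrow> 'a \<Rightarrow> 'a list \<Rightarrow> 'a list"
  where
    "quo R z [] = []"
  | "quo R z [c] = []"
  | "quo R z (c # e # p) = ev R z (e # p) # quo R z (e # p)"

lemma length_quo: "p \<noteq> [] \<Longrightarrow> length p = Suc (length (quo R z p))"
  by (induction R z p rule: quo.induct) auto

context cring
begin

lemma ev_closed: "\<lbrakk>subring F R; x \<in> F; set p \<subseteq> F\<rbrakk> \<Longrightarrow> ev R x p \<in> F"
  by (induction p) (auto intro: subringE)

lemma nev_closed: "\<lbrakk>subring F R; x \<in> F; set p \<subseteq> F\<rbrakk> \<Longrightarrow> nev R x p \<in> F"
  by (induction p) (auto intro: subringE)

lemmas ev_carrier [intro, simp] = ev_closed[OF carrier_is_subring]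
lemmas nev_carrier [intro, simp] = nev_closed[OF carrier_is_subring]

lemma ev_in_carrier: "\<lbrakk>subring F R; set p \<subseteq> F; x \<in> carrier R\<rbrakk> \<Longrightarrow> ev R x p \<in> carrier R"
  by (rule ev_carrier) (auto dest: subringE(1))

lemma nev_in_carrier: "\<lbrakk>subring F R; set p \<subseteq> F; x \<in> carrier R\<rbrakk> \<Longrightarrow> nev R x p \<in> carrier R"
  by (rule nev_carrier) (auto dest: subringE(1))

lemma dev_carrier [intro, simp]: "\<lbrakk>x \<in> carrier R; set p \<subseteq> carrier R\<rbrakk> \<Longrightarrow> dev R x p \<in> carrier R"
  by (induction p) auto

lemma quo_closed: "\<lbrakk>subring F R; z \<in> F; set p \<subseteq> F\<rbrakk> \<Longrightarrow> set (quo R z p) \<subseteq> F"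
proof (induction p)
  case (Cons c p)
  then show ?case using ev_closed[of F z p] by (cases p) auto
qed simp

lemma ev_quo:
  assumes "x \<in> carrier R" "z \<in> carrier R"
  shows "\<lbrakk>p \<noteq> []; set p \<subseteq> carrier R\<rbrakk> \<Longrightarrow> ev R x p = (x \<ominus> z) \<otimes> ev R x (quo R z p) \<oplus> ev R z p"
proof (induction p)
  case (Cons c p)
  show ?case
  proof (cases p)
    case Nil
    then show ?thesis using Cons.prems assms by simp algebra
  next
    case (Cons e q)
    have [simp]: "set (quo R z p) \<subseteq> carrier R"
      using quo_closed[OF carrier_is_subring] assms Cons.prems by simp
    define Q where "Q = ev R x (quo R z p)"
    define Z where "Z = ev R z p"
    have cl: "Q \<in> carrier R" "Z \<in> carrier R" "c \<in> carrier R"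
      using assms Cons.prems by (auto simp: Q_def Z_def)
    have q: "quo R z (c # p) = Z # quo R z p" using Cons by (simp add: Z_def)
    have E: "ev R x p = (x \<ominus> z) \<otimes> Q \<oplus> Z" using Cons.IH Cons.prems Cons by (simp add: Q_def Z_def)
    have "c \<oplus> x \<otimes> ((x \<ominus> z) \<otimes> Q \<oplus> Z) = (x \<ominus> z) \<otimes> (Z \<oplus> x \<otimes> Q) \<oplus> (c \<oplus> z \<otimes> Z)"
      using cl assms by algebra
    then show ?thesis unfolding q by (simp add: E) (simp add: Q_def Z_def)
  qed
qed simp

lemma nev_add:
  assumes "subring F R" "x \<in> carrier R"
  shows "\<lbrakk>set p \<subseteq> F; set q \<subseteq> F\<rbrakk> \<Longrightarrow> \<exists>s. set s \<subseteq> F \<and> nev R x s = nev R x p \<oplus> nev R x q"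
proof (induction p arbitrary: q)
  case Nil
  then have "nev R x q \<in> carrier R" using assms subringE(1)[OF assms(1)] by auto
  then show ?case using Nil by auto
next
  case (Cons c p)
  note C = subsetD[OF subringE(1)[OF assms(1)]]
  show ?case
  proof (cases q)
    case Nil
    have "nev R x (c # p) \<in> carrier R" using nev_in_carrier[OF assms(1) Cons.prems(1) assms(2)] .
    then show ?thesis using Nil Cons.prems by (intro exI[of _ "c # p"]) simp
  next
    case (Cons e q')
    with Cons.IH[of q'] Cons.prems obtain s where
      s: "set s \<subseteq> F" "nev R x s = nev R x p \<oplus> nev R x q'" by auto
    have "nev R x p \<in> carrier R" "nev R x q' \<in> carrier R" "c \<in> carrier R" "e \<in> carrier R"
      using Cons Cons.prems C assms nev_in_carrier[OF assms(1)] by auto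
    then have "nev R x ((c \<oplus> e) # s) = nev R x (c # p) \<oplus> nev R x q"
      using s Cons assms by simp algebra
    moreover have "set ((c \<oplus> e) # s) \<subseteq> F" using s Cons Cons.prems subringE(7)[OF assms(1)] by simp
    ultimately show ?thesis by blast
  qed
qed

lemma nev_smult:
  assumes "subring F R" "x \<in> carrier R" "c \<in> F"
  shows "set q \<subseteq> F \<Longrightarrow> set (map ((\<otimes>) c) q) \<subseteq> F \<and> nev R x (map ((\<otimes>) c) q) = c \<otimes> nev R x q"
proof (induction q)
  case (Cons e q)
  note C = subsetD[OF subringE(1)[OF assms(1)]]
  have "nev R x q \<in> carrier R" "e \<in> carrier R" "c \<in> carrier R" using Cons.prems C assms by auto
  then have "c \<otimes> e \<oplus> x \<otimes> (c \<otimes> nev R x q) = c \<otimes> (e \<oplus> x \<otimes> nev R x q)" using assms(2) by algebra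
  then show ?case using Cons subringE(6)[OF assms(1)] assms by auto
qed (use subsetD[OF subringE(1)[OF assms(1)]] assms in simp)

lemma nev_mult:
  assumes "subring F R" "x \<in> carrier R"
  shows "\<lbrakk>set p \<subseteq> F; set q \<subseteq> F\<rbrakk> \<Longrightarrow> \<exists>s. set s \<subseteq> F \<and> nev R x s = nev R x p \<otimes> nev R x q"
proof (induction p)
  case Nil
  note C = subsetD[OF subringE(1)[OF assms(1)]]
  have "nev R x q \<in> carrier R" using assms Nil C by auto
  then show ?case by (intro exI[of _ "[]"]) simp
next
  case (Cons c p)
  note C = subsetD[OF subringE(1)[OF assms(1)]]
  obtain s where s: "set s \<subseteq> F" "nev R x s = nev R x p \<otimes> nev R x q" using Cons by auto
  have cl: "nev R x p \<in> carrier R" "nev R x q \<in> carrier R" "c \<in> carrier R"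
    using Cons.prems C assms nev_in_carrier[OF assms(1)] by auto
  note m = nev_smult[OF assms, of c q]
  have "set (\<zero> # s) \<subseteq> F" using s subringE(2)[OF assms(1)] by simp
  with nev_add[OF assms, of "map ((\<otimes>) c) q" "\<zero> # s"] m Cons.prems obtain v where
    v: "set v \<subseteq> F" "nev R x v = c \<otimes> nev R x q \<oplus> nev R x (\<zero> # s)" by auto
  have "nev R x v = nev R x (c # p) \<otimes> nev R x q"
    unfolding v(2) using s(2) cl assms(2) by simp algebra
  then show ?case using v(1) by blast
qed

text \<open>This set is the ring F[x]. It is applied inside the dual numbers, with \<open>F\<close>
  the graph of a derivation, so \<open>F\<close> is an arbitrary subring of a ring that has zero
  divisors.\<close>

lemma subring_nev:
  assumes "subring F R" "x \<in> carrier R"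
  shows "subring {nev R x q |q. set q \<subseteq> F} R"
proof (rule subringI)
  note C = subsetD[OF subringE(1)[OF assms(1)]] and F = subringE[OF assms(1)]
  show "{nev R x q |q. set q \<subseteq> F} \<subseteq> carrier R" using assms C by auto
  show "\<one> \<in> {nev R x q |q. set q \<subseteq> F}"
    using F(3) assms(2) by (intro CollectI exI[of _ "[\<one>]"]) simp
  have m: "\<ominus> \<one> \<in> F" using F(3,5) by blast
  show "\<ominus> h \<in> {nev R x q |q. set q \<subseteq> F}" if "h \<in> {nev R x q |q. set q \<subseteq> F}" for h
  proof -
    obtain q where q: "set q \<subseteq> F" "h = nev R x q" using \<open>h \<in> _\<close> by auto
    then have "h \<in> carrier R" using assms C by auto
    then have "\<ominus> h = nev R x (map ((\<otimes>) (\<ominus> \<one>)) q)"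
      using nev_smult[OF assms m q(1)] q(2) by (simp add: l_minus)
    then show ?thesis using nev_smult[OF assms m q(1)] by blast
  qed
  fix h1 h2 assume "h1 \<in> {nev R x q |q. set q \<subseteq> F}" "h2 \<in> {nev R x q |q. set q \<subseteq> F}"
  then obtain q1 q2 where q: "set q1 \<subseteq> F" "h1 = nev R x q1" "set q2 \<subseteq> F" "h2 = nev R x q2" by blast
  show "h1 \<otimes> h2 \<in> {nev R x q |q. set q \<subseteq> F}"
    using nev_mult[OF assms q(1,3)] unfolding q(2,4) by force
  show "h1 \<oplus> h2 \<in> {nev R x q |q. set q \<subseteq> F}"
    using nev_add[OF assms q(1,3)] unfolding q(2,4) by force
qed

text \<open>One step of division by the monic polynomial \<open>p\<close>; \<open>e\<close> is the
  top coefficient of \<open>q\<close>. No coefficient is inverted, so the step also works over the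
  dual numbers.\<close>

lemma nev_reduce:
  assumes "subring F R" "x \<in> carrier R"
  shows "\<lbrakk>set p \<subseteq> F; set q \<subseteq> F; length q = Suc (length p)\<rbrakk> \<Longrightarrow>
    \<exists>e s. e \<in> F \<and> set s \<subseteq> F \<and> length s = length p \<and> nev R x q = nev R x s \<oplus> e \<otimes> ev R x p"
proof (induction p arbitrary: q)
  case Nil
  note C = subsetD[OF subringE(1)[OF assms(1)]]
  obtain e where "q = [e]" using Nil.prems(3) by (cases q) auto
  then show ?case using Nil.prems(2) C assms(2) by (intro exI[of _ e] exI[of _ "[]"]) auto
next
  case (Cons c p)
  note C = subsetD[OF subringE(1)[OF assms(1)]] and F = subringE[OF assms(1)]
  obtain b q' where q: "q = b # q'" using Cons.prems(3) by (cases q) auto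
  with Cons.IH[of q'] Cons.prems obtain e s where
    s: "e \<in> F" "set s \<subseteq> F" "length s = length p" "nev R x q' = nev R x s \<oplus> e \<otimes> ev R x p" by auto
  have cl: "nev R x s \<in> carrier R" "ev R x p \<in> carrier R" "c \<in> carrier R" "b \<in> carrier R" "e \<in> carrier R"
    using Cons.prems s C assms q nev_in_carrier[OF assms(1)] ev_in_carrier[OF assms(1)] by auto
  have "nev R x q = nev R x ((b \<ominus> e \<otimes> c) # s) \<oplus> e \<otimes> ev R x (c # p)"
    using cl assms(2) by (simp add: q s(4)) algebra
  moreover have "b \<ominus> e \<otimes> c \<in> F" using Cons.prems s(1) q F unfolding minus_eq by simp
  ultimately show ?case using s by (intro exI[of _ e] exI[of _ "(b \<ominus> e \<otimes> c) # s"]) simp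
qed

end

lemma (in cring) ev_replicate: "x \<in> carrier R \<Longrightarrow> ev R x (replicate n \<zero>) = x [^] n"
  by (induction n) (simp_all add: m_comm)

lemma (in field) subfield_inv_closed: "\<lbrakk>subfield F R; e \<in> F; e \<noteq> \<zero>\<rbrakk> \<Longrightarrow> inv e \<in> F \<and> e \<otimes> inv e = \<one> \<and> inv e \<noteq> \<zero>"
  using subfield_m_inv[of F e] by auto

text \<open>\<open>e\<close> is the highest nonzero coefficient, and zeros above it are dropped. The
  strict inequality of lengths reflects that the leading 1 of a monic polynomial is not listed; it
  is what contradicts the minimality of a minimal polynomial later.\<close>

lemma (in field) nev_eq_smult_ev:
  assumes "subfield F R"
  shows "\<lbrakk>set q \<subseteq> F; \<exists>c\<in>set q. c \<noteq> \<zero>\<rbrakk> \<Longrightarrow> \<exists>e s. e \<in> F \<and> e \<noteq> \<zero> \<and> set s \<subseteq> F \<and>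
    length s < length q \<and> (\<forall>x\<in>carrier R. nev R x q = e \<otimes> ev R x s)"
proof (induction q)
  case (Cons c q)
  note F = subringE[OF subfieldE(1)[OF assms]]
  note C = subsetD[OF F(1)]
  show ?case
  proof (cases "\<exists>c\<in>set q. c \<noteq> \<zero>")
    case True
    then obtain e s where es: "e \<in> F" "e \<noteq> \<zero>" "set s \<subseteq> F" "length s < length q"
      "\<And>x. x \<in> carrier R \<Longrightarrow> nev R x q = e \<otimes> ev R x s" using Cons by auto
    note e = subfield_inv_closed[OF assms es(1,2)]
    have "nev R x (c # q) = e \<otimes> ev R x ((inv e \<otimes> c) # s)" if "x \<in> carrier R" for x
    proof -
      have cl: "ev R x s \<in> carrier R" "c \<in> carrier R" "e \<in> carrier R" "inv e \<in> carrier R"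
        using Cons.prems es e C that ev_in_carrier[OF subfieldE(1)[OF assms]] by auto
      have "c = e \<otimes> (inv e \<otimes> c)" using cl e by (simp add: m_assoc[symmetric])
      then have "nev R x (c # q) = e \<otimes> (inv e \<otimes> c) \<oplus> x \<otimes> (e \<otimes> ev R x s)" using es(5) that by simp
      also have "\<dots> = e \<otimes> ev R x ((inv e \<otimes> c) # s)"
        using cl that by (simp add: r_distr m_lcomm)
      finally show ?thesis .
    qed
    moreover have "inv e \<otimes> c \<in> F" using e Cons.prems F(6) by simp
    ultimately show ?thesis using es
      by (intro exI[of _ e] exI[of _ "(inv e \<otimes> c) # s"]) simp
  next
    case False
    have z: "nev R x q = \<zero>" if "x \<in> carrier R" "\<forall>c\<in>set q. c = \<zero>" for x and q :: "'a list"
      using that by (induction q) auto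
    have "c \<noteq> \<zero>" "c \<in> F" using False Cons.prems by auto
    then show ?thesis using z False C by (intro exI[of _ c] exI[of _ "[]"]) auto
  qed
qed simp

text \<open>The two leading coefficients add up to \<open>\<alpha> \<oplus> \<beta>\<close>, and
  dividing by it makes the combination monic. This is the step by which the derivative of a monic
  polynomial is normalized.\<close>

lemma (in field) ev_combination:
  assumes "subfield F R" "\<alpha> \<in> F" "\<beta> \<in> F" "\<alpha> \<oplus> \<beta> \<noteq> \<zero>" "x \<in> carrier R"
  shows "\<lbrakk>set p \<subseteq> F; set q \<subseteq> F; length p = length q\<rbrakk> \<Longrightarrow>
    \<exists>s. set s \<subseteq> F \<and> length s = length p \<and> \<alpha> \<otimes> ev R x p \<oplus> \<beta> \<otimes> ev R x q = (\<alpha> \<oplus> \<beta>) \<otimes> ev R x s"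
proof (induction p arbitrary: q)
  case Nil
  note C = subsetD[OF subringE(1)[OF subfieldE(1)[OF assms(1)]]]
  show ?case using Nil C assms(2,3) by (intro exI[of _ "[]"]) simp
next
  case (Cons c p)
  note F = subringE[OF subfieldE(1)[OF assms(1)]]
  note C = subsetD[OF F(1)]
  obtain e q' where q: "q = e # q'" using Cons.prems(3) by (cases q) auto
  with Cons.IH[of q'] Cons.prems obtain s where s: "set s \<subseteq> F" "length s = length p"
    "\<alpha> \<otimes> ev R x p \<oplus> \<beta> \<otimes> ev R x q' = (\<alpha> \<oplus> \<beta>) \<otimes> ev R x s" by auto
  have sF: "\<alpha> \<oplus> \<beta> \<in> F" using assms F by blast
  note w = subfield_inv_closed[OF assms(1) sF assms(4)]
  define v where "v = inv (\<alpha> \<oplus> \<beta>) \<otimes> (\<alpha> \<otimes> c \<oplus> \<beta> \<otimes> e)"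
  have cl: "ev R x p \<in> carrier R" "ev R x q' \<in> carrier R" "ev R x s \<in> carrier R" "\<alpha> \<in> carrier R"
    "\<beta> \<in> carrier R" "c \<in> carrier R" "e \<in> carrier R" "inv (\<alpha> \<oplus> \<beta>) \<in> carrier R"
    using Cons.prems s q C assms w ev_in_carrier[OF subfieldE(1)[OF assms(1)]] by auto
  have "(\<alpha> \<oplus> \<beta>) \<otimes> v = (\<alpha> \<oplus> \<beta>) \<otimes> inv (\<alpha> \<oplus> \<beta>) \<otimes> (\<alpha> \<otimes> c \<oplus> \<beta> \<otimes> e)"
    unfolding v_def by (subst m_assoc) (use cl in simp_all)
  then have v: "(\<alpha> \<oplus> \<beta>) \<otimes> v = \<alpha> \<otimes> c \<oplus> \<beta> \<otimes> e" using w cl by simp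
  have vF: "v \<in> F" unfolding v_def using w assms Cons.prems q F by auto
  have "\<alpha> \<otimes> ev R x (c # p) \<oplus> \<beta> \<otimes> ev R x q =
    (\<alpha> \<otimes> c \<oplus> \<beta> \<otimes> e) \<oplus> x \<otimes> (\<alpha> \<otimes> ev R x p \<oplus> \<beta> \<otimes> ev R x q')"
    unfolding q using cl assms(5) by simp algebra
  also have "\<dots> = (\<alpha> \<oplus> \<beta>) \<otimes> v \<oplus> x \<otimes> ((\<alpha> \<oplus> \<beta>) \<otimes> ev R x s)" by (simp only: v s(3))
  also have "\<dots> = (\<alpha> \<oplus> \<beta>) \<otimes> ev R x (v # s)"
    using cl assms(5) C[OF vF] by (simp add: r_distr m_lcomm)
  finally show ?case using s vF by (intro exI[of _ "v # s"]) simp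
qed

text \<open>The derivative of a monic polynomial of degree \<open>n\<close> has leading coefficient
  \<open>n\<close>, invertible in characteristic zero. Written as a multiple of a monic polynomial
  of smaller degree, it cannot vanish at a root of a minimal polynomial.\<close>

lemma (in field) dev_eq_smult_ev:
  assumes "subfield F R" "x \<in> carrier R" "\<And>n::nat. 0 < n \<Longrightarrow> [n] \<cdot> \<one> \<noteq> \<zero>"
  shows "\<lbrakk>set p \<subseteq> F; p \<noteq> []\<rbrakk> \<Longrightarrow>
    \<exists>s. set s \<subseteq> F \<and> Suc (length s) = length p \<and> dev R x p = ([length p] \<cdot> \<one>) \<otimes> ev R x s"
proof (induction p)
  case (Cons c p)
  note F = subringE[OF subfieldE(1)[OF assms(1)]]
  note C = subsetD[OF F(1)]
  show ?case
  proof (cases "p = []")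
    case True
    then show ?thesis using assms(2) by (intro exI[of _ "[]"]) simp
  next
    case False
    then obtain s where s: "set s \<subseteq> F" "Suc (length s) = length p"
      "dev R x p = ([length p] \<cdot> \<one>) \<otimes> ev R x s" using Cons by auto
    have nF: "[n] \<cdot> \<one> \<in> F" for n :: nat by (induction n) (use F in auto)
    have S: "[length (c # p)] \<cdot> \<one> = \<one> \<oplus> [length p] \<cdot> \<one>" using a_comm by simp
    have ne: "\<one> \<oplus> [length p] \<cdot> \<one> \<noteq> \<zero>" using assms(3)[of "length (c # p)"] unfolding S by simp
    have "set (\<zero> # s) \<subseteq> F" "length p = length (\<zero> # s)" using s F by auto
    then obtain v where v: "set v \<subseteq> F" "length v = length p"
      "\<one> \<otimes> ev R x p \<oplus> [length p] \<cdot> \<one> \<otimes> ev R x (\<zero> # s) = (\<one> \<oplus> [length p] \<cdot> \<one>) \<otimes> ev R x v"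
      using ev_combination[OF assms(1) F(3) nF ne assms(2), of p "\<zero> # s"] Cons.prems by auto
    have cl: "ev R x p \<in> carrier R" "ev R x s \<in> carrier R" "[length p] \<cdot> \<one> \<in> carrier R"
      using Cons.prems s C[OF nF] assms(2) ev_in_carrier[OF subfieldE(1)[OF assms(1)]] by auto
    have "dev R x (c # p) = \<one> \<otimes> ev R x p \<oplus> [length p] \<cdot> \<one> \<otimes> ev R x (\<zero> # s)"
      using cl assms(2) by (simp add: s(3) m_lcomm)
    then show ?thesis using v unfolding S by auto
  qed
qed simp

section \<open>Dual numbers and the extension of derivations\<close>

definition dual :: "('a, 'b) ring_scheme \<Rightarrow> ('a \<times> 'a) ring"
  where "dual R =
    \<lparr>carrier = carrier R \<times> carrier R,
     monoid.mult = (\<lambda>x y. (fst x \<otimes>\<^bsub>R\<^esub> fst y, fst x \<otimes>\<^bsub>R\<^esub> snd y \<oplus>\<^bsub>R\<^esub> snd x \<otimes>\<^bsub>R\<^esub> fst y)),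
     one = (\<one>\<^bsub>R\<^esub>, \<zero>\<^bsub>R\<^esub>),
     ring.zero = (\<zero>\<^bsub>R\<^esub>, \<zero>\<^bsub>R\<^esub>),
     add = (\<lambda>x y. (fst x \<oplus>\<^bsub>R\<^esub> fst y, snd x \<oplus>\<^bsub>R\<^esub> snd y))\<rparr>"

lemma dual_simps:
  "carrier (dual R) = carrier R \<times> carrier R" "\<one>\<^bsub>dual R\<^esub> = (\<one>\<^bsub>R\<^esub>, \<zero>\<^bsub>R\<^esub>)" "\<zero>\<^bsub>dual R\<^esub> = (\<zero>\<^bsub>R\<^esub>, \<zero>\<^bsub>R\<^esub>)"
  "x \<otimes>\<^bsub>dual R\<^esub> y = (fst x \<otimes>\<^bsub>R\<^esub> fst y, fst x \<otimes>\<^bsub>R\<^esub> snd y \<oplus>\<^bsub>R\<^esub> snd x \<otimes>\<^bsub>R\<^esub> fst y)"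
  "x \<oplus>\<^bsub>dual R\<^esub> y = (fst x \<oplus>\<^bsub>R\<^esub> fst y, snd x \<oplus>\<^bsub>R\<^esub> snd y)"
  by (simp_all add: dual_def)

lemma fst_ev_dual: "fst (ev (dual R) t p) = ev R (fst t) (map fst p)"
  by (induction p) (simp_all add: dual_simps)

lemma fst_nev_dual: "fst (nev (dual R) t p) = nev R (fst t) (map fst p)"
  by (induction p) (simp_all add: dual_simps)

lemma (in cring) nev_zero: "x \<in> carrier R \<Longrightarrow> \<forall>c\<in>set q. c = \<zero> \<Longrightarrow> nev R x q = \<zero>"
  by (induction q) auto

context field
begin

text \<open>The pair \<open>(a, b)\<close> stands for a + b\<epsilon> with \<epsilon> squared equal
  to 0. Being a commutative ring, the dual numbers admit Horner evaluation of polynomials whose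
  coefficients carry their derivatives along.\<close>

lemma cring_dual: "cring (dual R)"
proof (rule cringI)
  show "abelian_group (dual R)"
  proof (rule abelian_groupI)
    fix x assume "x \<in> carrier (dual R)"
    then show "\<exists>y\<in>carrier (dual R). y \<oplus>\<^bsub>dual R\<^esub> x = \<zero>\<^bsub>dual R\<^esub>"
      by (intro bexI[of _ "(\<ominus> fst x, \<ominus> snd x)"]) (auto simp: dual_simps l_neg)
  qed (auto simp: dual_simps a_ac)
  show "comm_monoid (dual R)"
    by (rule comm_monoidI) (auto simp: dual_simps m_ac a_ac r_distr l_distr)
qed (auto simp: dual_simps l_distr r_distr a_ac)

lemma neg_dual: "x \<in> carrier (dual R) \<Longrightarrow> \<ominus>\<^bsub>dual R\<^esub> x = (\<ominus> fst x, \<ominus> snd x)"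
  using abelian_group.minus_equality[of "dual R" "(\<ominus> fst x, \<ominus> snd x)" x] cring_dual
  by (auto simp: cring_def ring_def dual_simps l_neg)

text \<open>Taylor's formula: moving the argument from s to s + u\<epsilon> changes the
  \<epsilon>-part by \<open>u\<close> times the derivative at \<open>s\<close> of the polynomial
  formed by the first components.\<close>

lemma snd_ev_dual:
  assumes "s \<in> carrier R" "u \<in> carrier R"
  shows "set p \<subseteq> carrier (dual R) \<Longrightarrow>
    snd (ev (dual R) (s, u) p) = snd (ev (dual R) (s, \<zero>) p) \<oplus> u \<otimes> dev R s (map fst p)"
proof (induction p)
  case (Cons c p)
  define E where "E = ev R s (map fst p)"
  define S where "S = snd (ev (dual R) (s, \<zero>) p)"
  define T where "T = dev R s (map fst p)"
  have p: "set (map fst p) \<subseteq> carrier R" using Cons.prems by (auto simp: dual_simps)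
  have c: "snd c \<in> carrier R" using Cons.prems by (auto simp: dual_simps)
  have "ev (dual R) (s, \<zero>) p \<in> carrier (dual R)"
    using Cons.prems assms by (intro cring.ev_carrier[OF cring_dual]) (auto simp: dual_simps)
  then have cl: "E \<in> carrier R" "S \<in> carrier R" "T \<in> carrier R" "snd c \<in> carrier R"
    using p assms c by (auto simp: E_def S_def T_def dual_simps)
  have "snd (ev (dual R) (s, u) (c # p)) = snd c \<oplus> (s \<otimes> (S \<oplus> u \<otimes> T) \<oplus> u \<otimes> E)"
    using Cons by (simp add: dual_simps fst_ev_dual S_def T_def E_def)
  moreover have "snd (ev (dual R) (s, \<zero>) (c # p)) = snd c \<oplus> (s \<otimes> S \<oplus> \<zero> \<otimes> E)"
    by (simp add: dual_simps fst_ev_dual S_def E_def)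
  moreover have "snd c \<oplus> (s \<otimes> (S \<oplus> u \<otimes> T) \<oplus> u \<otimes> E) = (snd c \<oplus> (s \<otimes> S \<oplus> \<zero> \<otimes> E)) \<oplus> u \<otimes> (E \<oplus> s \<otimes> T)"
    using cl assms by algebra
  ultimately show ?case by (simp add: E_def T_def)
qed (use assms in \<open>simp add: dual_simps\<close>)

text \<open>The graph \<open>{(x, D x)}\<close> of a derivation \<open>D : F \<rightarrow> R\<close> on a subfield \<open>F\<close>, as a subring of the
  dual numbers \<open>R[\<epsilon>]\<close>.\<close>

definition deriv_graph :: "('a \<times> 'a) set \<Rightarrow> bool"
  where "deriv_graph G \<longleftrightarrow> subring G (dual R) \<and> (\<forall>y. (\<zero>, y) \<in> G \<longrightarrow> y = \<zero>) \<and>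
    (\<forall>x\<in>G. fst x \<noteq> \<zero> \<longrightarrow> (\<exists>y\<in>G. x \<otimes>\<^bsub>dual R\<^esub> y = \<one>\<^bsub>dual R\<^esub>))"

text \<open>With v = 1/p the inverse of p + q\<epsilon> is v - q v^2 \<epsilon>.\<close>

lemma dual_inv:
  assumes "x \<in> carrier (dual R)" "fst x \<noteq> \<zero>"
  shows "\<exists>y\<in>carrier (dual R). x \<otimes>\<^bsub>dual R\<^esub> y = \<one>\<^bsub>dual R\<^esub>"
proof -
  obtain p q where x: "x = (p, q)" "p \<in> carrier R" "q \<in> carrier R" "p \<noteq> \<zero>"
    using assms by (cases x) (auto simp: dual_simps)
  define v where "v = inv p"
  have v: "v \<in> carrier R" "p \<otimes> v = \<one>" unfolding v_def using x field_Units by auto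
  have "p \<otimes> (\<ominus> (q \<otimes> v \<otimes> v)) \<oplus> q \<otimes> v = q \<otimes> v \<ominus> (p \<otimes> v) \<otimes> (q \<otimes> v)"
    using x v(1) by algebra
  also have "\<dots> = \<zero>" using x v by (simp add: minus_eq r_neg)
  finally have "p \<otimes> (\<ominus> (q \<otimes> v \<otimes> v)) \<oplus> q \<otimes> v = \<zero>" .
  then show ?thesis using x v by (intro bexI[of _ "(v, \<ominus> (q \<otimes> v \<otimes> v))"]) (simp_all add: dual_simps)
qed

text \<open>The quotient rule: \<open>G\<close> consists of the fractions with numerator and
  denominator in \<open>A\<close>, the denominator having nonzero first component. It remains the
  graph of a function, because multiplying an element \<open>(\<zero>, y)\<close> by its denominator
  leads back into \<open>A\<close>.\<close>

lemma deriv_graph_localize: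
  assumes "subring A (dual R)" "\<And>y. (\<zero>, y) \<in> A \<Longrightarrow> y = \<zero>"
  shows "\<exists>G. deriv_graph G \<and> A \<subseteq> G"
proof -
  interpret S: cring "dual R" by (rule cring_dual)
  define G where "G = {x \<in> carrier (dual R). \<exists>h\<in>A. fst h \<noteq> \<zero> \<and> h \<otimes>\<^bsub>dual R\<^esub> x \<in> A}"
  note A = subringE[OF assms(1)]
  note C = subsetD[OF A(1)]
  have GI: "x \<in> G" if "x \<in> carrier (dual R)" "h \<in> A" "fst h \<noteq> \<zero>" "h \<otimes>\<^bsub>dual R\<^esub> x \<in> A" for x h
    using that by (auto simp: G_def)
  have sub: "A \<subseteq> G"
  proof
    fix x assume x: "x \<in> A"
    show "x \<in> G" using x C[OF x] A(3) S.l_one[OF C[OF x]] one_not_zero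
      by (intro GI[of x "\<one>\<^bsub>dual R\<^esub>"]) (auto simp: dual_simps(2))
  qed
  have prod: "h \<otimes>\<^bsub>dual R\<^esub> h' \<in> A \<and> fst (h \<otimes>\<^bsub>dual R\<^esub> h') \<noteq> \<zero>"
    if "h \<in> A" "h' \<in> A" "fst h \<noteq> \<zero>" "fst h' \<noteq> \<zero>" for h h'
    using that A(6) C[of h] C[of h'] integral_iff by (auto simp: dual_simps)
  have "subring G (dual R)"
  proof (rule S.subringI)
    show "G \<subseteq> carrier (dual R)" by (auto simp: G_def)
    show "\<one>\<^bsub>dual R\<^esub> \<in> G" using sub A(3) by blast
    show "\<ominus>\<^bsub>dual R\<^esub> x \<in> G" if "x \<in> G" for x
    proof -
      obtain h where h: "x \<in> carrier (dual R)" "h \<in> A" "fst h \<noteq> \<zero>" "h \<otimes>\<^bsub>dual R\<^esub> x \<in> A"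
        using \<open>x \<in> G\<close> by (auto simp: G_def)
      show ?thesis using h A(5)[OF h(4)] C[OF h(2)] by (intro GI[OF _ h(2,3)]) (simp_all add: S.r_minus)
    qed
    fix x y assume "x \<in> G" "y \<in> G"
    then obtain h h' where h: "x \<in> carrier (dual R)" "h \<in> A" "fst h \<noteq> \<zero>" "h \<otimes>\<^bsub>dual R\<^esub> x \<in> A"
      and h': "y \<in> carrier (dual R)" "h' \<in> A" "fst h' \<noteq> \<zero>" "h' \<otimes>\<^bsub>dual R\<^esub> y \<in> A"
      by (auto simp: G_def)
    note p = prod[OF h(2) h'(2) h(3) h'(3)]
    have c: "h \<in> carrier (dual R)" "h' \<in> carrier (dual R)" using h h' C by blast+
    have "(h \<otimes>\<^bsub>dual R\<^esub> h') \<otimes>\<^bsub>dual R\<^esub> (x \<otimes>\<^bsub>dual R\<^esub> y) = (h \<otimes>\<^bsub>dual R\<^esub> x) \<otimes>\<^bsub>dual R\<^esub> (h' \<otimes>\<^bsub>dual R\<^esub> y)"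
      using c h(1) h'(1) by (simp add: S.m_ac)
    then show "x \<otimes>\<^bsub>dual R\<^esub> y \<in> G" using p h h' A(6) by (intro GI[of _ "h \<otimes>\<^bsub>dual R\<^esub> h'"]) auto
    have "(h \<otimes>\<^bsub>dual R\<^esub> h') \<otimes>\<^bsub>dual R\<^esub> (x \<oplus>\<^bsub>dual R\<^esub> y) =
      h' \<otimes>\<^bsub>dual R\<^esub> (h \<otimes>\<^bsub>dual R\<^esub> x) \<oplus>\<^bsub>dual R\<^esub> h \<otimes>\<^bsub>dual R\<^esub> (h' \<otimes>\<^bsub>dual R\<^esub> y)"
      using c h(1) h'(1) by (simp add: S.r_distr S.m_ac)
    then show "x \<oplus>\<^bsub>dual R\<^esub> y \<in> G" using p h h' A(6,7) by (intro GI[of _ "h \<otimes>\<^bsub>dual R\<^esub> h'"]) auto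
  qed
  moreover have "y = \<zero>" if y: "(\<zero>, y) \<in> G" for y
  proof -
    obtain h where h: "(\<zero>, y) \<in> carrier (dual R)" "h \<in> A" "fst h \<noteq> \<zero>" "h \<otimes>\<^bsub>dual R\<^esub> (\<zero>, y) \<in> A"
      using y unfolding G_def by blast
    then have "y \<in> carrier R" "fst h \<in> carrier R" "snd h \<in> carrier R" using C[OF h(2)] by (auto simp: dual_simps)
    then show ?thesis using h assms(2)[of "fst h \<otimes> y"] integral_iff by (auto simp: dual_simps)
  qed
  moreover have "\<exists>y\<in>G. x \<otimes>\<^bsub>dual R\<^esub> y = \<one>\<^bsub>dual R\<^esub>" if x: "x \<in> G" "fst x \<noteq> \<zero>" for x
  proof -
    obtain h where h: "x \<in> carrier (dual R)" "h \<in> A" "fst h \<noteq> \<zero>" "h \<otimes>\<^bsub>dual R\<^esub> x \<in> A"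
      using x by (auto simp: G_def)
    obtain y where y: "y \<in> carrier (dual R)" "x \<otimes>\<^bsub>dual R\<^esub> y = \<one>\<^bsub>dual R\<^esub>" using dual_inv[OF h(1) x(2)] by blast
    have "(h \<otimes>\<^bsub>dual R\<^esub> x) \<otimes>\<^bsub>dual R\<^esub> y = h" using h y C by (simp add: S.m_assoc)
    moreover have "fst (h \<otimes>\<^bsub>dual R\<^esub> x) \<noteq> \<zero>"
      using C[OF h(2)] h(1,3) x(2) integral_iff by (auto simp: dual_simps)
    ultimately have "y \<in> G" using y h by (intro GI[of y "h \<otimes>\<^bsub>dual R\<^esub> x"]) auto
    then show ?thesis using y by blast
  qed
  ultimately show ?thesis using sub unfolding deriv_graph_def by blast
qed

lemma deriv_graphD:
  assumes "deriv_graph G"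
  shows "subring G (dual R)" "\<And>y. (\<zero>, y) \<in> G \<Longrightarrow> y = \<zero>"
    "\<And>x. x \<in> G \<Longrightarrow> fst x \<in> carrier R \<and> snd x \<in> carrier R"
  using assms subringE(1) unfolding deriv_graph_def by (fastforce simp: dual_simps)+

lemma subfield_deriv_graph:
  assumes "deriv_graph G" shows "subfield (fst ` G) R"
proof (rule subfieldI')
  note G = subringE[OF deriv_graphD(1)[OF assms]] and c = deriv_graphD(3)[OF assms]
  show "subring (fst ` G) R"
  proof (rule subringI)
    show "fst ` G \<subseteq> carrier R" using c by auto
    show "\<one> \<in> fst ` G" using G(3) by (force simp: dual_simps)
    show "\<ominus> h \<in> fst ` G" if h: "h \<in> fst ` G" for h
    proof -
      obtain x where x: "x \<in> G" "h = fst x" using h by blast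
      have "fst (\<ominus>\<^bsub>dual R\<^esub> x) = \<ominus> h" using x G(1) by (subst neg_dual) auto
      then show ?thesis using G(5)[OF x(1)] by force
    qed
    fix h h' assume "h \<in> fst ` G" "h' \<in> fst ` G"
    then obtain x y where xy: "x \<in> G" "h = fst x" "y \<in> G" "h' = fst y" by auto
    have "fst (x \<otimes>\<^bsub>dual R\<^esub> y) = h \<otimes> h'" "fst (x \<oplus>\<^bsub>dual R\<^esub> y) = h \<oplus> h'" using xy by (auto simp: dual_simps)
    then show "h \<otimes> h' \<in> fst ` G" "h \<oplus> h' \<in> fst ` G"
      using imageI[OF G(6)[OF xy(1,3)], of fst] imageI[OF G(7)[OF xy(1,3)], of fst] by simp_all
  qed
  fix h assume "h \<in> fst ` G - {\<zero>}"
  then obtain x where x: "x \<in> G" "h = fst x" "h \<noteq> \<zero>" by auto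
  then obtain y where y: "y \<in> G" "x \<otimes>\<^bsub>dual R\<^esub> y = \<one>\<^bsub>dual R\<^esub>" using assms by (auto simp: deriv_graph_def)
  then have "h \<otimes> fst y = \<one>" using x by (simp add: dual_simps)
  then have "inv h = fst y" using c[OF x(1)] c[OF y(1)] x by (intro comm_inv_char) auto
  then show "inv h \<in> fst ` G" using y by force
qed

text \<open>The part common to transcendental and algebraic elements. Coefficients in
  \<open>G\<close> with vanishing first component are zero, since \<open>G\<close> is a graph; the
  hypothesis on \<open>q\<close> therefore says that the ring G[t] is again a graph, and localizing
  makes its domain a field.\<close>

lemma deriv_graph_adjoin_aux:
  assumes G: "deriv_graph G" and t: "t \<in> carrier (dual R)"
    and *: "\<And>q. \<lbrakk>set q \<subseteq> G; fst (nev (dual R) t q) = \<zero>\<rbrakk> \<Longrightarrow>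
      \<exists>p. set p \<subseteq> G \<and> nev (dual R) t q = nev (dual R) t p \<and> (\<forall>c\<in>set p. fst c = \<zero>)"
  shows "\<exists>G'. deriv_graph G' \<and> G \<subseteq> G' \<and> t \<in> G'"
proof -
  interpret S: cring "dual R" by (rule cring_dual)
  note gr = subringE[OF deriv_graphD(1)[OF G]]
  note C = subsetD[OF gr(1)]
  define A where "A = {nev (dual R) t q |q. set q \<subseteq> G}"
  have A: "subring A (dual R)" unfolding A_def by (rule S.subring_nev[OF deriv_graphD(1)[OF G] t])
  have z: "y = \<zero>" if y: "(\<zero>, y) \<in> A" for y
  proof -
    obtain q where q: "set q \<subseteq> G" "nev (dual R) t q = (\<zero>, y)" using y by (force simp: A_def)
    with *[of q] obtain p where p: "set p \<subseteq> G" "nev (dual R) t p = (\<zero>, y)" "\<forall>c\<in>set p. fst c = \<zero>" by auto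
    have "c = \<zero>\<^bsub>dual R\<^esub>" if "c \<in> set p" for c
    proof -
      have "c \<in> G" "c = (\<zero>, snd c)" using that p by (auto intro: prod_eqI)
      then show ?thesis using deriv_graphD(2)[OF G, of "snd c"] by (simp add: dual_simps)
    qed
    then have "nev (dual R) t p = \<zero>\<^bsub>dual R\<^esub>" using S.nev_zero[OF t] by blast
    then show ?thesis using p by (simp add: dual_simps)
  qed
  obtain G' where G': "deriv_graph G'" "A \<subseteq> G'" using deriv_graph_localize[OF A z] by blast
  have "x \<in> A" if "x \<in> G" for x
    unfolding A_def using that C[OF that] t by (intro CollectI exI[of _ "[x]"]) simp
  moreover have "t \<in> A"
    unfolding A_def using t gr(2,3) by (intro CollectI exI[of _ "[\<zero>\<^bsub>dual R\<^esub>, \<one>\<^bsub>dual R\<^esub>]"]) simp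
  ultimately show ?thesis using G' by blast
qed

text \<open>A polynomial vanishing at \<open>s\<close> has only zero coefficients, so no relation
  restricts the derivative \<open>u\<close> of \<open>s\<close>. This freedom is used to prescribe
  the value 1.\<close>

lemma deriv_graph_adjoin_transcendental:
  assumes G: "deriv_graph G" and "s \<in> carrier R" "u \<in> carrier R"
    and tr: "\<And>p. set p \<subseteq> fst ` G \<Longrightarrow> ev R s p \<noteq> \<zero>"
  shows "\<exists>G'. deriv_graph G' \<and> G \<subseteq> G' \<and> (s, u) \<in> G'"
proof (rule deriv_graph_adjoin_aux[OF G])
  show "(s, u) \<in> carrier (dual R)" using assms by (simp add: dual_simps)
  fix q assume q: "set q \<subseteq> G" "fst (nev (dual R) (s, u) q) = \<zero>"
  note F = subfield_deriv_graph[OF G]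
  have "set (map fst q) \<subseteq> fst ` G" using q by auto
  have "\<forall>c\<in>set q. fst c = \<zero>"
  proof (rule ccontr)
    assume "\<not> ?thesis"
    then obtain e p where e: "e \<in> fst ` G" "e \<noteq> \<zero>" "set p \<subseteq> fst ` G"
      "\<forall>x\<in>carrier R. nev R x (map fst q) = e \<otimes> ev R x p"
      using nev_eq_smult_ev[OF F \<open>set (map fst q) \<subseteq> _\<close>] by auto
    then have "e \<otimes> ev R s p = \<zero>" using q(2) assms(2) by (simp add: fst_nev_dual)
    moreover have "e \<in> carrier R" "ev R s p \<in> carrier R"
      using e(1,3) subringE(1)[OF subfieldE(1)[OF F]] assms(2) ev_in_carrier[OF subfieldE(1)[OF F]] by auto
    ultimately show False using e(2) tr[OF e(3)] integral_iff by blast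
  qed
  then show "\<exists>p. set p \<subseteq> G \<and> nev (dual R) (s, u) q = nev (dual R) (s, u) p \<and> (\<forall>c\<in>set p. fst c = \<zero>)"
    using q by blast
qed

text \<open>For transcendental \<open>s\<close> the derivative 0 is chosen. For algebraic
  \<open>s\<close> it is forced: differentiating the minimal equation gives a linear equation for
  \<open>u\<close> with coefficient the derivative of \<open>p\<close> at \<open>s\<close>, which is
  nonzero by minimality and characteristic zero.\<close>

lemma deriv_graph_adjoin:
  assumes G: "deriv_graph G" and s: "s \<in> carrier R"
    and char: "\<And>n::nat. 0 < n \<Longrightarrow> [n] \<cdot> \<one> \<noteq> \<zero>"
  shows "\<exists>G'. deriv_graph G' \<and> G \<subseteq> G' \<and> s \<in> fst ` G'"
proof (cases "\<exists>p. set p \<subseteq> fst ` G \<and> ev R s p = \<zero>")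
  case False
  then have "\<And>p. set p \<subseteq> fst ` G \<Longrightarrow> ev R s p \<noteq> \<zero>" by blast
  from deriv_graph_adjoin_transcendental[OF G s zero_closed this]
  obtain G' where "deriv_graph G'" "G \<subseteq> G'" "(s, \<zero>) \<in> G'" by blast
  moreover from this(3) have "s \<in> fst ` G'" by (metis fst_conv imageI)
  ultimately show ?thesis by blast
next
  case True
  interpret S: cring "dual R" by (rule cring_dual)
  note F = subfield_deriv_graph[OF G]
  note Fs = subringE[OF subfieldE(1)[OF F]]
  note Gs = deriv_graphD(1)[OF G]
  define P where "P p \<longleftrightarrow> set p \<subseteq> fst ` G \<and> ev R s p = \<zero>" for p
  define p where "p = arg_min length P"
  obtain p0 where "P p0" using True unfolding P_def by blast
  then have "P p" unfolding p_def by (rule arg_min_natI)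
  then have p: "set p \<subseteq> fst ` G" "ev R s p = \<zero>" by (auto simp: P_def)
  have min: "length p \<le> length q" if "set q \<subseteq> fst ` G" "ev R s q = \<zero>" for q
    unfolding p_def using that by (intro arg_min_nat_le) (simp add: P_def)
  have "p \<noteq> []" using p by auto
  from dev_eq_smult_ev[OF F s char p(1) this] obtain p' where
    p': "set p' \<subseteq> fst ` G" "Suc (length p') = length p" "dev R s p = [length p] \<cdot> \<one> \<otimes> ev R s p'" by blast
  have cl: "set p \<subseteq> carrier R" "ev R s p' \<in> carrier R"
    using p p' Fs(1) s ev_in_carrier[OF subfieldE(1)[OF F]] by auto
  have "ev R s p' \<noteq> \<zero>" using min[of p'] p' by auto
  then have dp: "dev R s p \<noteq> \<zero>" "dev R s p \<in> carrier R"
    using p' cl s char[of "length p"] \<open>p \<noteq> []\<close> integral_iff by auto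
  obtain h where h: "set h \<subseteq> G" "map fst h = p"
  proof -
    have "p \<in> lists (fst ` G)" using p(1) by auto
    then have "p \<in> map fst ` lists G" by (simp add: lists_image)
    then show thesis using that by auto
  qed
  define v where "v = snd (ev (dual R) (s, \<zero>) h)"
  \<comment> \<open>chosen such that \<open>s + \<epsilon>u\<close> is a root of the lift \<open>h\<close> of the minimal polynomial of \<open>s\<close>\<close>
  define u where "u = \<ominus> (v \<otimes> inv (dev R s p))"
  have hc: "set h \<subseteq> carrier (dual R)" using h subringE(1)[OF Gs] by blast
  then have "ev (dual R) (s, \<zero>) h \<in> carrier (dual R)"
    using s by (intro S.ev_carrier) (auto simp: dual_simps)
  then have v: "v \<in> carrier R" by (auto simp: v_def dual_simps)
  have i: "inv (dev R s p) \<in> carrier R" "inv (dev R s p) \<otimes> dev R s p = \<one>"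
    using dp field_Units by auto
  then have u: "u \<in> carrier R" using v by (simp add: u_def)
  have "snd (ev (dual R) (s, u) h) = v \<oplus> u \<otimes> dev R s p"
    using snd_ev_dual[OF s u hc] by (simp add: v_def h(2))
  also have "\<dots> = v \<ominus> v \<otimes> (inv (dev R s p) \<otimes> dev R s p)"
    using v i(1) dp by (simp add: u_def minus_eq l_minus m_assoc)
  also have "\<dots> = \<zero>" using v i by (simp add: minus_eq r_neg)
  finally have eh: "ev (dual R) (s, u) h = \<zero>\<^bsub>dual R\<^esub>"
    using fst_ev_dual[of R "(s, u)" h] p h by (simp add: dual_simps prod_eq_iff)
  have t: "(s, u) \<in> carrier (dual R)" using s u by (simp add: dual_simps)
  \<comment> \<open>Repeated division by the monic \<open>h\<close>, which vanishes at s +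
    u\<epsilon>, brings every polynomial below the degree of \<open>h\<close>. Its first components
    then form a polynomial of degree below that of \<open>p\<close>, so if it vanishes at
    \<open>s\<close> minimality makes all of them zero.\<close>
  have red: "\<exists>b. set b \<subseteq> G \<and> length b = length h \<and> nev (dual R) (s, u) q = nev (dual R) (s, u) b"
    if "set q \<subseteq> G" for q
    using that
  proof (induction q)
    case Nil
    have "nev (dual R) (s, u) (replicate n \<zero>\<^bsub>dual R\<^esub>) = \<zero>\<^bsub>dual R\<^esub>" for n
      by (induction n) (use t in auto)
    then show ?case using subringE(2)[OF Gs]
      by (intro exI[of _ "replicate (length h) \<zero>\<^bsub>dual R\<^esub>"]) auto
  next
    case (Cons c q)
    then obtain b where b: "set b \<subseteq> G" "length b = length h"
      "nev (dual R) (s, u) q = nev (dual R) (s, u) b" by auto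
    have "set (c # b) \<subseteq> G" "length (c # b) = Suc (length h)" using Cons b by auto
    from S.nev_reduce[OF Gs t h(1) this] obtain e b' where b': "e \<in> G" "set b' \<subseteq> G" "length b' = length h"
      "nev (dual R) (s, u) (c # b) = nev (dual R) (s, u) b' \<oplus>\<^bsub>dual R\<^esub> e \<otimes>\<^bsub>dual R\<^esub> ev (dual R) (s, u) h" by blast
    have "e \<in> carrier (dual R)" "nev (dual R) (s, u) b' \<in> carrier (dual R)"
      using b' subringE(1)[OF Gs] S.nev_in_carrier[OF Gs _ t] by auto
    then have "nev (dual R) (s, u) (c # q) = nev (dual R) (s, u) b'"
      using b(3) b'(4) by (simp add: eh)
    then show ?case using b' by blast
  qed
  have "\<exists>G'. deriv_graph G' \<and> G \<subseteq> G' \<and> (s, u) \<in> G'"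
  proof (rule deriv_graph_adjoin_aux[OF G t])
    fix q assume q: "set q \<subseteq> G" "fst (nev (dual R) (s, u) q) = \<zero>"
    obtain b where b: "set b \<subseteq> G" "length b = length h" "nev (dual R) (s, u) q = nev (dual R) (s, u) b"
      using red[OF q(1)] by blast
    have bF: "set (map fst b) \<subseteq> fst ` G" using b by auto
    have "\<forall>c\<in>set b. fst c = \<zero>"
    proof (rule ccontr)
      assume "\<not> ?thesis"
      then obtain e p0 where e: "e \<in> fst ` G" "e \<noteq> \<zero>" "set p0 \<subseteq> fst ` G" "length p0 < length b"
        "\<forall>x\<in>carrier R. nev R x (map fst b) = e \<otimes> ev R x p0"
        using nev_eq_smult_ev[OF F bF] by auto
      then have "e \<otimes> ev R s p0 = \<zero>" using q(2) b(3) s by (simp add: fst_nev_dual)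
      moreover have "e \<in> carrier R" "ev R s p0 \<in> carrier R"
        using e(1,3) Fs(1) s ev_in_carrier[OF subfieldE(1)[OF F]] by auto
      ultimately have "ev R s p0 = \<zero>" using e(2) integral_iff by blast
      then show False using min[OF e(3)] e(4) b(2) h(2) by (metis length_map not_less)
    qed
    then show "\<exists>p. set p \<subseteq> G \<and> nev (dual R) (s, u) q = nev (dual R) (s, u) p \<and> (\<forall>c\<in>set p. fst c = \<zero>)"
      using b by blast
  qed
  then obtain G' where "deriv_graph G'" "G \<subseteq> G'" "(s, u) \<in> G'" by blast
  moreover from this(3) have "s \<in> fst ` G'" by (metis fst_conv imageI)
  ultimately show ?thesis by blast
qed

lemma deriv_graph_adjoin_finite:
  assumes "finite S" "S \<subseteq> carrier R" "deriv_graph G" "\<And>n::nat. 0 < n \<Longrightarrow> [n] \<cdot> \<one> \<noteq> \<zero>"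
  shows "\<exists>G'. deriv_graph G' \<and> G \<subseteq> G' \<and> S \<subseteq> fst ` G'"
  using assms(1,2)
proof (induction S)
  case (insert s S)
  then obtain G' where G': "deriv_graph G'" "G \<subseteq> G'" "S \<subseteq> fst ` G'" by auto
  obtain G'' where "deriv_graph G''" "G' \<subseteq> G''" "s \<in> fst ` G''"
    using deriv_graph_adjoin[OF G'(1) _ assms(4)] insert.prems by blast
  then show ?case using G' by (intro exI[of _ G'']) blast
qed (use assms(3) in blast)

end

lemma (in field) algebraically_closed_root:
  assumes k: "subfield k R" and ac: "algebraically_closed (R\<lparr>carrier := k\<rparr>)"
    and p: "set p \<subseteq> k" "p \<noteq> []"
  shows "\<exists>z\<in>k. ev R z p = \<zero>"
proof -
  interpret K: algebraically_closed "R\<lparr>carrier := k\<rparr>" by (rule ac)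
  note ks = subringE[OF subfieldE(1)[OF k]]
  \<comment> \<open>The polynomials of HOL-Algebra start with the leading coefficient, which is
    written out; hence the reversal and the explicit 1.\<close>
  define P where "P = \<one> # rev p"
  have P: "P \<in> carrier (poly_ring (R\<lparr>carrier := k\<rparr>))"
    using p ks(3) by (simp add: univ_poly_carrier[symmetric] polynomial_def P_def)
  have "size (K.roots P) = length p"
    using K.roots_over_carrier[OF P] by (simp add: K.splitted_def P_def)
  then have "K.roots P \<noteq> {#}" using p(2) by auto
  then obtain z where z: "z \<in> k" "z \<in># K.roots P" using K.not_empty_rootsE[OF P] by auto
  have "K.eval (\<one> # rev q) z = ev R z q" if "set q \<subseteq> k" for q
    using that
  proof (induction q)
    case Nil
    then show ?case using z ks(3) subsetD[OF ks(1)] by (simp add: K.eval.simps)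
  next
    case (Cons c q)
    have "K.eval ((\<one> # rev q) @ [c]) z = K.eval (\<one> # rev q) z \<otimes> z \<oplus> c"
      using K.eval_append_aux[of "\<one> # rev q" c z] Cons.prems ks(3) z(1) by simp
    moreover have "ev R z q \<in> carrier R" "c \<in> carrier R" "z \<in> carrier R"
      using Cons.prems z(1) ks(1) ev_in_carrier[OF subfieldE(1)[OF k]] by auto
    ultimately show ?case using Cons by (simp add: m_comm a_comm)
  qed
  from this[OF p(1)] have "ev R z p = \<zero>"
    using K.roots_mem_iff_is_root[OF P, of z] z(2) by (simp add: K.is_root_def P_def)
  then show ?thesis using z(1) by blast
qed

text \<open>A root \<open>z\<close> in \<open>k\<close> splits off the factor \<open>X - z\<close>,
  which is nonzero at \<open>x\<close> because \<open>x\<close> is not in \<open>k\<close>;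
  induction on the degree handles the quotient.\<close>

lemma (in field) algebraically_closed_transcendental:
  assumes k: "subfield k R" and ac: "algebraically_closed (R\<lparr>carrier := k\<rparr>)"
    and x: "x \<in> carrier R" "x \<notin> k"
  shows "set p \<subseteq> k \<Longrightarrow> ev R x p \<noteq> \<zero>"
proof (induction "length p" arbitrary: p rule: less_induct)
  case less
  note ks = subfieldE(1)[OF k]
  show ?case
  proof (cases "p = []")
    case False
    obtain z where z: "z \<in> k" "ev R z p = \<zero>" using algebraically_closed_root[OF k ac less.prems False] by blast
    have zc: "z \<in> carrier R" using z(1) subringE(1)[OF ks] by blast
    have q: "set (quo R z p) \<subseteq> k" using quo_closed[OF ks z(1) less.prems] .
    have "length (quo R z p) < length p" using length_quo[OF False, of R z] by linarith
    then have "ev R x (quo R z p) \<noteq> \<zero>" using less.hyps q by blast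
    moreover have "x \<ominus> z \<noteq> \<zero>" using x z zc by auto
    moreover have "ev R x p = (x \<ominus> z) \<otimes> ev R x (quo R z p) \<oplus> \<zero>"
      using ev_quo[OF x(1) zc False] less.prems subringE(1)[OF ks] z(2) by auto
    moreover have "ev R x (quo R z p) \<in> carrier R" using ev_in_carrier[OF ks q x(1)] .
    ultimately show ?thesis using x zc integral_iff by simp
  qed simp
qed

text \<open>The zero derivation on \<open>k\<close> is extended to \<open>x\<close>, transcendental
  over \<open>k\<close>, with value 1, and then to the finitely many generators of the field. The
  domain of the result is a subfield containing \<open>k\<close> and the generators, hence
  everything.\<close>

lemma (in field) exists_derivation:
  assumes k: "subfield k R" and ac: "algebraically_closed (R\<lparr>carrier := k\<rparr>)"
    and ch: "char_zero (R\<lparr>carrier := k\<rparr>)" and fg: "finitely_generated_field R k"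
    and x: "x \<in> carrier R" "x \<notin> k"
  shows "\<exists>\<delta>. (\<forall>a\<in>carrier R. \<delta> a \<in> carrier R) \<and>
    (\<forall>a\<in>carrier R. \<forall>b\<in>carrier R. \<delta> (a \<oplus> b) = \<delta> a \<oplus> \<delta> b) \<and>
    (\<forall>a\<in>carrier R. \<forall>b\<in>carrier R. \<delta> (a \<otimes> b) = a \<otimes> \<delta> b \<oplus> \<delta> a \<otimes> b) \<and>
    (\<forall>c\<in>k. \<delta> c = \<zero>) \<and> \<delta> x = \<one>"
proof -
  interpret S: cring "dual R" by (rule cring_dual)
  note ks = subringE[OF subfieldE(1)[OF k]]
  note kC = subsetD[OF ks(1)]
  have char: "[n] \<cdot> \<one> \<noteq> \<zero>" if "0 < n" for n :: nat
    using ch that by (simp add: char_zero_def add_pow_def nat_pow_def)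
  define G0 where "G0 = (\<lambda>c. (c, \<zero>)) ` k"
  have fst_G0: "fst ` G0 = k" by (auto simp: G0_def image_image)
  have "deriv_graph G0"
    unfolding deriv_graph_def
  proof (intro conjI allI impI ballI)
    show "subring G0 (dual R)"
    proof (rule S.subringI)
      fix h h' assume "h \<in> G0" "h' \<in> G0"
      then show "h \<otimes>\<^bsub>dual R\<^esub> h' \<in> G0" "h \<oplus>\<^bsub>dual R\<^esub> h' \<in> G0" using ks(6,7) kC by (auto simp: G0_def dual_simps)
    next
      fix h assume "h \<in> G0"
      then show "\<ominus>\<^bsub>dual R\<^esub> h \<in> G0" using ks(5) kC by (auto simp: G0_def neg_dual dual_simps)
    qed (use ks kC in \<open>auto simp: G0_def dual_simps\<close>)
    show "y = \<zero>" if "(\<zero>, y) \<in> G0" for y using that by (auto simp: G0_def)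
    fix h assume h: "h \<in> G0" "fst h \<noteq> \<zero>"
    then obtain c where c: "h = (c, \<zero>)" "c \<in> k" unfolding G0_def by blast
    with h(2) have "c \<noteq> \<zero>" by simp
    note i = subfield_inv_closed[OF k c(2) \<open>c \<noteq> \<zero>\<close>]
    show "\<exists>y\<in>G0. h \<otimes>\<^bsub>dual R\<^esub> y = \<one>\<^bsub>dual R\<^esub>"
    proof (rule bexI[of _ "(inv c, \<zero>)"])
      show "(inv c, \<zero>) \<in> G0" using i unfolding G0_def by blast
      show "h \<otimes>\<^bsub>dual R\<^esub> (inv c, \<zero>) = \<one>\<^bsub>dual R\<^esub>" using c i kC by (simp add: dual_simps)
    qed
  qed
  then obtain G1 where G1: "deriv_graph G1" "G0 \<subseteq> G1" "(x, \<one>) \<in> G1"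
    using deriv_graph_adjoin_transcendental[of G0 x \<one>] algebraically_closed_transcendental[OF k ac x]
    unfolding fst_G0 using x(1) by blast
  obtain S where S: "finite S" "S \<subseteq> carrier R" "generate_field R (k \<union> S) = carrier R"
    using fg by (auto simp: finitely_generated_field_def)
  obtain G where G: "deriv_graph G" "G1 \<subseteq> G" "S \<subseteq> fst ` G"
    using deriv_graph_adjoin_finite[OF S(1,2) G1(1) char] by blast
  have "k \<subseteq> fst ` G" using fst_G0 G1(2) G(2) by blast
  then have "carrier R \<subseteq> fst ` G"
    using generate_field_min_subfield1[of "k \<union> S" "fst ` G"] subfield_deriv_graph[OF G(1)] G(3) S ks(1) by auto
  then have ex: "\<exists>b. (a, b) \<in> G" if "a \<in> carrier R" for a using that by force
  note g = subringE[OF deriv_graphD(1)[OF G(1)]]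
  have un: "b = b'" if bb: "(a, b) \<in> G" "(a, b') \<in> G" for a b b'
  proof -
    have c: "a \<in> carrier R" "b \<in> carrier R" "b' \<in> carrier R" using bb g(1) by (auto simp: dual_simps)
    have "(a, b) \<oplus>\<^bsub>dual R\<^esub> (\<ominus>\<^bsub>dual R\<^esub> (a, b')) \<in> G" using bb g(5,7) by blast
    then have "(\<zero>, b \<ominus> b') \<in> G" using c by (simp add: neg_dual dual_simps r_neg minus_eq)
    from deriv_graphD(2)[OF G(1) this] show ?thesis using c by simp
  qed
  define \<delta> where "\<delta> a = (SOME b. (a, b) \<in> G)" for a
  have \<delta>: "(a, \<delta> a) \<in> G" if "a \<in> carrier R" for a unfolding \<delta>_def using someI_ex[OF ex[OF that]] .
  have eq: "\<delta> a = b" if "(a, b) \<in> G" for a b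
    using un[OF \<delta> that] that g(1) by (auto simp: dual_simps)
  show ?thesis
  proof (intro exI[of _ \<delta>] conjI ballI)
    show "\<delta> a \<in> carrier R" if "a \<in> carrier R" for a using \<delta>[OF that] g(1) by (auto simp: dual_simps)
    show "\<delta> (a \<oplus> b) = \<delta> a \<oplus> \<delta> b" if "a \<in> carrier R" "b \<in> carrier R" for a b
      using g(7)[OF \<delta>[OF that(1)] \<delta>[OF that(2)]] by (intro eq) (simp add: dual_simps)
    show "\<delta> (a \<otimes> b) = a \<otimes> \<delta> b \<oplus> \<delta> a \<otimes> b" if "a \<in> carrier R" "b \<in> carrier R" for a b
      using g(6)[OF \<delta>[OF that(1)] \<delta>[OF that(2)]] by (intro eq) (simp add: dual_simps)
    show "\<delta> c = \<zero>" if "c \<in> k" for c using that G1(2) G(2) by (intro eq) (auto simp: G0_def)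
    show "\<delta> x = \<one>" using G1(3) G(2) by (intro eq) auto
  qed
qed

section \<open>Schur's lemma\<close>

text \<open>The analogues of \<open>ev\<close> and \<open>nev\<close> with an endomorphism in place of \<open>x\<close>.\<close>

primrec hop :: "('a, 'v, 'c) module_scheme \<Rightarrow> ('v \<Rightarrow> 'v) \<Rightarrow> 'a list \<Rightarrow> 'v \<Rightarrow> 'v"
  where
    "hop V \<psi> [] m = m"
  | "hop V \<psi> (c # p) m = c \<odot>\<^bsub>V\<^esub> m \<oplus>\<^bsub>V\<^esub> \<psi> (hop V \<psi> p m)"

primrec nhop :: "('a, 'v, 'c) module_scheme \<Rightarrow> ('v \<Rightarrow> 'v) \<Rightarrow> 'a list \<Rightarrow> 'v \<Rightarrow> 'v"
  where
    "nhop V \<psi> [] m = \<zero>\<^bsub>V\<^esub>"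
  | "nhop V \<psi> (c # p) m = c \<odot>\<^bsub>V\<^esub> m \<oplus>\<^bsub>V\<^esub> \<psi> (nhop V \<psi> p m)"

locale vector_endo = vectorspace R V for R :: "('a, 'b) ring_scheme" (structure) and V :: "('a, 'v, 'c) module_scheme" +
  fixes \<psi> :: "'v \<Rightarrow> 'v"
  assumes endo_closed [simp]: "x \<in> carrier V \<Longrightarrow> \<psi> x \<in> carrier V"
    and endo_add: "\<lbrakk>x \<in> carrier V; y \<in> carrier V\<rbrakk> \<Longrightarrow> \<psi> (x \<oplus>\<^bsub>V\<^esub> y) = \<psi> x \<oplus>\<^bsub>V\<^esub> \<psi> y"
    and endo_smult: "\<lbrakk>c \<in> carrier R; x \<in> carrier V\<rbrakk> \<Longrightarrow> \<psi> (c \<odot>\<^bsub>V\<^esub> x) = c \<odot>\<^bsub>V\<^esub> \<psi> x"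
begin

lemma smult_zeros [simp]: "x \<in> carrier V \<Longrightarrow> \<zero> \<odot>\<^bsub>V\<^esub> x = \<zero>\<^bsub>V\<^esub>" "c \<in> carrier R \<Longrightarrow> c \<odot>\<^bsub>V\<^esub> \<zero>\<^bsub>V\<^esub> = \<zero>\<^bsub>V\<^esub>"
  by (simp_all add: lmult_0 rmult_0)

lemma endo_zero [simp]: "\<psi> \<zero>\<^bsub>V\<^esub> = \<zero>\<^bsub>V\<^esub>"
  using endo_smult[of \<zero> "\<zero>\<^bsub>V\<^esub>"] by simp

lemma hop_closed [simp]: "\<lbrakk>set p \<subseteq> carrier R; m \<in> carrier V\<rbrakk> \<Longrightarrow> hop V \<psi> p m \<in> carrier V"
  by (induction p) auto

lemma nhop_closed [simp]: "\<lbrakk>set p \<subseteq> carrier R; m \<in> carrier V\<rbrakk> \<Longrightarrow> nhop V \<psi> p m \<in> carrier V"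
  by (induction p) auto

lemma hop_add: "\<lbrakk>set p \<subseteq> carrier R; m \<in> carrier V; n \<in> carrier V\<rbrakk> \<Longrightarrow>
    hop V \<psi> p (m \<oplus>\<^bsub>V\<^esub> n) = hop V \<psi> p m \<oplus>\<^bsub>V\<^esub> hop V \<psi> p n"
  by (induction p) (simp_all add: smult_r_distr endo_add M.a_ac)

lemma hop_smult: "\<lbrakk>set p \<subseteq> carrier R; m \<in> carrier V; c \<in> carrier R\<rbrakk> \<Longrightarrow>
    hop V \<psi> p (c \<odot>\<^bsub>V\<^esub> m) = c \<odot>\<^bsub>V\<^esub> hop V \<psi> p m"
  by (induction p) (simp_all add: smult_r_distr endo_smult smult_assoc1[symmetric] R.m_comm)

lemma hop_zero [simp]: "set p \<subseteq> carrier R \<Longrightarrow> hop V \<psi> p \<zero>\<^bsub>V\<^esub> = \<zero>\<^bsub>V\<^esub>"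
  using hop_smult[of p "\<zero>\<^bsub>V\<^esub>" \<zero>] by simp

lemma nhop_sum:
  "\<lbrakk>set p \<subseteq> carrier R; m \<in> carrier V\<rbrakk> \<Longrightarrow>
    nhop V \<psi> p m = (\<Oplus>\<^bsub>V\<^esub>i\<in>{..<length p}. p ! i \<odot>\<^bsub>V\<^esub> (\<psi> ^^ i) m)"
proof (induction p)
  case (Cons c p)
  have pc: "(\<psi> ^^ i) m \<in> carrier V" for i using Cons.prems by (induction i) simp_all
  have nth: "p ! i \<in> carrier R" if "i < length p" for i using Cons.prems that by auto
  have nth': "(c # p) ! i \<in> carrier R" if "i < Suc (length p)" for i
    using Cons.prems that by (cases i) auto
  have "\<psi> (\<Oplus>\<^bsub>V\<^esub>i\<in>{..<length p}. p ! i \<odot>\<^bsub>V\<^esub> (\<psi> ^^ i) m) = (\<Oplus>\<^bsub>V\<^esub>i\<in>{..<length p}. \<psi> (p ! i \<odot>\<^bsub>V\<^esub> (\<psi> ^^ i) m))"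
    by (rule M.hom_sum) (use nth pc in \<open>auto simp: hom_def endo_add M.abelian_monoid_axioms\<close>)
  also have "\<dots> = (\<Oplus>\<^bsub>V\<^esub>i\<in>{..<length p}. p ! i \<odot>\<^bsub>V\<^esub> (\<psi> ^^ Suc i) m)"
    by (rule M.sum_cong) (use nth pc in \<open>auto simp: endo_smult\<close>)
  finally show ?case using Cons nth' pc
    by (simp only: length_Cons nhop.simps, subst M.sum_Suc_shift) (auto simp del: funpow.simps simp: funpow_0 less_Suc_eq_le)
qed simp

text \<open>The division p = (X - z) q + p(z) evaluated at the endomorphism, with the subtracted
  term moved to the left. If \<open>p\<close> annihilates and \<open>z\<close> is a root of it, the
  values of the quotient are eigenvectors for \<open>z\<close>.\<close>

lemma hop_quo:
  assumes "z \<in> carrier R" "m \<in> carrier V"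
  shows "\<lbrakk>p \<noteq> []; set p \<subseteq> carrier R\<rbrakk> \<Longrightarrow> hop V \<psi> p m \<oplus>\<^bsub>V\<^esub> z \<odot>\<^bsub>V\<^esub> hop V \<psi> (quo R z p) m =
    \<psi> (hop V \<psi> (quo R z p) m) \<oplus>\<^bsub>V\<^esub> ev R z p \<odot>\<^bsub>V\<^esub> m"
proof (induction p)
  case (Cons c p)
  show ?case
  proof (cases p)
    case Nil
    then show ?thesis using Cons.prems assms by (simp add: smult_l_distr M.a_ac)
  next
    case (Cons e q)
    have [simp]: "set (quo R z p) \<subseteq> carrier R"
      using R.quo_closed[OF R.carrier_is_subring] assms Cons.prems by simp
    define Q where "Q = hop V \<psi> (quo R z p) m"
    define Z where "Z = ev R z p"
    define W where "W = hop V \<psi> p m"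
    have cl [simp]: "Q \<in> carrier V" "Z \<in> carrier R" "c \<in> carrier R" "W \<in> carrier V"
      using assms Cons.prems by (auto simp: Q_def Z_def W_def)
    have q: "quo R z (c # p) = Z # quo R z p" using Cons by (simp add: Z_def)
    have "W \<oplus>\<^bsub>V\<^esub> z \<odot>\<^bsub>V\<^esub> Q = \<psi> Q \<oplus>\<^bsub>V\<^esub> Z \<odot>\<^bsub>V\<^esub> m" using Cons.IH Cons.prems Cons by (simp add: Q_def Z_def W_def)
    then have "\<psi> (W \<oplus>\<^bsub>V\<^esub> z \<odot>\<^bsub>V\<^esub> Q) = \<psi> (\<psi> Q \<oplus>\<^bsub>V\<^esub> Z \<odot>\<^bsub>V\<^esub> m)" by simp
    then have E: "\<psi> W \<oplus>\<^bsub>V\<^esub> z \<odot>\<^bsub>V\<^esub> \<psi> Q = \<psi> (\<psi> Q) \<oplus>\<^bsub>V\<^esub> Z \<odot>\<^bsub>V\<^esub> \<psi> m" using assms by (simp add: endo_add endo_smult)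
    have "(c \<odot>\<^bsub>V\<^esub> m \<oplus>\<^bsub>V\<^esub> \<psi> W) \<oplus>\<^bsub>V\<^esub> z \<odot>\<^bsub>V\<^esub> (Z \<odot>\<^bsub>V\<^esub> m \<oplus>\<^bsub>V\<^esub> \<psi> Q) =
      (\<psi> W \<oplus>\<^bsub>V\<^esub> z \<odot>\<^bsub>V\<^esub> \<psi> Q) \<oplus>\<^bsub>V\<^esub> (c \<oplus> z \<otimes> Z) \<odot>\<^bsub>V\<^esub> m"
      using assms by (simp add: smult_r_distr smult_l_distr smult_assoc1 M.a_ac)
    also have "\<dots> = \<psi> (Z \<odot>\<^bsub>V\<^esub> m \<oplus>\<^bsub>V\<^esub> \<psi> Q) \<oplus>\<^bsub>V\<^esub> (c \<oplus> z \<otimes> Z) \<odot>\<^bsub>V\<^esub> m"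
      unfolding E using assms by (simp add: endo_add endo_smult M.a_ac)
    finally show ?thesis unfolding q by (simp add: W_def Q_def Z_def)
  qed
qed simp

lemma nhop_eq_smult_hop:
  "\<lbrakk>set q \<subseteq> carrier R; \<exists>c\<in>set q. c \<noteq> \<zero>\<rbrakk> \<Longrightarrow> \<exists>e s. e \<in> carrier R \<and> e \<noteq> \<zero> \<and> set s \<subseteq> carrier R \<and>
    length s < length q \<and> (\<forall>m\<in>carrier V. nhop V \<psi> q m = e \<odot>\<^bsub>V\<^esub> hop V \<psi> s m)"
proof (induction q)
  case (Cons c q)
  show ?case
  proof (cases "\<exists>c\<in>set q. c \<noteq> \<zero>")
    case True
    then obtain e s where es: "e \<in> carrier R" "e \<noteq> \<zero>" "set s \<subseteq> carrier R" "length s < length q"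
      "\<And>m. m \<in> carrier V \<Longrightarrow> nhop V \<psi> q m = e \<odot>\<^bsub>V\<^esub> hop V \<psi> s m" using Cons by auto
    have e: "inv e \<in> carrier R" "e \<otimes> inv e = \<one>" using es field_Units by auto
    have c: "c \<in> carrier R" "c = e \<otimes> (inv e \<otimes> c)" using Cons.prems es(1) e by (auto simp: R.m_assoc[symmetric])
    have "nhop V \<psi> (c # q) m = e \<odot>\<^bsub>V\<^esub> hop V \<psi> ((inv e \<otimes> c) # s) m" if "m \<in> carrier V" for m
    proof -
      have "nhop V \<psi> (c # q) m = (e \<otimes> (inv e \<otimes> c)) \<odot>\<^bsub>V\<^esub> m \<oplus>\<^bsub>V\<^esub> \<psi> (e \<odot>\<^bsub>V\<^esub> hop V \<psi> s m)"
        using es(5)[OF that] c(2) by simp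
      also have "\<dots> = e \<odot>\<^bsub>V\<^esub> hop V \<psi> ((inv e \<otimes> c) # s) m"
        using es e c(1) that by (simp add: smult_r_distr smult_assoc1[of e] endo_smult)
      finally show ?thesis .
    qed
    then show ?thesis using es e c(1)
      by (intro exI[of _ e] exI[of _ "(inv e \<otimes> c) # s"]) simp
  next
    case False
    have z: "nhop V \<psi> q m = \<zero>\<^bsub>V\<^esub>" if "m \<in> carrier V" "\<forall>c\<in>set q. c = \<zero>" for m and q :: "'a list"
      using that by (induction q) auto
    have "c \<noteq> \<zero>" "c \<in> carrier R" using False Cons.prems by auto
    then show ?thesis using z False by (intro exI[of _ c] exI[of _ "[]"]) auto
  qed
qed simp

lemma smult_eq_zeroD: "\<lbrakk>e \<in> carrier R; e \<noteq> \<zero>; x \<in> carrier V; e \<odot>\<^bsub>V\<^esub> x = \<zero>\<^bsub>V\<^esub>\<rbrakk> \<Longrightarrow> x = \<zero>\<^bsub>V\<^esub>"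
proof -
  assume e: "e \<in> carrier R" "e \<noteq> \<zero>" "x \<in> carrier V" "e \<odot>\<^bsub>V\<^esub> x = \<zero>\<^bsub>V\<^esub>"
  then have i: "inv e \<in> carrier R" "inv e \<otimes> e = \<one>" using field_Units by auto
  have "x = (inv e \<otimes> e) \<odot>\<^bsub>V\<^esub> x" using i e by simp
  also have "\<dots> = inv e \<odot>\<^bsub>V\<^esub> (e \<odot>\<^bsub>V\<^esub> x)" using i e by (intro smult_assoc1)
  finally show ?thesis using i e by simp
qed

text \<open>Among \<open>Suc dim\<close> iterates of \<open>v\<close> there is a linear relation.
  Its coefficients form a nonzero polynomial, which is divided by its leading coefficient.\<close>

lemma exists_annihilator_vector:
  assumes fd: "fin_dim" and v: "v \<in> carrier V"
  shows "\<exists>p. set p \<subseteq> carrier R \<and> hop V \<psi> p v = \<zero>\<^bsub>V\<^esub>"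
proof -
  have pc: "(\<psi> ^^ i) v \<in> carrier V" for i using v by (induction i) simp_all
  have "\<exists>q. set q \<subseteq> carrier R \<and> (\<exists>c\<in>set q. c \<noteq> \<zero>) \<and> nhop V \<psi> q v = \<zero>\<^bsub>V\<^esub>"
  \<comment> \<open>Linear dependence is a property of sets and does not see repetitions. If two
    iterates coincide, the relation is X^j - X^i instead.\<close>
  proof (cases "inj_on (\<lambda>i. (\<psi> ^^ i) v) {..<Suc dim}")
    case True
    let ?A = "(\<lambda>i. (\<psi> ^^ i) v) ` {..<Suc dim}"
    have A: "?A \<subseteq> carrier V" using pc by blast
    have "card ?A = Suc dim" using card_image[OF True] by simp
    then have "lin_dep ?A" using li_le_dim(2)[OF fd A] by fastforce
    from finite_lin_dep[OF _ this A] obtain f w where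
      f: "f \<in> ?A \<rightarrow> carrier R" "lincomb f ?A = \<zero>\<^bsub>V\<^esub>" "w \<in> ?A" "f w \<noteq> \<zero>" by blast
    define q where "q = map (\<lambda>i. f ((\<psi> ^^ i) v)) [0..<Suc dim]"
    have fc: "f ((\<psi> ^^ i) v) \<in> carrier R" if "i < Suc dim" for i using f(1) that by auto
    have q: "set q \<subseteq> carrier R" unfolding q_def using fc by auto
    have "lincomb f ?A = (\<Oplus>\<^bsub>V\<^esub>i\<in>{..<Suc dim}. f ((\<psi> ^^ i) v) \<odot>\<^bsub>V\<^esub> (\<psi> ^^ i) v)"
      unfolding lincomb_def by (rule M.finsum_reindex[OF _ True]) (use fc pc in auto)
    also have "\<dots> = nhop V \<psi> q v"
    proof -
      have len: "length q = Suc dim" by (simp add: q_def)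
      have nth: "q ! l = f ((\<psi> ^^ l) v)" if "l < Suc dim" for l
        using that by (simp add: q_def del: upt_Suc)
      show ?thesis
        unfolding nhop_sum[OF q v] len by (rule M.sum_cong) (use fc pc nth in auto)
    qed
    finally have "nhop V \<psi> q v = \<zero>\<^bsub>V\<^esub>" using f(2) by simp
    moreover have "\<exists>c\<in>set q. c \<noteq> \<zero>" using f(3,4) by (auto simp: q_def simp del: upt_Suc)
    ultimately show ?thesis using q by blast
  next
    case False
    then obtain i j where ij: "i < j" "(\<psi> ^^ i) v = (\<psi> ^^ j) v"
      unfolding inj_on_def by (metis nat_neq_iff)
    define q where "q = map (\<lambda>l. if l = i then \<ominus> \<one> else if l = j then \<one> else \<zero>) [0..<Suc j]"
    have q: "set q \<subseteq> carrier R" by (auto simp: q_def)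
    have "nhop V \<psi> q v = (\<Oplus>\<^bsub>V\<^esub>l\<in>{..<Suc j}. (if l = i then (\<ominus> \<one>) \<odot>\<^bsub>V\<^esub> (\<psi> ^^ i) v else \<zero>\<^bsub>V\<^esub>) \<oplus>\<^bsub>V\<^esub>
        (if l = j then (\<psi> ^^ j) v else \<zero>\<^bsub>V\<^esub>))"
      unfolding nhop_sum[OF q v] by (subst M.sum_cong) (use pc ij(1) in \<open>auto simp: q_def simp del: upt_Suc\<close>)
    also have "\<dots> = (\<Oplus>\<^bsub>V\<^esub>l\<in>{..<Suc j}. if l = i then (\<ominus> \<one>) \<odot>\<^bsub>V\<^esub> (\<psi> ^^ i) v else \<zero>\<^bsub>V\<^esub>) \<oplus>\<^bsub>V\<^esub>
        (\<Oplus>\<^bsub>V\<^esub>l\<in>{..<Suc j}. if l = j then (\<psi> ^^ j) v else \<zero>\<^bsub>V\<^esub>)"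
      by (rule M.finsum_addf) (use pc in auto)
    also have "\<dots> = (\<ominus> \<one>) \<odot>\<^bsub>V\<^esub> (\<psi> ^^ j) v \<oplus>\<^bsub>V\<^esub> \<one> \<odot>\<^bsub>V\<^esub> (\<psi> ^^ j) v"
      using ij pc by (simp add: M.sum_delta)
    also have "\<dots> = (\<ominus> \<one> \<oplus> \<one>) \<odot>\<^bsub>V\<^esub> (\<psi> ^^ j) v" using pc by (subst smult_l_distr) auto
    also have "\<dots> = \<zero>\<^bsub>V\<^esub>" using pc by (simp add: R.l_neg)
    finally show ?thesis using q by (intro exI[of _ q]) (auto simp: q_def)
  qed
  then obtain q where q: "set q \<subseteq> carrier R" "\<exists>c\<in>set q. c \<noteq> \<zero>" "nhop V \<psi> q v = \<zero>\<^bsub>V\<^esub>" by blast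
  from nhop_eq_smult_hop[OF q(1,2)] q(3) v obtain e s where
    "e \<in> carrier R" "e \<noteq> \<zero>" "set s \<subseteq> carrier R" "e \<odot>\<^bsub>V\<^esub> hop V \<psi> s v = \<zero>\<^bsub>V\<^esub>" by auto
  then show ?thesis using smult_eq_zeroD v by (intro exI[of _ s]) simp
qed

lemma hop_add_lower:
  assumes "c \<in> carrier R"
  shows "\<lbrakk>set p \<subseteq> carrier R; set t \<subseteq> carrier R; length p < length t\<rbrakk> \<Longrightarrow>
    \<exists>s. set s \<subseteq> carrier R \<and> length s = length t \<and>
      (\<forall>m\<in>carrier V. hop V \<psi> s m = c \<odot>\<^bsub>V\<^esub> hop V \<psi> p m \<oplus>\<^bsub>V\<^esub> hop V \<psi> t m)"
proof (induction p arbitrary: t)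
  case Nil
  then obtain e t' where t: "t = e # t'" by (cases t) auto
  show ?case using Nil assms t
    by (intro exI[of _ "(c \<oplus> e) # t'"]) (auto simp: smult_l_distr M.a_assoc)
next
  case (Cons b p)
  then obtain e t' where t: "t = e # t'" by (cases t) auto
  with Cons.IH[of t'] Cons.prems obtain s where s: "set s \<subseteq> carrier R" "length s = length t'"
    "\<And>m. m \<in> carrier V \<Longrightarrow> hop V \<psi> s m = c \<odot>\<^bsub>V\<^esub> hop V \<psi> p m \<oplus>\<^bsub>V\<^esub> hop V \<psi> t' m" by auto
  show ?case
  proof (intro exI[of _ "(c \<otimes> b \<oplus> e) # s"] conjI ballI)
    fix m assume "m \<in> carrier V"
    then show "hop V \<psi> ((c \<otimes> b \<oplus> e) # s) m = c \<odot>\<^bsub>V\<^esub> hop V \<psi> (b # p) m \<oplus>\<^bsub>V\<^esub> hop V \<psi> t m"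
      using Cons.prems assms t by (simp add: s(3) smult_l_distr smult_r_distr smult_assoc1 endo_add endo_smult M.a_ac)
  qed (use Cons.prems assms t s in auto)
qed

lemma hop_hop:
  assumes "set p \<subseteq> carrier R"
  shows "set q \<subseteq> carrier R \<Longrightarrow> \<exists>s. set s \<subseteq> carrier R \<and> length s = length q + length p \<and>
    (\<forall>m\<in>carrier V. hop V \<psi> s m = hop V \<psi> q (hop V \<psi> p m))"
proof (induction q)
  case (Cons c q)
  then obtain s where s: "set s \<subseteq> carrier R" "length s = length q + length p"
    "\<And>m. m \<in> carrier V \<Longrightarrow> hop V \<psi> s m = hop V \<psi> q (hop V \<psi> p m)" by auto
  have c: "c \<in> carrier R" using Cons.prems by simp
  have "set (\<zero> # s) \<subseteq> carrier R" "length p < length (\<zero> # s)" using s by auto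
  from hop_add_lower[OF c assms this] obtain s' where s': "set s' \<subseteq> carrier R" "length s' = length (\<zero> # s)"
    "\<forall>m\<in>carrier V. hop V \<psi> s' m = c \<odot>\<^bsub>V\<^esub> hop V \<psi> p m \<oplus>\<^bsub>V\<^esub> hop V \<psi> (\<zero> # s) m" by blast
  show ?case
    by (rule exI[of _ s']) (use s' s(2) assms Cons.prems in \<open>auto simp: s(3)\<close>)
qed (use assms in auto)

text \<open>Annihilators of the generators are composed one after the other: \<open>q\<close> is
  chosen for the image of the next generator under \<open>p\<close>, and it preserves the zeros
  already produced. The kernel of the result is a subspace, so killing the generators
  suffices.\<close>

lemma exists_annihilator:
  assumes fd: "fin_dim"
  shows "\<exists>p. set p \<subseteq> carrier R \<and> (\<forall>m\<in>carrier V. hop V \<psi> p m = \<zero>\<^bsub>V\<^esub>)"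
proof -
  obtain A where A: "finite A" "A \<subseteq> carrier V" "gen_set A" using fd unfolding fin_dim_def by blast
  have "\<exists>p. set p \<subseteq> carrier R \<and> (\<forall>m\<in>A. hop V \<psi> p m = \<zero>\<^bsub>V\<^esub>)"
    using A(1,2)
  proof (induction A)
    case (insert v A)
    then obtain p where p: "set p \<subseteq> carrier R" "\<forall>m\<in>A. hop V \<psi> p m = \<zero>\<^bsub>V\<^esub>" by auto
    obtain q where q: "set q \<subseteq> carrier R" "hop V \<psi> q (hop V \<psi> p v) = \<zero>\<^bsub>V\<^esub>"
      using exists_annihilator_vector[OF fd, of "hop V \<psi> p v"] p insert.prems by auto
    obtain s where "set s \<subseteq> carrier R" "\<forall>m\<in>carrier V. hop V \<psi> s m = hop V \<psi> q (hop V \<psi> p m)"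
      using hop_hop[OF p(1) q(1)] by blast
    then show ?case using p q insert.prems by (intro exI[of _ s]) auto
  qed (auto intro!: exI[of _ "[]"])
  then obtain p where p: "set p \<subseteq> carrier R" "\<forall>m\<in>A. hop V \<psi> p m = \<zero>\<^bsub>V\<^esub>" by blast
  have "LinearCombinations.submodule R {m \<in> carrier V. hop V \<psi> p m = \<zero>\<^bsub>V\<^esub>} V"
    using p(1) by (auto simp: LinearCombinations.submodule_def hop_add hop_smult module_axioms)
  from span_is_subset[OF _ this, of A] have "carrier V \<subseteq> {m \<in> carrier V. hop V \<psi> p m = \<zero>\<^bsub>V\<^esub>}"
    using A p(2) by auto
  then show ?thesis using p(1) by blast
qed

end

section \<open>Modules over the ring of differential operators\<close>

locale diff_module = k_field +
  fixes M :: "('a \<Rightarrow> 'a, 'm) module"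
  assumes left_module: "left_module (diff_ops L k) M"
begin

sublocale D: left_module "diff_ops L k" M
  by (rule left_module)

abbreviation "CM \<equiv> carrier M"
abbreviation M_add (infixl "\<oplus>\<^sub>M" 65) where "x \<oplus>\<^sub>M y \<equiv> x \<oplus>\<^bsub>M\<^esub> y"
abbreviation M_zero ("\<zero>\<^sub>M") where "\<zero>\<^sub>M \<equiv> \<zero>\<^bsub>M\<^esub>"
abbreviation op_act (infixr "\<bullet>" 70) where "P \<bullet> m \<equiv> P \<odot>\<^bsub>M\<^esub> m"

definition scal :: "'a \<Rightarrow> 'm \<Rightarrow> 'm" (infixr "*\<^sub>M" 70)
  where "c *\<^sub>M m = mult_op L c \<bullet> m"

lemma act_closed [simp]: "\<lbrakk>P \<in> DL; m \<in> CM\<rbrakk> \<Longrightarrow> P \<bullet> m \<in> CM"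
  by (rule D.smult_closed)

lemma act_add: "\<lbrakk>P \<in> DL; m \<in> CM; n \<in> CM\<rbrakk> \<Longrightarrow> P \<bullet> (m \<oplus>\<^sub>M n) = P \<bullet> m \<oplus>\<^sub>M P \<bullet> n"
  by (rule D.smult_r_distr)

lemma act_plus: "\<lbrakk>P \<in> DL; Q \<in> DL; m \<in> CM\<rbrakk> \<Longrightarrow> (\<lambda>x\<in>CL. P x \<oplus> Q x) \<bullet> m = P \<bullet> m \<oplus>\<^sub>M Q \<bullet> m"
  using D.smult_l_distr[of P Q m] by (simp add: diff_ops_simps)

lemma act_compose: "\<lbrakk>P \<in> DL; Q \<in> DL; m \<in> CM\<rbrakk> \<Longrightarrow> compose CL P Q \<bullet> m = P \<bullet> (Q \<bullet> m)"
  using D.smult_assoc1[of P Q m] by (simp add: diff_ops_simps)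

lemma act_zero [simp]: assumes "P \<in> DL" shows "P \<bullet> \<zero>\<^sub>M = \<zero>\<^sub>M"
proof -
  have "P \<bullet> (\<zero>\<^sub>M \<oplus>\<^sub>M \<zero>\<^sub>M) = P \<bullet> \<zero>\<^sub>M \<oplus>\<^sub>M P \<bullet> \<zero>\<^sub>M" using assms by (intro act_add) auto
  moreover have "P \<bullet> \<zero>\<^sub>M \<in> CM" using assms by simp
  ultimately show ?thesis by simp
qed

lemma mult_op_add:
  "\<lbrakk>c \<in> CL; e \<in> CL\<rbrakk> \<Longrightarrow> mult_op L (c \<oplus> e) = (\<lambda>x\<in>CL. mult_op L c x \<oplus> mult_op L e x)"
  unfolding mult_op_def by (rule restrict_ext) (simp add: l_distr)

lemma mult_op_mult: "\<lbrakk>c \<in> CL; e \<in> CL\<rbrakk> \<Longrightarrow> mult_op L (c \<otimes> e) = compose CL (mult_op L c) (mult_op L e)"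
  unfolding mult_op_def compose_def by (rule restrict_ext) (simp add: m_assoc)

lemma mult_op_one: "mult_op L \<one> = \<one>\<^bsub>diff_ops L k\<^esub>"
  unfolding mult_op_def diff_ops_simps by (rule restrict_ext) simp

lemma scal_closed [simp]: "\<lbrakk>c \<in> CL; m \<in> CM\<rbrakk> \<Longrightarrow> c *\<^sub>M m \<in> CM"
  unfolding scal_def by (intro act_closed mult_op_diff_ops)

lemma scal_add: "\<lbrakk>c \<in> CL; m \<in> CM; n \<in> CM\<rbrakk> \<Longrightarrow> c *\<^sub>M (m \<oplus>\<^sub>M n) = c *\<^sub>M m \<oplus>\<^sub>M c *\<^sub>M n"
  unfolding scal_def by (intro act_add mult_op_diff_ops)

lemma scal_plus: "\<lbrakk>c \<in> CL; e \<in> CL; m \<in> CM\<rbrakk> \<Longrightarrow> (c \<oplus> e) *\<^sub>M m = c *\<^sub>M m \<oplus>\<^sub>M e *\<^sub>M m"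
  unfolding scal_def mult_op_add by (intro act_plus mult_op_diff_ops)

lemma scal_mult: "\<lbrakk>c \<in> CL; e \<in> CL; m \<in> CM\<rbrakk> \<Longrightarrow> (c \<otimes> e) *\<^sub>M m = c *\<^sub>M (e *\<^sub>M m)"
  unfolding scal_def mult_op_mult by (intro act_compose mult_op_diff_ops)

lemma scal_one [simp]: "m \<in> CM \<Longrightarrow> \<one> *\<^sub>M m = m"
  unfolding scal_def mult_op_one by (rule D.smult_one)

lemma scal_zero [simp]: "c \<in> CL \<Longrightarrow> c *\<^sub>M \<zero>\<^sub>M = \<zero>\<^sub>M"
  unfolding scal_def using mult_op_diff_ops by simp

lemma scal_sum:
  "\<lbrakk>c \<in> CL; \<And>i. i < n \<Longrightarrow> f i \<in> CM\<rbrakk> \<Longrightarrow> c *\<^sub>M (\<Oplus>\<^bsub>M\<^esub>i\<in>{..<n::nat}. f i) = (\<Oplus>\<^bsub>M\<^esub>i\<in>{..<n}. c *\<^sub>M f i)"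
  by (rule D.M.hom_sum) (auto simp: hom_def scal_add D.M.abelian_monoid_axioms)

lemma act_sum:
  "\<lbrakk>P \<in> DL; \<And>i. i < n \<Longrightarrow> f i \<in> CM\<rbrakk> \<Longrightarrow> P \<bullet> (\<Oplus>\<^bsub>M\<^esub>i\<in>{..<n::nat}. f i) = (\<Oplus>\<^bsub>M\<^esub>i\<in>{..<n}. P \<bullet> f i)"
  by (rule D.M.hom_sum) (auto simp: hom_def act_add D.M.abelian_monoid_axioms)

lemma scal_lzero [simp]: assumes "m \<in> CM" shows "\<zero> *\<^sub>M m = \<zero>\<^sub>M"
proof -
  have "(\<zero> \<oplus> \<zero>) *\<^sub>M m = \<zero> *\<^sub>M m \<oplus>\<^sub>M \<zero> *\<^sub>M m" using assms by (intro scal_plus) auto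
  moreover have "\<zero> *\<^sub>M m \<in> CM" using assms by simp
  ultimately show ?thesis by simp
qed

lemma sum_scal:
  assumes "m \<in> CM"
  shows "(\<And>i. i < n \<Longrightarrow> f i \<in> CL) \<Longrightarrow> (\<Oplus>i\<in>{..<n::nat}. f i) *\<^sub>M m = (\<Oplus>\<^bsub>M\<^esub>i\<in>{..<n}. f i *\<^sub>M m)"
  by (rule hom_sum[of M "\<lambda>c. c *\<^sub>M m"]) (use assms in \<open>auto simp: hom_def scal_plus D.M.abelian_monoid_axioms\<close>)

lemma act_scal_k:
  assumes "P \<in> DL" "c \<in> k" "m \<in> CM"
  shows "P \<bullet> (c *\<^sub>M m) = c *\<^sub>M (P \<bullet> m)"
proof -
  note c = k_in_carrier[OF assms(2)] and C = mult_op_diff_ops[OF k_in_carrier[OF assms(2)]]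
  have "compose CL P (mult_op L c) = compose CL (mult_op L c) P"
    unfolding compose_def
    by (rule restrict_ext) (use linD[OF diff_ops_lin[OF assms(1)]] assms(2) c in \<open>simp add: mult_op_def\<close>)
  then show ?thesis
    using act_compose[OF assms(1) C assms(3)] act_compose[OF C assms(1,3)] by (simp add: scal_def)
qed

lemma act_op_sum:
  assumes "\<And>i. i < n \<Longrightarrow> P i \<in> DL" "m \<in> CM"
  shows "(\<lambda>x\<in>CL. \<Oplus>i\<in>{..<n::nat}. P i x) \<bullet> m = (\<Oplus>\<^bsub>M\<^esub>i\<in>{..<n}. P i \<bullet> m)"
  using assms(1)
proof (induction n)
  case 0
  have "(\<lambda>x\<in>CL. \<Oplus>i\<in>{..<0}. P i x) = mult_op L \<zero>" unfolding mult_op_def by (rule restrict_ext) simp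
  then have "(\<lambda>x\<in>CL. \<Oplus>i\<in>{..<0}. P i x) \<bullet> m = \<zero> *\<^sub>M m" by (simp add: scal_def)
  then show ?case using assms(2) by simp
next
  case (Suc n)
  have c: "P i x \<in> CL" if "i < Suc n" "x \<in> CL" for i x using linD(2)[OF diff_ops_lin] Suc.prems that by blast
  have "(\<lambda>x\<in>CL. \<Oplus>i\<in>{..<Suc n}. P i x) = (\<lambda>x\<in>CL. (\<lambda>x\<in>CL. \<Oplus>i\<in>{..<n}. P i x) x \<oplus> P n x)"
    by (rule restrict_ext) (use c in \<open>simp add: sum_Suc\<close>)
  then have "(\<lambda>x\<in>CL. \<Oplus>i\<in>{..<Suc n}. P i x) \<bullet> m = (\<lambda>x\<in>CL. \<Oplus>i\<in>{..<n}. P i x) \<bullet> m \<oplus>\<^sub>M P n \<bullet> m"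
    using act_plus[OF diff_ops_sum _ assms(2), of n P] Suc.prems by simp
  also have "\<dots> = (\<Oplus>\<^bsub>M\<^esub>i\<in>{..<Suc n}. P i \<bullet> m)"
    using Suc assms(2) by (subst D.M.sum_Suc) auto
  finally show ?case .
qed

lemma vectorspace: "vectorspace L (underlying_module L M)"
proof -
  have "abelian_group (underlying_module L M)"
  proof (rule abelian_groupI)
    fix x assume "x \<in> carrier (underlying_module L M)"
    then show "\<exists>y\<in>carrier (underlying_module L M). y \<oplus>\<^bsub>underlying_module L M\<^esub> x = \<zero>\<^bsub>underlying_module L M\<^esub>"
      by (intro bexI[of _ "\<ominus>\<^bsub>M\<^esub> x"]) (simp_all add: underlying_module_def D.M.l_neg)
  qed (auto simp: underlying_module_def D.M.a_ac)
  then have "module L (underlying_module L M)"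
    by (intro moduleI is_cring) (simp_all add: underlying_module_def scal_def[symmetric] scal_plus scal_add scal_mult)
  then show ?thesis by (intro vectorspace.intro field_axioms)
qed

lemma ne_neg: "m \<in> CM \<Longrightarrow> \<ominus>\<^bsub>M\<^esub> m = (\<ominus> \<one>) *\<^sub>M m"
proof (rule D.M.minus_equality)
  assume m: "m \<in> CM"
  have "(\<ominus> \<one>) *\<^sub>M m \<oplus>\<^sub>M \<one> *\<^sub>M m = (\<ominus> \<one> \<oplus> \<one>) *\<^sub>M m" using m by (intro scal_plus[symmetric]) auto
  then show "(\<ominus> \<one>) *\<^sub>M m \<oplus>\<^sub>M m = \<zero>\<^sub>M" using m by (simp add: l_neg)
qed auto

lemma submoduleI':
  assumes "H \<subseteq> CM" "\<zero>\<^sub>M \<in> H" "\<And>x y. \<lbrakk>x \<in> H; y \<in> H\<rbrakk> \<Longrightarrow> x \<oplus>\<^sub>M y \<in> H" "\<And>P x. \<lbrakk>P \<in> DL; x \<in> H\<rbrakk> \<Longrightarrow> P \<bullet> x \<in> H"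
  shows "Module.submodule H (diff_ops L k) M"
proof -
  have "\<ominus>\<^bsub>M\<^esub> x \<in> H" if "x \<in> H" for x
    using assms(1) assms(4)[OF mult_op_diff_ops[of "\<ominus> \<one>"] that] ne_neg[of x] that by (auto simp: scal_def)
  then show ?thesis
    using assms by (auto simp: Module.submodule_def Module.submodule_axioms_def subgroup_def a_inv_def)
qed

end

locale simple_diff_module = diff_module +
  assumes k_subfield: "subfield k L" and k_closed: "algebraically_closed (L\<lparr>carrier := k\<rparr>)"
    and char_0: "char_zero (L\<lparr>carrier := k\<rparr>)" and fin_gen: "finitely_generated_field L k"
    and simple: "simple_module (diff_ops L k) M"
    and fin_dim: "vectorspace.fin_dim L (underlying_module L M)"
begin

lemma nonzero: "\<exists>m\<in>CM. m \<noteq> \<zero>\<^sub>M"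
  using simple by (auto simp: simple_module_def)

lemma submodule_cases:
  "Module.submodule H (diff_ops L k) M \<Longrightarrow> H = {\<zero>\<^sub>M} \<or> H = CM"
  using simple by (auto simp: simple_module_def)

text \<open>The commutator of \<delta> with \<open>a\<close> is multiplication by
  \<open>\<delta> a\<close>, which has order 0. So \<delta> has order 1, which is index 2 in
  \<open>dop\<close>.\<close>

lemma derivation_diff_op:
  assumes "\<And>a. a \<in> CL \<Longrightarrow> \<delta> a \<in> CL"
    "\<And>a b. \<lbrakk>a \<in> CL; b \<in> CL\<rbrakk> \<Longrightarrow> \<delta> (a \<oplus> b) = \<delta> a \<oplus> \<delta> b"
    "\<And>a b. \<lbrakk>a \<in> CL; b \<in> CL\<rbrakk> \<Longrightarrow> \<delta> (a \<otimes> b) = a \<otimes> \<delta> b \<oplus> \<delta> a \<otimes> b"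
    "\<And>c. c \<in> k \<Longrightarrow> \<delta> c = \<zero>"
  shows "restrict \<delta> CL \<in> DL"
proof -
  note [simp] = assms k_in_carrier
  have l: "restrict \<delta> CL \<in> lin CL" by (rule linI) simp_all
  have "com CL (restrict \<delta> CL) a = mult_op L (\<delta> a)" if "a \<in> CL" for a
    unfolding com_def mult_op_def
  proof (rule restrict_ext)
    fix x assume "x \<in> CL"
    then have "a \<otimes> \<delta> x \<oplus> \<delta> a \<otimes> x \<ominus> a \<otimes> \<delta> x = \<delta> a \<otimes> x" using that assms(1) by algebra
    then show "restrict \<delta> CL (a \<otimes> x) \<ominus> a \<otimes> restrict \<delta> CL x = \<delta> a \<otimes> x" using that \<open>x \<in> CL\<close> by simp
  qed
  then have "restrict \<delta> CL \<in> dop CL (Suc (Suc 0))"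
    by (intro dop_SucI[OF l]) (simp add: mult_op_dop del: dop.simps)
  then show ?thesis by (auto simp: diff_ops_carrier simp del: dop.simps)
qed

text \<open>The operator identity \<delta> c = c \<delta> + \<delta>(c), applied to a vector. It
  tells how \<delta> differentiates the coefficients of a polynomial in an endomorphism.\<close>

lemma derivation_act_scal:
  assumes "\<And>a. a \<in> CL \<Longrightarrow> \<delta> a \<in> CL"
    "\<And>a b. \<lbrakk>a \<in> CL; b \<in> CL\<rbrakk> \<Longrightarrow> \<delta> (a \<otimes> b) = a \<otimes> \<delta> b \<oplus> \<delta> a \<otimes> b"
    "restrict \<delta> CL \<in> DL" "c \<in> CL" "m \<in> CM"
  shows "restrict \<delta> CL \<bullet> (c *\<^sub>M m) = c *\<^sub>M (restrict \<delta> CL \<bullet> m) \<oplus>\<^sub>M \<delta> c *\<^sub>M m"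
proof -
  note [simp] = assms mult_op_diff_ops
  have "compose CL (restrict \<delta> CL) (mult_op L c) =
    (\<lambda>x\<in>CL. compose CL (mult_op L c) (restrict \<delta> CL) x \<oplus> mult_op L (\<delta> c) x)"
    unfolding compose_def by (rule restrict_ext) (simp add: mult_op_def)
  then have "compose CL (restrict \<delta> CL) (mult_op L c) \<bullet> m =
    compose CL (mult_op L c) (restrict \<delta> CL) \<bullet> m \<oplus>\<^sub>M mult_op L (\<delta> c) \<bullet> m"
    by (simp add: act_plus diff_ops_compose)
  then show ?thesis by (simp add: act_compose scal_def)
qed

text \<open>The coefficients of the minimal polynomial of an endomorphism over \<open>L\<close> are killed by all
  derivations, hence lie in \<open>k\<close>.\<close>

theorem schur:
  assumes closed: "\<And>x. x \<in> CM \<Longrightarrow> \<psi> x \<in> CM"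
    and add: "\<And>x y. \<lbrakk>x \<in> CM; y \<in> CM\<rbrakk> \<Longrightarrow> \<psi> (x \<oplus>\<^sub>M y) = \<psi> x \<oplus>\<^sub>M \<psi> y"
    and comm: "\<And>P x. \<lbrakk>P \<in> DL; x \<in> CM\<rbrakk> \<Longrightarrow> \<psi> (P \<bullet> x) = P \<bullet> \<psi> x"
  shows "\<exists>c\<in>k. \<forall>x\<in>CM. \<psi> x = c *\<^sub>M x"
proof -
  let ?V = "underlying_module L M"
  have Vs: "carrier ?V = CM" "\<And>x y. x \<oplus>\<^bsub>?V\<^esub> y = x \<oplus>\<^sub>M y" "\<And>c x. c \<odot>\<^bsub>?V\<^esub> x = c *\<^sub>M x" "\<zero>\<^bsub>?V\<^esub> = \<zero>\<^sub>M"
    by (simp_all add: underlying_module_def scal_def)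
  have scal_\<psi>: "\<psi> (c *\<^sub>M x) = c *\<^sub>M \<psi> x" if "c \<in> CL" "x \<in> CM" for c x
    unfolding scal_def using that by (intro comm mult_op_diff_ops)
  have endo: "vector_endo L ?V \<psi>"
    by (intro vector_endo.intro vector_endo_axioms.intro vectorspace) (simp_all add: Vs closed add scal_\<psi>)
  interpret E: vector_endo L ?V \<psi> by (rule endo)
  have hop_closed [simp]: "hop ?V \<psi> p m \<in> CM" if "set p \<subseteq> CL" "m \<in> CM" for p m
    using E.hop_closed[of p m] that by (simp add: Vs)
  define A where "A p \<longleftrightarrow> set p \<subseteq> CL \<and> (\<forall>m\<in>CM. hop ?V \<psi> p m = \<zero>\<^sub>M)" for p
  define p where "p = arg_min length A"
  obtain p0 where "A p0" using E.exists_annihilator[OF fin_dim] unfolding A_def Vs by blast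
  then have "A p" unfolding p_def by (rule arg_min_natI)
  then have p: "set p \<subseteq> CL" "\<And>m. m \<in> CM \<Longrightarrow> hop ?V \<psi> p m = \<zero>\<^sub>M" by (auto simp: A_def)
  have min: "length p \<le> length q" if "set q \<subseteq> CL" "\<And>m. m \<in> CM \<Longrightarrow> hop ?V \<psi> q m = \<zero>\<^sub>M" for q
    unfolding p_def using that by (intro arg_min_nat_le) (simp add: A_def)
  have pk: "c \<in> k" if "c \<in> set p" for c
  proof (rule ccontr)
    assume "c \<notin> k"
    have c: "c \<in> CL" using that p by auto
    obtain \<delta> where \<delta>: "\<And>a. a \<in> CL \<Longrightarrow> \<delta> a \<in> CL"
      "\<And>a b. \<lbrakk>a \<in> CL; b \<in> CL\<rbrakk> \<Longrightarrow> \<delta> (a \<oplus> b) = \<delta> a \<oplus> \<delta> b"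
      "\<And>a b. \<lbrakk>a \<in> CL; b \<in> CL\<rbrakk> \<Longrightarrow> \<delta> (a \<otimes> b) = a \<otimes> \<delta> b \<oplus> \<delta> a \<otimes> b"
      "\<And>c. c \<in> k \<Longrightarrow> \<delta> c = \<zero>" "\<delta> c = \<one>"
      using exists_derivation[OF k_subfield k_closed char_0 fin_gen c \<open>c \<notin> k\<close>] by blast
    let ?D = "restrict \<delta> CL"
    have D: "?D \<in> DL" by (rule derivation_diff_op[OF \<delta>(1-4)])
    \<comment> \<open>Since \<psi> commutes with \<delta>, only the coefficients are differentiated.
      For the annihilator \<open>p\<close> both terms with \<open>hop\<close> vanish, so the
      differentiated polynomial annihilates as well. It has lost the leading 1, but is nonzero
      because \<open>\<delta> c = \<one>\<close>; normalized, it is an annihilator shorter than the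
      minimal \<open>p\<close>.\<close>
    have der: "?D \<bullet> hop ?V \<psi> q m = hop ?V \<psi> q (?D \<bullet> m) \<oplus>\<^sub>M nhop ?V \<psi> (map \<delta> q) m"
      if "set q \<subseteq> CL" "m \<in> CM" for q m
      using that(1)
    proof (induction q)
      case Nil
      then show ?case using that D by (simp add: Vs)
    next
      case (Cons b q)
      note [simp] = D that(2) \<delta>(1) closed
      have b: "b \<in> CL" "set q \<subseteq> CL" using Cons.prems by auto
      have "set (map \<delta> q) \<subseteq> CL" using b \<delta>(1) by auto
      then have n [simp]: "nhop ?V \<psi> (map \<delta> q) m \<in> CM" using E.nhop_closed[of "map \<delta> q" m] by (simp add: Vs)
      have "?D \<bullet> hop ?V \<psi> (b # q) m = ?D \<bullet> (b *\<^sub>M m) \<oplus>\<^sub>M ?D \<bullet> \<psi> (hop ?V \<psi> q m)"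
        using b by (simp add: Vs act_add)
      also have "?D \<bullet> \<psi> (hop ?V \<psi> q m) = \<psi> (hop ?V \<psi> q (?D \<bullet> m)) \<oplus>\<^sub>M \<psi> (nhop ?V \<psi> (map \<delta> q) m)"
        using b by (simp add: comm[symmetric] Cons.IH add)
      also have "?D \<bullet> (b *\<^sub>M m) = b *\<^sub>M (?D \<bullet> m) \<oplus>\<^sub>M \<delta> b *\<^sub>M m"
        by (rule derivation_act_scal[OF \<delta>(1,3) D b(1) that(2)])
      finally show ?case using b by (simp add: Vs D.M.a_ac)
    qed
    have dp: "set (map \<delta> p) \<subseteq> CL" using p \<delta>(1) by auto
    have "\<exists>c\<in>set (map \<delta> p). c \<noteq> \<zero>" using that \<delta>(5) one_not_zero by force
    from E.nhop_eq_smult_hop[OF dp this] obtain e s where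
      e: "e \<in> CL" "e \<noteq> \<zero>" "set s \<subseteq> CL" "length s < length p"
        "\<And>m. m \<in> CM \<Longrightarrow> nhop ?V \<psi> (map \<delta> p) m = e *\<^sub>M hop ?V \<psi> s m"
      by (auto simp: Vs)
    have "hop ?V \<psi> s m = \<zero>\<^sub>M" if m: "m \<in> CM" for m
    proof -
      have "nhop ?V \<psi> (map \<delta> p) m \<in> CM" using E.nhop_closed[OF dp, of m] m by (simp add: Vs)
      then have "nhop ?V \<psi> (map \<delta> p) m = \<zero>\<^sub>M" using der[OF p(1) m] p(2) m D by simp
      then show ?thesis using E.smult_eq_zeroD[of e "hop ?V \<psi> s m"] e m by (simp add: Vs)
    qed
    then show False using min[OF e(3)] e(4) by simp
  qed
  have "p \<noteq> []" using p(2) nonzero by auto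
  from algebraically_closed_root[OF k_subfield k_closed _ this] pk
  obtain z where z: "z \<in> k" "ev L z p = \<zero>" by blast
  have zc: "z \<in> CL" using z k_in_carrier by blast
  let ?q = "quo L z p"
  have q: "set ?q \<subseteq> CL" using quo_closed[OF carrier_is_subring zc p(1)] .
  have "length ?q < length p" using length_quo[OF \<open>p \<noteq> []\<close>, of L z] by linarith
  \<comment> \<open>The quotient of \<open>p\<close> by \<open>X - z\<close> is too short to
    annihilate \<open>M\<close>. A nonzero value of it is an eigenvector for
    \<open>z\<close>.\<close>
  then obtain m where m: "m \<in> CM" "hop ?V \<psi> ?q m \<noteq> \<zero>\<^sub>M" using min[OF q] by force
  define w where "w = hop ?V \<psi> ?q m"
  have w: "w \<in> CM" "w \<noteq> \<zero>\<^sub>M" using m q by (auto simp: w_def)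
  have "\<psi> w = z *\<^sub>M w"
    using E.hop_quo[OF zc _ \<open>p \<noteq> []\<close> p(1), of m] m(1) p(2)[OF m(1)] z(2) w(1) zc closed[OF w(1)]
    by (simp add: Vs w_def[symmetric])
  \<comment> \<open>The eigenspace is stable under all operators, which are \<open>k\<close>-linear
    while \<open>z\<close> lies in \<open>k\<close>. Being nonzero, it is all of the simple
    module.\<close>
  define H where "H = {x \<in> CM. \<psi> x = z *\<^sub>M x}"
  have "Module.submodule H (diff_ops L k) M"
  proof (rule submoduleI')
    show "\<zero>\<^sub>M \<in> H" using scal_\<psi>[of \<zero> "\<zero>\<^sub>M"] zc closed[of "\<zero>\<^sub>M"] by (simp add: H_def)
    fix P x assume P: "P \<in> DL" and x: "x \<in> H"
    have "P \<bullet> (z *\<^sub>M x) = z *\<^sub>M (P \<bullet> x)"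
      using act_scal_k[OF P z(1)] x by (simp add: H_def)
    then show "P \<bullet> x \<in> H" using P x comm by (simp add: H_def)
  qed (auto simp: H_def add scal_add zc)
  moreover have "w \<in> H" using w \<open>\<psi> w = z *\<^sub>M w\<close> by (simp add: H_def)
  ultimately have "H = CM" using submodule_cases w(2) by blast
  then show ?thesis using z(1) by (auto simp: H_def)
qed

end

section \<open>Galois descent\<close>

locale semilinear = cyclic_extension L k K g d + diff_module L k M
  for L :: "'a ring" (structure) and k K g d and M :: "('a \<Rightarrow> 'a, 'm) module" +
  fixes \<phi> :: "'m \<Rightarrow> 'm"
  assumes phi_closed: "x \<in> CM \<Longrightarrow> \<phi> x \<in> CM"
    and phi_add: "\<lbrakk>x \<in> CM; y \<in> CM\<rbrakk> \<Longrightarrow> \<phi> (x \<oplus>\<^sub>M y) = \<phi> x \<oplus>\<^sub>M \<phi> y"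
    and phi_act: "\<lbrakk>P \<in> DL; x \<in> CM\<rbrakk> \<Longrightarrow> \<phi> (P \<bullet> x) = conjn 1 P \<bullet> \<phi> x"
begin

lemma ppow_closed [simp]: "x \<in> CM \<Longrightarrow> (\<phi> ^^ j) x \<in> CM"
  by (induction j) (simp_all add: phi_closed)

lemma ppow_add: "\<lbrakk>x \<in> CM; y \<in> CM\<rbrakk> \<Longrightarrow> (\<phi> ^^ j) (x \<oplus>\<^sub>M y) = (\<phi> ^^ j) x \<oplus>\<^sub>M (\<phi> ^^ j) y"
  by (induction j) (simp_all add: phi_add)

lemma ppow_act:
  assumes "P \<in> DL" "x \<in> CM" shows "(\<phi> ^^ j) (P \<bullet> x) = conjn j P \<bullet> (\<phi> ^^ j) x"
proof (induction j)
  case 0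
  show ?case using conjn_0[OF diff_ops_lin[OF assms(1)]] by simp
next
  case (Suc j)
  show ?case using Suc phi_act[OF conjn_diff_ops[OF assms(1)] ppow_closed[OF assms(2)]]
    by (simp add: conjn_Suc[of j])
qed

lemma ppow_scal: "\<lbrakk>c \<in> CL; x \<in> CM\<rbrakk> \<Longrightarrow> (\<phi> ^^ j) (c *\<^sub>M x) = (g ^^ j) c *\<^sub>M (\<phi> ^^ j) x"
  unfolding scal_def by (simp add: ppow_act mult_op_diff_ops conjn_mult_op)

lemma ppow_zero: "(\<phi> ^^ j) \<zero>\<^sub>M = \<zero>\<^sub>M"
  using ppow_scal[of \<zero> "\<zero>\<^sub>M" j] by (simp add: pow_zero)

lemma ppow_sum: "(\<And>i. i < n \<Longrightarrow> f i \<in> CM) \<Longrightarrow>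
    (\<phi> ^^ j) (\<Oplus>\<^bsub>M\<^esub>i\<in>{..<n::nat}. f i) = (\<Oplus>\<^bsub>M\<^esub>i\<in>{..<n}. (\<phi> ^^ j) (f i))"
  by (rule D.M.hom_sum) (auto simp: hom_def ppow_add ppow_zero D.M.abelian_monoid_axioms)

end

locale simple_semilinear = semilinear L k K g d M \<phi> + simple_diff_module L k M
  for L :: "'a ring" (structure) and k K g d and M :: "('a \<Rightarrow> 'a, 'm) module" and \<phi>
begin

text \<open>By Schur's lemma \<open>\<phi>\<^sup>d\<close> is a scalar \<open>c \<in> k\<close>, so dividing \<open>\<phi>\<close> by a \<open>d\<close>-th root of \<open>c\<close>
  turns it into an action of the cyclic group.\<close>

lemma exists_normalized:
  assumes inj: "\<And>x. \<lbrakk>x \<in> CM; \<phi> x = \<zero>\<^sub>M\<rbrakk> \<Longrightarrow> x = \<zero>\<^sub>M"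
  shows "\<exists>\<phi>'. semilinear L k K g d M \<phi>' \<and> (\<forall>x\<in>CM. (\<phi>' ^^ d) x = x)"
proof -
  have "\<exists>c\<in>k. \<forall>x\<in>CM. (\<phi> ^^ d) x = c *\<^sub>M x"
    by (rule schur) (simp_all add: ppow_add ppow_act conjn_d diff_ops_lin)
  then obtain c where c: "c \<in> k" "\<And>x. x \<in> CM \<Longrightarrow> (\<phi> ^^ d) x = c *\<^sub>M x" by blast
  have pinj: "x = \<zero>\<^sub>M" if "x \<in> CM" "(\<phi> ^^ j) x = \<zero>\<^sub>M" for x j
    using that(2)
  proof (induction j)
    case (Suc j)
    then show ?case using inj[OF ppow_closed[OF that(1), of j]] by simp
  qed simp
  obtain m where m: "m \<in> CM" "m \<noteq> \<zero>\<^sub>M" using nonzero by blast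
  have "c \<noteq> \<zero>" using c(2)[OF m(1)] pinj[OF m(1)] m by auto
  note ci = subfield_inv_closed[OF k_subfield c(1) this]
  note ks = subringE[OF subfieldE(1)[OF k_subfield]]
  \<comment> \<open>This list is the polynomial X^d - 1/c: the constant term and
    \<open>d - 1\<close> zeros, the leading 1 being implicit. Its root \<open>e\<close> multiplies
    \<phi>, which amounts to dividing by a root of \<open>c\<close>.\<close>
  have "set ((\<ominus> (inv c)) # replicate (d - 1) \<zero>) \<subseteq> k" using ci ks(2,5) by auto
  from algebraically_closed_root[OF k_subfield k_closed this] obtain e where
    e: "e \<in> k" "ev L e ((\<ominus> (inv c)) # replicate (d - 1) \<zero>) = \<zero>" by blast
  have cl: "c \<in> CL" "inv c \<in> CL" "e \<in> CL" using c ci e k_in_carrier by auto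
  have "\<ominus> (inv c) \<oplus> e \<otimes> e [^] (d - 1) = \<zero>" using e(2) cl by (simp add: ev_replicate)
  then have "e \<otimes> e [^] (d - 1) = inv c" using cl by (metis a_inv_closed minus_equality minus_minus m_closed nat_pow_closed a_comm)
  moreover have "e [^] d = e \<otimes> e [^] (d - 1)" using d_pos cl by (cases d) (simp_all add: m_comm)
  ultimately have ed: "e [^] d \<otimes> c = \<one>" using ci cl by (simp add: m_comm)
  have ek: "e [^] j \<in> k" for j :: nat by (induction j) (use e(1) ks in auto)
  define \<phi>' where "\<phi>' x = e *\<^sub>M \<phi> x" for x
  \<comment> \<open>Elements of \<open>k\<close> lie in \<open>K\<close> and are fixed by
    \<open>g\<close>, so \<phi> is linear over them and the factors \<open>e\<close> in the powers
    of \<open>\<phi>'\<close> can be collected in front.\<close>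
  have pk: "\<phi> (b *\<^sub>M x) = b *\<^sub>M \<phi> x" if "b \<in> k" "x \<in> CM" for b x
    using ppow_scal[of b x 1] that k_in_carrier pow_K[of b 1] k_sub_K by auto
  have "semilinear L k K g d M \<phi>'"
  proof (unfold_locales)
    show "\<phi>' (x \<oplus>\<^sub>M y) = \<phi>' x \<oplus>\<^sub>M \<phi>' y" if "x \<in> CM" "y \<in> CM" for x y
      using that cl by (simp add: \<phi>'_def phi_add phi_closed scal_add)
    show "\<phi>' (P \<bullet> x) = conjn 1 P \<bullet> \<phi>' x" if "P \<in> DL" "x \<in> CM" for P x
      using that act_scal_k[OF conjn_diff_ops[OF that(1)] e(1) phi_closed[OF that(2)], of 1]
      by (simp add: \<phi>'_def phi_act)
  qed (use cl in \<open>simp_all add: \<phi>'_def phi_closed\<close>)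
  moreover have "(\<phi>' ^^ j) x = e [^] j *\<^sub>M (\<phi> ^^ j) x" if "x \<in> CM" for j x
  proof (induction j)
    case 0
    then show ?case using that by simp
  next
    case (Suc j)
    have "(\<phi>' ^^ Suc j) x = \<phi>' (e [^] j *\<^sub>M (\<phi> ^^ j) x)" using Suc by simp
    also have "\<dots> = e *\<^sub>M (e [^] j *\<^sub>M \<phi> ((\<phi> ^^ j) x))"
      using that by (simp add: \<phi>'_def pk ek)
    also have "\<dots> = (e [^] Suc j) *\<^sub>M (\<phi> ^^ Suc j) x"
      using that cl ek k_in_carrier ppow_closed[OF that, of "Suc j"] by (simp add: scal_mult[symmetric] m_comm)
    finally show ?case .
  qed
  then have "(\<phi>' ^^ d) x = x" if "x \<in> CM" for x
    using that c(2) ed cl by (simp add: scal_mult[symmetric])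
  ultimately show ?thesis by blast
qed

end

locale descent = semilinear L k K g d M \<phi>
  for L :: "'a ring" (structure) and k K g d and M :: "('a \<Rightarrow> 'a, 'm) module" and \<phi> +
  assumes phi_d: "x \<in> CM \<Longrightarrow> (\<phi> ^^ d) x = x"
begin

definition "NC = {x \<in> CM. \<phi> x = x}"

definition Tr :: "'m \<Rightarrow> 'm" where "Tr m = (\<Oplus>\<^bsub>M\<^esub>j\<in>{..<d}. (\<phi> ^^ j) m)"

lemma NC_carrier: "x \<in> NC \<Longrightarrow> x \<in> CM"
  by (simp add: NC_def)

lemma ppow_NC: "x \<in> NC \<Longrightarrow> (\<phi> ^^ j) x = x"
  by (induction j) (simp_all add: NC_def)

lemma Tr_closed [simp]: "m \<in> CM \<Longrightarrow> Tr m \<in> CM"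
  unfolding Tr_def by (intro D.M.sum_closed) simp

lemma Tr_NC: assumes "m \<in> CM" shows "Tr m \<in> NC"
proof -
  have "\<phi> (Tr m) = (\<Oplus>\<^bsub>M\<^esub>j\<in>{..<d}. (\<phi> ^^ Suc j) m)"
    unfolding Tr_def using ppow_sum[of d "\<lambda>j. (\<phi> ^^ j) m" 1] assms by simp
  also have "\<dots> = Tr m"
    unfolding Tr_def using assms phi_d by (intro D.M.sum_rotate) (auto simp del: funpow.simps simp: funpow_0)
  finally show ?thesis using assms by (simp add: NC_def)
qed

lemma Tr_add: "\<lbrakk>x \<in> CM; y \<in> CM\<rbrakk> \<Longrightarrow> Tr (x \<oplus>\<^sub>M y) = Tr x \<oplus>\<^sub>M Tr y"
  unfolding Tr_def by (simp add: ppow_add D.M.finsum_addf)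

lemma Tr_zero: "Tr \<zero>\<^sub>M = \<zero>\<^sub>M"
  unfolding Tr_def by (simp add: ppow_zero D.M.finsum_zero)

lemma Tr_scal: "\<lbrakk>c \<in> CL; n \<in> NC\<rbrakk> \<Longrightarrow> Tr (c *\<^sub>M n) = tr c *\<^sub>M n"
  unfolding Tr_def tr_def by (simp add: NC_carrier ppow_scal ppow_NC sum_scal pow_closed)

text \<open>The computation of \<open>expand\<close> with the powers of \<phi> acting on
  \<open>m\<close>. It shows that the invariants span \<open>M\<close> over \<open>L\<close>, with
  explicit coordinates, so that descent requires neither a basis nor a count of dimensions.\<close>

lemma expand_M:
  assumes "m \<in> CM" shows "(\<Oplus>\<^bsub>M\<^esub>i\<in>{..<sn}. sa i *\<^sub>M Tr (sb i *\<^sub>M m)) = m"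
proof -
  note [simp] = assms sa_closed sb_closed pow_closed
  have "(\<Oplus>\<^bsub>M\<^esub>i\<in>{..<sn}. sa i *\<^sub>M Tr (sb i *\<^sub>M m)) =
    (\<Oplus>\<^bsub>M\<^esub>i\<in>{..<sn}. \<Oplus>\<^bsub>M\<^esub>j\<in>{..<d}. (sa i \<otimes> (g ^^ j) (sb i)) *\<^sub>M (\<phi> ^^ j) m)"
    unfolding Tr_def
    by (intro D.M.sum_cong) (auto simp: scal_sum ppow_scal scal_mult intro!: D.M.sum_closed D.M.sum_cong)
  also have "\<dots> = (\<Oplus>\<^bsub>M\<^esub>j\<in>{..<d}. \<Oplus>\<^bsub>M\<^esub>i\<in>{..<sn}. (sa i \<otimes> (g ^^ j) (sb i)) *\<^sub>M (\<phi> ^^ j) m)"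
    by (rule D.M.sum_swap) simp
  also have "\<dots> = (\<Oplus>\<^bsub>M\<^esub>j\<in>{..<d}. if j = 0 then m else \<zero>\<^sub>M)"
  proof (rule D.M.sum_cong)
    fix j assume j: "j < d"
    have "(\<Oplus>\<^bsub>M\<^esub>i\<in>{..<sn}. (sa i \<otimes> (g ^^ j) (sb i)) *\<^sub>M (\<phi> ^^ j) m) =
      (\<Oplus>i\<in>{..<sn}. sa i \<otimes> (g ^^ j) (sb i)) *\<^sub>M (\<phi> ^^ j) m"
      by (rule sum_scal[symmetric]) auto
    then show "(\<Oplus>\<^bsub>M\<^esub>i\<in>{..<sn}. (sa i \<otimes> (g ^^ j) (sb i)) *\<^sub>M (\<phi> ^^ j) m) = (if j = 0 then m else \<zero>\<^sub>M)"
      using ab_sum[OF j] by simp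
  qed simp
  also have "\<dots> = m" using d_pos by (simp add: D.M.sum_delta)
  finally show ?thesis .
qed

lemma tr_diff_ops': assumes "P \<in> DL" shows "(\<lambda>x\<in>K. tr (P x)) \<in> DK"
proof -
  have "(\<lambda>x\<in>K. tr (P x)) = (\<lambda>x\<in>K. tr (\<one> \<otimes> P x))"
    by (rule restrict_ext) (use linD(2)[OF diff_ops_lin[OF assms]] K_carrier in simp)
  then show ?thesis using tr_diff_ops[OF assms, of \<one>] by simp
qed

text \<open>As \<open>n\<close> is invariant, its image under \<open>P\<close> is moved by the j-th
  power of \<phi> to its image under the j-th conjugate of \<open>P\<close>. The sum of all
  conjugates restricts to x \<mapsto> tr(P x) on \<open>K\<close> and so is the lift of that
  operator of \<open>K\<close>.\<close>

lemma Tr_act: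
  assumes "P \<in> DL" "n \<in> NC" shows "Tr (P \<bullet> n) = lift (\<lambda>x\<in>K. tr (P x)) \<bullet> n"
proof -
  note n = NC_carrier[OF assms(2)]
  have "lift (\<lambda>x\<in>K. tr (P x)) = (\<lambda>x\<in>CL. \<Oplus>j\<in>{..<d}. conjn j P x)"
  proof (rule lift_eqI[OF tr_diff_ops'[OF assms(1)] diff_ops_sum])
    fix x assume x: "x \<in> K"
    have "P x \<in> CL" using linD(2)[OF diff_ops_lin[OF assms(1)]] x K_carrier by blast
    then show "(\<lambda>x\<in>CL. \<Oplus>j\<in>{..<d}. conjn j P x) x = (\<lambda>x\<in>K. tr (P x)) x"
      using x K_carrier[OF x] by (simp add: tr_def conjn_K[OF assms(1) x])
  qed (rule conjn_diff_ops[OF assms(1)])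
  then have "lift (\<lambda>x\<in>K. tr (P x)) \<bullet> n = (\<Oplus>\<^bsub>M\<^esub>j\<in>{..<d}. conjn j P \<bullet> n)"
    using act_op_sum[of d "\<lambda>j. conjn j P" n] conjn_diff_ops[OF assms(1)] n by simp
  also have "\<dots> = Tr (P \<bullet> n)"
    unfolding Tr_def by (rule D.M.sum_cong)
      (simp_all add: ppow_act[OF assms(1) n] ppow_NC[OF assms(2)] assms(1) n conjn_diff_ops)
  finally show ?thesis by simp
qed

text \<open>The operator with summands l_i lift(Q_i) agrees with \<open>P\<close> on
  \<open>K\<close>, so it is \<open>P\<close> by uniqueness of extensions. This makes the
  identification used in the definition of the inverse image effective on \<open>M\<close>.\<close>

lemma act_decompose:
  assumes "P \<in> DL" "m \<in> CM" "\<And>i. i < r \<Longrightarrow> l i \<in> CL" "\<And>i. i < r \<Longrightarrow> Q i \<in> DK"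
    "\<And>x. x \<in> K \<Longrightarrow> P x = (\<Oplus>i\<in>{..<r::nat}. l i \<otimes> Q i x)"
  shows "P \<bullet> m = (\<Oplus>\<^bsub>M\<^esub>i\<in>{..<r}. l i *\<^sub>M (lift (Q i) \<bullet> m))"
proof -
  let ?R = "\<lambda>i. compose CL (mult_op L (l i)) (lift (Q i))"
  have R: "?R i \<in> DL" if "i < r" for i using that assms lift by (intro diff_ops_compose mult_op_diff_ops) auto
  have "P = (\<lambda>x\<in>CL. \<Oplus>i\<in>{..<r}. ?R i x)"
  proof (rule diff_ops_unique[OF assms(1) diff_ops_sum[OF R]])
    fix x assume x: "x \<in> K"
    have Qx: "Q i x \<in> CL" if "i < r" for i using diff_ops_K_closed[OF assms(4)[OF that] x] K_carrier by blast
    have "(\<Oplus>i\<in>{..<r}. l i \<otimes> Q i x) = (\<Oplus>i\<in>{..<r}. ?R i x)"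
      by (rule sum_cong) (use x K_carrier[OF x] lift(2)[OF assms(4)] Qx assms(3) in \<open>simp_all add: compose_def mult_op_def\<close>)
    then show "P x = (\<lambda>x\<in>CL. \<Oplus>i\<in>{..<r}. ?R i x) x" using assms(5)[OF x] K_carrier[OF x] by simp
  qed
  then have "P \<bullet> m = (\<Oplus>\<^bsub>M\<^esub>i\<in>{..<r}. ?R i \<bullet> m)" using act_op_sum[of r ?R m] R assms(2) by simp
  also have "\<dots> = (\<Oplus>\<^bsub>M\<^esub>i\<in>{..<r}. l i *\<^sub>M (lift (Q i) \<bullet> m))"
    by (rule D.M.sum_cong) (use assms lift in \<open>auto simp: scal_def act_compose mult_op_diff_ops\<close>)
  finally show ?thesis .
qed

section \<open>The invariants as a module over the operators of \<open>K\<close>\<close>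

definition N :: "('a \<Rightarrow> 'a, 'm) module"
  where "N = \<lparr>carrier = NC, monoid.mult = monoid.mult M, one = one M, ring.zero = \<zero>\<^sub>M,
    add = add M, smult = (\<lambda>Q n. lift Q \<bullet> n)\<rparr>"

lemma N_simps: "carrier N = NC" "\<zero>\<^bsub>N\<^esub> = \<zero>\<^sub>M" "x \<oplus>\<^bsub>N\<^esub> y = x \<oplus>\<^sub>M y" "Q \<odot>\<^bsub>N\<^esub> x = lift Q \<bullet> x"
  by (simp_all add: N_def)

lemma NC_zero: "\<zero>\<^sub>M \<in> NC"
  using ppow_zero[of 1] by (simp add: NC_def)

lemma NC_add: "\<lbrakk>x \<in> NC; y \<in> NC\<rbrakk> \<Longrightarrow> x \<oplus>\<^sub>M y \<in> NC"
  by (simp add: NC_def phi_add)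

lemma NC_act: "\<lbrakk>Q \<in> DK; x \<in> NC\<rbrakk> \<Longrightarrow> lift Q \<bullet> x \<in> NC"
  by (simp add: NC_def phi_act lift conjn_lift)

lemma mult_op_K: "c \<in> K \<Longrightarrow> mult_op (L\<lparr>carrier := K\<rparr>) c \<in> DK"
proof -
  interpret K: k_field "L\<lparr>carrier := K\<rparr>" k by (rule K_field)
  assume "c \<in> K" then show ?thesis using K.mult_op_diff_ops[of c] by simp
qed

lemma lift_mult_op: "c \<in> K \<Longrightarrow> lift (mult_op (L\<lparr>carrier := K\<rparr>) c) = mult_op L c"
  by (rule lift_eqI[OF mult_op_K mult_op_diff_ops]) (simp_all add: K_carrier mult_op_def)

lemma NC_scal: "\<lbrakk>c \<in> K; x \<in> NC\<rbrakk> \<Longrightarrow> c *\<^sub>M x \<in> NC"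
  using NC_act[OF mult_op_K, of c x] by (simp add: lift_mult_op scal_def)

text \<open>By uniqueness of extensions \<open>lift\<close> respects sums, products and the unit, so
  the module axioms are inherited from \<open>M\<close>.\<close>

lemma left_module_N: "left_module (diff_ops (L\<lparr>carrier := K\<rparr>) k) N"
proof -
  interpret K: k_field "L\<lparr>carrier := K\<rparr>" k by (rule K_field)
  have Kc: "carrier (L\<lparr>carrier := K\<rparr>) = K" by simp
  have mo: "\<ominus> \<one> \<in> K" using k_subringD(5,7)[OF k_subring_K] by blast
  have "abelian_group N"
  proof (rule abelian_groupI)
    fix x assume "x \<in> carrier N"
    then have x: "x \<in> NC" by (simp add: N_simps)
    show "\<exists>y\<in>carrier N. y \<oplus>\<^bsub>N\<^esub> x = \<zero>\<^bsub>N\<^esub>"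
      using NC_scal[OF mo x] D.M.l_neg[OF NC_carrier[OF x]] unfolding ne_neg[OF NC_carrier[OF x]] N_simps by blast
  qed (auto simp: N_simps NC_zero NC_add NC_carrier D.M.a_ac)
  moreover have "left_module_axioms (diff_ops (L\<lparr>carrier := K\<rparr>) k) N"
  proof (rule left_module_axioms.intro, goal_cases)
    case (2 P Q x)
    have "lift (P \<oplus>\<^bsub>diff_ops (L\<lparr>carrier := K\<rparr>) k\<^esub> Q) = (\<lambda>x\<in>CL. lift P x \<oplus> lift Q x)"
      using 2 K.diff_ops_add[of P Q] lift by (intro lift_eqI diff_ops_add) (simp_all add: K.diff_ops_simps K_carrier)
    then show ?case using 2 lift NC_carrier by (simp add: N_simps act_plus)
  next
    case (4 P Q x)
    have "lift (P \<otimes>\<^bsub>diff_ops (L\<lparr>carrier := K\<rparr>) k\<^esub> Q) = compose CL (lift P) (lift Q)"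
      using 4 K.diff_ops_compose[of P Q] lift diff_ops_K_closed
      by (intro lift_eqI diff_ops_compose) (simp_all add: K.diff_ops_simps K_carrier compose_def)
    then show ?case using 4 lift NC_carrier by (simp add: N_simps act_compose)
  next
    case (5 x)
    have "lift \<one>\<^bsub>diff_ops (L\<lparr>carrier := K\<rparr>) k\<^esub> = \<one>\<^bsub>diff_ops L k\<^esub>"
      by (intro lift_eqI monoid.one_closed ring.axioms(2) ring_diff_ops K.ring_diff_ops)
        (simp_all add: K.diff_ops_simps diff_ops_simps K_carrier)
    then show ?case using 5 NC_carrier by (simp add: N_simps)
  qed (auto simp: N_simps NC_act act_add lift NC_carrier)
  ultimately show ?thesis
    using K.ring_diff_ops by (simp add: left_module_def)
qed

end

locale simple_descent = descent L k K g d M \<phi> + simple_diff_module L k M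
  for L :: "'a ring" (structure) and k K g d and M :: "('a \<Rightarrow> 'a, 'm) module" and \<phi>
begin

text \<open>A submodule \<open>H\<close> of \<open>N\<close> generates a submodule \<open>H'\<close>
  of \<open>M\<close>, which is zero or everything. In the first case \<open>H\<close> is zero,
  being contained in \<open>H'\<close>. In the second, each invariant \<open>x\<close> has tr(y) x
  in \<open>H\<close> for some \<open>y\<close> of nonzero trace, and dividing by the trace gives
  \<open>x\<close>.\<close>

lemma simple_N: "simple_module (diff_ops (L\<lparr>carrier := K\<rparr>) k) N"
  unfolding simple_module_def
proof (intro conjI allI impI)
  show "left_module (diff_ops (L\<lparr>carrier := K\<rparr>) k) N" by (rule left_module_N)
  obtain m where m: "m \<in> CM" "m \<noteq> \<zero>\<^sub>M" using nonzero by blast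
  show "carrier N \<noteq> {\<zero>\<^bsub>N\<^esub>}"
  proof
    assume "carrier N = {\<zero>\<^bsub>N\<^esub>}"
    then have "Tr (sb i *\<^sub>M m) = \<zero>\<^sub>M" if "i < sn" for i
      using Tr_NC[of "sb i *\<^sub>M m"] m sb_closed[OF that] by (simp add: N_simps)
    then have "(\<Oplus>\<^bsub>M\<^esub>i\<in>{..<sn}. sa i *\<^sub>M Tr (sb i *\<^sub>M m)) = (\<Oplus>\<^bsub>M\<^esub>i\<in>{..<sn}. \<zero>\<^sub>M)"
      by (intro D.M.sum_cong) (simp_all add: sa_closed)
    then show False using expand_M[OF m(1)] m(2) by (simp add: D.M.finsum_zero)
  qed
next
  fix H assume "Module.submodule H (diff_ops (L\<lparr>carrier := K\<rparr>) k) N"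
  then have H: "H \<subseteq> NC" "\<zero>\<^sub>M \<in> H" "\<And>x y. \<lbrakk>x \<in> H; y \<in> H\<rbrakk> \<Longrightarrow> x \<oplus>\<^sub>M y \<in> H"
    "\<And>Q x. \<lbrakk>Q \<in> DK; x \<in> H\<rbrakk> \<Longrightarrow> lift Q \<bullet> x \<in> H"
    by (auto simp: Module.submodule_def Module.submodule_axioms_def subgroup_def N_simps)
  have HC: "x \<in> CM" if "x \<in> H" for x using that H(1) NC_carrier by blast
  have H_scal: "c *\<^sub>M x \<in> H" if "c \<in> K" "x \<in> H" for c x
    using H(4)[OF mult_op_K that(2), OF that(1)] by (simp add: lift_mult_op[OF that(1)] scal_def)
  have H_sum: "(\<And>i. i < n \<Longrightarrow> f i \<in> H) \<Longrightarrow> (\<Oplus>\<^bsub>M\<^esub>i\<in>{..<n}. f i) \<in> H" for n :: nat and f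
    by (induction n) (simp_all add: H HC D.M.sum_Suc)
  \<comment> \<open>By \<open>expand_M\<close> this is \<open>L H\<close>, described by a condition
    on traces instead of by finite sums of products.\<close>
  define H' where "H' = {m \<in> CM. \<forall>y\<in>CL. Tr (y *\<^sub>M m) \<in> H}"
  have "Module.submodule H' (diff_ops L k) M"
  proof (rule submoduleI')
    show "\<zero>\<^sub>M \<in> H'" using H(2) by (simp add: H'_def Tr_zero)
    show "x \<oplus>\<^sub>M y \<in> H'" if "x \<in> H'" "y \<in> H'" for x y
      using that H(3) by (simp add: H'_def scal_add Tr_add)
    fix P m assume P: "P \<in> DL" and m: "m \<in> H'"
    have "Tr (y *\<^sub>M (P \<bullet> m)) \<in> H" if y: "y \<in> CL" for y
    proof -
      \<comment> \<open>The vector \<open>m\<close> is the sum of the a_i \<open>?h i\<close> with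
        \<open>?h i\<close> in \<open>H\<close>. So applying \<open>P\<close>, multiplying by
        \<open>y\<close> and taking the trace yields traces of the
        \<open>?Z i \<bullet> ?h i\<close>, and \<open>Tr_act\<close> turns each of them into an
        operator of \<open>K\<close> acting on an element of \<open>H\<close>.\<close>
      let ?h = "\<lambda>i. Tr (sb i *\<^sub>M m)"
      let ?Z = "\<lambda>i. compose CL (mult_op L y) (compose CL P (mult_op L (sa i)))"
      have h: "?h i \<in> H" if "i < sn" for i using m that sb_closed by (simp add: H'_def)
      have Z: "?Z i \<in> DL" if "i < sn" for i
        using that sa_closed y P by (intro diff_ops_compose mult_op_diff_ops) auto
      have "m \<in> CM" using m by (simp add: H'_def)
      then have "y *\<^sub>M (P \<bullet> m) = y *\<^sub>M (P \<bullet> (\<Oplus>\<^bsub>M\<^esub>i\<in>{..<sn}. sa i *\<^sub>M ?h i))" by (simp add: expand_M)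
      also have "\<dots> = (\<Oplus>\<^bsub>M\<^esub>i\<in>{..<sn}. y *\<^sub>M (P \<bullet> (sa i *\<^sub>M ?h i)))"
        using h HC sa_closed P y by (simp add: act_sum scal_sum)
      also have "\<dots> = (\<Oplus>\<^bsub>M\<^esub>i\<in>{..<sn}. ?Z i \<bullet> ?h i)"
        by (rule D.M.sum_cong)
          (use h HC sa_closed P y in \<open>simp_all add: act_compose diff_ops_compose mult_op_diff_ops scal_def\<close>)
      finally have "Tr (y *\<^sub>M (P \<bullet> m)) = (\<Oplus>\<^bsub>M\<^esub>i\<in>{..<sn}. Tr (?Z i \<bullet> ?h i))"
        using D.M.hom_sum[of M Tr sn "\<lambda>i. ?Z i \<bullet> ?h i"] h HC Z
        by (simp add: hom_def Tr_add Tr_zero D.M.abelian_monoid_axioms)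
      also have "\<dots> = (\<Oplus>\<^bsub>M\<^esub>i\<in>{..<sn}. lift (\<lambda>x\<in>K. tr (?Z i x)) \<bullet> ?h i)"
      proof (rule D.M.sum_cong)
        fix i assume i: "i < sn"
        show "Tr (?Z i \<bullet> ?h i) = lift (\<lambda>x\<in>K. tr (?Z i x)) \<bullet> ?h i"
          using h[OF i] H(1) by (intro Tr_act[OF Z[OF i]]) blast
        show "lift (\<lambda>x\<in>K. tr (?Z i x)) \<bullet> ?h i \<in> CM"
          using HC[OF h[OF i]] lift(1)[OF tr_diff_ops'[OF Z[OF i]]] by simp
      qed
      also have "\<dots> \<in> H" by (intro H_sum H(4) tr_diff_ops' Z h)
      finally show ?thesis .
    qed
    then show "P \<bullet> m \<in> H'" using P m by (simp add: H'_def)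
  qed (auto simp: H'_def)
  from submodule_cases[OF this] show "H = {\<zero>\<^bsub>N\<^esub>} \<or> H = carrier N"
  proof
    assume "H' = {\<zero>\<^sub>M}"
    moreover have "H \<subseteq> H'"
    proof
      fix x assume x: "x \<in> H"
      then have "x \<in> NC" using H(1) by blast
      then show "x \<in> H'" using x HC H_scal tr_K by (simp add: H'_def Tr_scal)
    qed
    ultimately show ?thesis using H(2) by (auto simp: N_simps)
  next
    assume H': "H' = CM"
    have "x \<in> H" if x: "x \<in> NC" for x
    proof -
      obtain y where y: "y \<in> CL" "tr y \<noteq> \<zero>" using tr_nonzero by blast
      note i = subfield_inv_closed[OF K_subfield tr_K[OF y(1)] y(2)]
      have "x \<in> H'" using H' NC_carrier[OF x] by simp
      then have "Tr (y *\<^sub>M x) \<in> H" using y(1) by (simp add: H'_def)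
      then have "tr y *\<^sub>M x \<in> H" using Tr_scal[OF y(1) x] by simp
      then have "inv (tr y) *\<^sub>M (tr y *\<^sub>M x) \<in> H" using H_scal i by blast
      moreover have "inv (tr y) *\<^sub>M (tr y *\<^sub>M x) = x"
        using i tr_closed[OF y(1)] NC_carrier[OF x] K_carrier by (simp add: scal_mult[symmetric] m_comm)
      ultimately show ?thesis by simp
    qed
    then show ?thesis using H(1) by (auto simp: N_simps)
  qed
qed

end

section \<open>The inverse image\<close>

locale tensor = A: abelian_group A + B: abelian_group B
  for R :: "('r, 'c) ring_scheme" and A :: "('r, 'a, 'd) module_scheme" and B :: "('r, 'b, 'e) module_scheme" +
  assumes smult_A: "\<lbrakk>r \<in> carrier R; x \<in> carrier A\<rbrakk> \<Longrightarrow> r \<odot>\<^bsub>A\<^esub> x \<in> carrier A"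
    and smult_B: "\<lbrakk>r \<in> carrier R; y \<in> carrier B\<rbrakk> \<Longrightarrow> r \<odot>\<^bsub>B\<^esub> y \<in> carrier B"
begin

abbreviation "F \<equiv> free_Abelian_group (carrier A \<times> carrier B)"
abbreviation "T \<equiv> tensor_group R A B"
abbreviation "pt \<equiv> pure_tensor R A B"

lemma F_group: "group F"
  by simp

lemma F_diff: "\<lbrakk>x \<in> carrier F; y \<in> carrier F\<rbrakk> \<Longrightarrow> x - y \<in> carrier F"
  using keys_diff[of x y] by auto

lemma frag_of_F: "\<lbrakk>x \<in> carrier A; y \<in> carrier B\<rbrakk> \<Longrightarrow> frag_of (x, y) \<in> carrier F"
  by simp

lemma relations_subset: "tensor_relations R A B \<subseteq> carrier F"
  unfolding tensor_relations_def
  by (auto simp del: carrier_free_Abelian_group_iff intro!: F_diff frag_of_F smult_A smult_B)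

lemma subgroup_kernel: "subgroup (tensor_kernel R A B) F"
  unfolding tensor_kernel_def by (rule group.generate_is_subgroup[OF F_group relations_subset])

lemma normal_kernel: "tensor_kernel R A B \<lhd> F"
  using comm_group.normal_iff_subgroup[OF abelian_free_Abelian_group] subgroup_kernel by blast

lemma comm_group_T: "comm_group T"
  unfolding tensor_group_def by (rule comm_group.abelian_FactGroup[OF abelian_free_Abelian_group subgroup_kernel])

definition q where "q u = tensor_kernel R A B #>\<^bsub>F\<^esub> u"

lemma q_hom: "q \<in> hom F T"
  unfolding q_def tensor_group_def by (rule normal.r_coset_hom_Mod[OF normal_kernel])

lemma q_add: "\<lbrakk>u \<in> carrier F; v \<in> carrier F\<rbrakk> \<Longrightarrow> q (u + v) = q u \<otimes>\<^bsub>T\<^esub> q v"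
  using hom_mult[OF q_hom, of u v] by simp

lemma q_eqI: assumes "u \<in> carrier F" "v \<in> carrier F" "u - v \<in> tensor_kernel R A B" shows "q u = q v"
proof -
  interpret T: comm_group T by (rule comm_group_T)
  have "q (u - v) = \<one>\<^bsub>T\<^esub>"
    unfolding q_def using group.coset_join2[OF F_group F_diff[OF assms(1,2)] subgroup_kernel assms(3)]
    by (simp add: tensor_group_def)
  then have "q ((u - v) + v) = q v"
    using q_add[OF F_diff[OF assms(1,2)] assms(2)] hom_in_carrier[OF q_hom assms(2)] by simp
  then show ?thesis by simp
qed

lemma pt_q: "pt x y = q (frag_of (x, y))"
  by (simp add: pure_tensor_def q_def)

lemma pt_closed: "\<lbrakk>x \<in> carrier A; y \<in> carrier B\<rbrakk> \<Longrightarrow> pt x y \<in> carrier T"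
  unfolding pt_q by (rule hom_in_carrier[OF q_hom frag_of_F])

lemma relation_kernel: "u \<in> tensor_relations R A B \<Longrightarrow> u \<in> tensor_kernel R A B"
  unfolding tensor_kernel_def by (rule generate.incl)

lemma F_add: "\<lbrakk>x \<in> carrier F; y \<in> carrier F\<rbrakk> \<Longrightarrow> x + y \<in> carrier F"
  using keys_add[of x y] by auto

lemma pt_add_left:
  assumes "x \<in> carrier A" "x' \<in> carrier A" "y \<in> carrier B"
  shows "pt (x \<oplus>\<^bsub>A\<^esub> x') y = pt x y \<otimes>\<^bsub>T\<^esub> pt x' y"
proof -
  have "frag_of (x \<oplus>\<^bsub>A\<^esub> x', y) - frag_of (x, y) - frag_of (x', y) \<in> tensor_relations R A B"
    using assms unfolding tensor_relations_def by blast
  then have "frag_of (x \<oplus>\<^bsub>A\<^esub> x', y) - (frag_of (x, y) + frag_of (x', y)) \<in> tensor_kernel R A B"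
    using relation_kernel by (simp add: diff_diff_eq)
  then have "q (frag_of (x \<oplus>\<^bsub>A\<^esub> x', y)) = q (frag_of (x, y) + frag_of (x', y))"
    using assms by (intro q_eqI F_add frag_of_F) auto
  then show ?thesis using assms by (simp add: pt_q q_add frag_of_F del: carrier_free_Abelian_group_iff)
qed

lemma pt_add_right:
  assumes "x \<in> carrier A" "y \<in> carrier B" "y' \<in> carrier B"
  shows "pt x (y \<oplus>\<^bsub>B\<^esub> y') = pt x y \<otimes>\<^bsub>T\<^esub> pt x y'"
proof -
  have "frag_of (x, y \<oplus>\<^bsub>B\<^esub> y') - frag_of (x, y) - frag_of (x, y') \<in> tensor_relations R A B"
    using assms unfolding tensor_relations_def by blast
  then have "frag_of (x, y \<oplus>\<^bsub>B\<^esub> y') - (frag_of (x, y) + frag_of (x, y')) \<in> tensor_kernel R A B"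
    using relation_kernel by (simp add: diff_diff_eq)
  then have "q (frag_of (x, y \<oplus>\<^bsub>B\<^esub> y')) = q (frag_of (x, y) + frag_of (x, y'))"
    using assms by (intro q_eqI F_add frag_of_F) auto
  then show ?thesis using assms by (simp add: pt_q q_add frag_of_F del: carrier_free_Abelian_group_iff)
qed

lemma pt_smult:
  assumes "r \<in> carrier R" "x \<in> carrier A" "y \<in> carrier B"
  shows "pt (r \<odot>\<^bsub>A\<^esub> x) y = pt x (r \<odot>\<^bsub>B\<^esub> y)"
proof -
  have "frag_of (r \<odot>\<^bsub>A\<^esub> x, y) - frag_of (x, r \<odot>\<^bsub>B\<^esub> y) \<in> tensor_relations R A B"
    using assms unfolding tensor_relations_def by blast
  then show ?thesis
    unfolding pt_q using assms by (intro q_eqI frag_of_F relation_kernel smult_A smult_B) auto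
qed

lemma tensor_universal:
  assumes "comm_group G"
    and f: "\<And>x y. \<lbrakk>x \<in> carrier A; y \<in> carrier B\<rbrakk> \<Longrightarrow> f x y \<in> carrier G"
    and "\<And>x x' y. \<lbrakk>x \<in> carrier A; x' \<in> carrier A; y \<in> carrier B\<rbrakk> \<Longrightarrow> f (x \<oplus>\<^bsub>A\<^esub> x') y = f x y \<otimes>\<^bsub>G\<^esub> f x' y"
    and "\<And>x y y'. \<lbrakk>x \<in> carrier A; y \<in> carrier B; y' \<in> carrier B\<rbrakk> \<Longrightarrow> f x (y \<oplus>\<^bsub>B\<^esub> y') = f x y \<otimes>\<^bsub>G\<^esub> f x y'"
    and "\<And>r x y. \<lbrakk>r \<in> carrier R; x \<in> carrier A; y \<in> carrier B\<rbrakk> \<Longrightarrow> f (r \<odot>\<^bsub>A\<^esub> x) y = f x (r \<odot>\<^bsub>B\<^esub> y)"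
  obtains h where "h \<in> hom T G" "\<And>x y. \<lbrakk>x \<in> carrier A; y \<in> carrier B\<rbrakk> \<Longrightarrow> h (pt x y) = f x y"
proof -
  interpret G: comm_group G by fact
  have "case_prod f ` (carrier A \<times> carrier B) \<subseteq> carrier G" using f by auto
  from G.free_Abelian_group_universal[OF this] obtain h0 where
    h0: "h0 \<in> hom F G" "\<And>z. z \<in> carrier A \<times> carrier B \<Longrightarrow> h0 (frag_of z) = case_prod f z" by blast
  interpret h: group_hom F G h0 by (intro group_hom.intro group_hom_axioms.intro F_group G.is_group h0(1))
  have h_diff: "h0 (u - v) = h0 u \<otimes>\<^bsub>G\<^esub> inv\<^bsub>G\<^esub> h0 v" if "u \<in> carrier F" "v \<in> carrier F" for u v
  proof -
    have "h0 (u \<otimes>\<^bsub>F\<^esub> inv\<^bsub>F\<^esub> v) = h0 u \<otimes>\<^bsub>G\<^esub> inv\<^bsub>G\<^esub> h0 v"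
      using that h.G.inv_closed[OF that(2)] by (simp only: h.hom_mult h.hom_inv)
    then show ?thesis using that by simp
  qed
  have hf: "h0 (frag_of (x, y)) = f x y" if "x \<in> carrier A" "y \<in> carrier B" for x y
    using h0(2)[of "(x, y)"] that by simp
  have "tensor_relations R A B \<subseteq> kernel F G h0"
  proof
    fix u assume u: "u \<in> tensor_relations R A B"
    then have uF: "u \<in> carrier F" using relations_subset by blast
    have "h0 u = \<one>\<^bsub>G\<^esub>"
      using u unfolding tensor_relations_def
      by (auto simp del: carrier_free_Abelian_group_iff simp: h_diff F_diff frag_of_F hf assms smult_A smult_B
          G.m_assoc[symmetric] G.m_comm[of _ "inv\<^bsub>G\<^esub> _"] G.inv_solve_right)
    then show "u \<in> kernel F G h0" using uF by (simp add: kernel_def)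
  qed
  then have "tensor_kernel R A B \<subseteq> kernel F G h0"
    unfolding tensor_kernel_def by (rule h.G.generate_subgroup_incl[OF _ h.subgroup_kernel])
  from h.FactGroup_universal_kernel[OF normal_kernel this] obtain h where
    "h \<in> hom T G" "\<And>u. u \<in> carrier F \<Longrightarrow> h (q u) = h0 u" unfolding tensor_group_def q_def by blast
  then show thesis using that hf frag_of_F by (simp add: pt_q del: carrier_free_Abelian_group_iff)
qed

lemma tensor_hom_eq:
  assumes "group G" "h1 \<in> hom T G" "h2 \<in> hom T G"
    "\<And>x y. \<lbrakk>x \<in> carrier A; y \<in> carrier B\<rbrakk> \<Longrightarrow> h1 (pt x y) = h2 (pt x y)"
    "t \<in> carrier T"
  shows "h1 t = h2 t"
proof -
  interpret T: comm_group T by (rule comm_group_T)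
  interpret h1: group_hom T G h1 by (intro group_hom.intro group_hom_axioms.intro T.is_group assms)
  interpret h2: group_hom T G h2 by (intro group_hom.intro group_hom_axioms.intro T.is_group assms)
  interpret q: group_hom F T q by (intro group_hom.intro group_hom_axioms.intro T.is_group F_group q_hom)
  obtain u where u: "u \<in> carrier F" "t = q u"
    using assms(5) by (auto simp: tensor_group_def carrier_FactGroup q_def simp del: carrier_free_Abelian_group_iff)
  have q_diff: "q (u - v) = q u \<otimes>\<^bsub>T\<^esub> inv\<^bsub>T\<^esub> q v" if "u \<in> carrier F" "v \<in> carrier F" for u v
  proof -
    have "q (u \<otimes>\<^bsub>F\<^esub> inv\<^bsub>F\<^esub> v) = q u \<otimes>\<^bsub>T\<^esub> inv\<^bsub>T\<^esub> q v"
      using that q.G.inv_closed[OF that(2)] by (simp only: q.hom_mult q.hom_inv)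
    then show ?thesis using that by simp
  qed
  have "h1 (q u) = h2 (q u)"
    using u(1)[unfolded carrier_free_Abelian_group_iff]
  proof (rule free_Abelian_group_induct[of u "carrier A \<times> carrier B" "\<lambda>u. h1 (q u) = h2 (q u)"], goal_cases)
    case 1
    show ?case using q.hom_one by simp
  next
    case (2 x y)
    then have "q x \<in> carrier T" "q y \<in> carrier T" by (auto intro!: q.hom_closed)
    then show ?case using 2 by (simp add: q_diff)
  next
    case (3 z)
    then show ?case using assms(4) by (cases z) (simp add: pt_q)
  qed
  then show ?thesis using u by simp
qed

end

section \<open>The isomorphism of \<open>M\<close> with the inverse image of
  \<open>N\<close>\<close>

context descent
begin

abbreviation "KN \<equiv> underlying_module (L\<lparr>carrier := K\<rparr>) N"
abbreviation "PB \<equiv> pullback L K k N"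

lemma abelian_group_N: "abelian_group N"
  using left_module_N by (simp add: left_module_def)

lemma KN_simps: "carrier KN = NC" "x \<oplus>\<^bsub>KN\<^esub> y = x \<oplus>\<^sub>M y"
  "c \<in> K \<Longrightarrow> c \<odot>\<^bsub>KN\<^esub> x = c *\<^sub>M x"
  by (simp_all add: underlying_module_def N_simps lift_mult_op scal_def)

sublocale T: tensor "L\<lparr>carrier := K\<rparr>" "self_module L" KN
proof (intro tensor.intro tensor_axioms.intro)
  show "abelian_group (self_module L)"
  proof (rule abelian_groupI)
    fix x assume "x \<in> carrier (self_module L)"
    then show "\<exists>y\<in>carrier (self_module L). y \<oplus>\<^bsub>self_module L\<^esub> x = \<zero>\<^bsub>self_module L\<^esub>"
      by (intro bexI[of _ "\<ominus> x"]) (simp_all add: self_module_def l_neg)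
  qed (auto simp: self_module_def a_ac)
  interpret N: abelian_group N by (rule abelian_group_N)
  show "abelian_group KN"
  proof (rule abelian_groupI)
    fix x assume "x \<in> carrier KN"
    then show "\<exists>y\<in>carrier KN. y \<oplus>\<^bsub>KN\<^esub> x = \<zero>\<^bsub>KN\<^esub>"
      by (intro bexI[of _ "\<ominus>\<^bsub>N\<^esub> x"]) (simp_all add: underlying_module_def N.l_neg)
  qed (auto simp: underlying_module_def N.a_ac)
  show "r \<odot>\<^bsub>self_module L\<^esub> x \<in> carrier (self_module L)"
    if "r \<in> carrier (L\<lparr>carrier := K\<rparr>)" "x \<in> carrier (self_module L)" for r x
    using that K_carrier by (simp add: self_module_def)
  show "r \<odot>\<^bsub>KN\<^esub> y \<in> carrier KN" if "r \<in> carrier (L\<lparr>carrier := K\<rparr>)" "y \<in> carrier KN" for r y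
    using that by (simp add: KN_simps NC_scal)
qed

lemma self_simps: "carrier (self_module L) = CL" "x \<oplus>\<^bsub>self_module L\<^esub> y = x \<oplus> y"
  "c \<odot>\<^bsub>self_module L\<^esub> x = c \<otimes> x"
  by (simp_all add: self_module_def)

lemma base_change_eq: "base_change L K N = T.T" "base_change_tensor L K N = T.pt"
  by (simp_all add: base_change_def base_change_tensor_def)

lemma PB_simps: "carrier PB = carrier T.T" "x \<oplus>\<^bsub>PB\<^esub> y = x \<otimes>\<^bsub>T.T\<^esub> y" "\<zero>\<^bsub>PB\<^esub> = \<one>\<^bsub>T.T\<^esub>"
  "P \<odot>\<^bsub>PB\<^esub> x = pullback_action L K k N P x"
  by (simp_all add: pullback_def base_change_eq)

text \<open>The tensor product is a multiplicative group and the inverse image an additive module on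
  the same carrier. This lemma and \<open>finprod_PB\<close> pass between the two notations.\<close>

lemma hom_PB: "hom (add_monoid PB) H = hom T.T H"
  by (simp add: hom_def PB_simps)

lemma abelian_group_PB: "abelian_group PB"
proof -
  interpret G: comm_group T.T by (rule T.comm_group_T)
  show ?thesis
  proof (rule abelian_groupI)
    fix x assume "x \<in> carrier PB"
    then show "\<exists>y\<in>carrier PB. y \<oplus>\<^bsub>PB\<^esub> x = \<zero>\<^bsub>PB\<^esub>"
      by (intro bexI[of _ "inv\<^bsub>T.T\<^esub> x"]) (simp_all add: PB_simps)
  qed (simp_all add: PB_simps G.m_ac)
qed

interpretation PB: abelian_group PB by (rule abelian_group_PB)

lemma finprod_PB: "finprod T.T f A = finsum PB f A"
  proof -
  have "add PB = monoid.mult T.T" by (simp add: pullback_def base_change_eq)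
  then show ?thesis by (simp add: finsum_def finprod_def PB_simps)
qed

lemma pt_closed: "\<lbrakk>x \<in> CL; n \<in> NC\<rbrakk> \<Longrightarrow> T.pt x n \<in> carrier PB"
  using T.pt_closed[of x n] by (simp add: self_simps KN_simps PB_simps)

lemma pt_add_left: "\<lbrakk>x \<in> CL; y \<in> CL; n \<in> NC\<rbrakk> \<Longrightarrow> T.pt (x \<oplus> y) n = T.pt x n \<oplus>\<^bsub>PB\<^esub> T.pt y n"
  using T.pt_add_left[of x y n] by (simp add: self_simps KN_simps PB_simps)

lemma pt_add_right: "\<lbrakk>x \<in> CL; n \<in> NC; n' \<in> NC\<rbrakk> \<Longrightarrow> T.pt x (n \<oplus>\<^sub>M n') = T.pt x n \<oplus>\<^bsub>PB\<^esub> T.pt x n'"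
  using T.pt_add_right[of x n n'] by (simp add: self_simps KN_simps PB_simps)

lemma pt_scal: "\<lbrakk>c \<in> K; x \<in> CL; n \<in> NC\<rbrakk> \<Longrightarrow> T.pt (c \<otimes> x) n = T.pt x (c *\<^sub>M n)"
  using T.pt_smult[of c x n] by (simp add: self_simps KN_simps)

lemma pt_zero: assumes "n \<in> NC" shows "T.pt \<zero> n = \<zero>\<^bsub>PB\<^esub>"
proof -
  have "T.pt (\<zero> \<oplus> \<zero>) n = T.pt \<zero> n \<oplus>\<^bsub>PB\<^esub> T.pt \<zero> n" using assms by (intro pt_add_left) auto
  moreover have "T.pt \<zero> n \<in> carrier PB" using assms by (intro pt_closed) auto
  ultimately show ?thesis by simp
qed

lemma pt_sum: "\<lbrakk>n \<in> NC; \<And>i. i < r \<Longrightarrow> f i \<in> CL\<rbrakk> \<Longrightarrow>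
    T.pt (\<Oplus>i\<in>{..<r::nat}. f i) n = (\<Oplus>\<^bsub>PB\<^esub>i\<in>{..<r}. T.pt (f i) n)"
  by (rule hom_sum[of PB "\<lambda>x. T.pt x n"]) (auto simp: hom_def pt_closed pt_add_left pt_zero PB.abelian_monoid_axioms)

text \<open>The formula of \<open>expand_M\<close> with each product replaced by a tensor. It is an
  explicit inverse of the multiplication map from the tensor product to \<open>M\<close>.\<close>

definition iota :: "'m \<Rightarrow> ('a \<times> 'm \<Rightarrow>\<^sub>0 int) set"
  where "iota m = (\<Oplus>\<^bsub>PB\<^esub>i\<in>{..<sn}. T.pt (sa i) (Tr (sb i *\<^sub>M m)))"

lemma iota_closed: "m \<in> CM \<Longrightarrow> iota m \<in> carrier PB"
  unfolding iota_def by (intro PB.sum_closed pt_closed) (simp_all add: sa_closed sb_closed Tr_NC)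

lemma iota_add: assumes "m \<in> CM" "n \<in> CM" shows "iota (m \<oplus>\<^sub>M n) = iota m \<oplus>\<^bsub>PB\<^esub> iota n"
proof -
  have "iota (m \<oplus>\<^sub>M n) =
    (\<Oplus>\<^bsub>PB\<^esub>i\<in>{..<sn}. T.pt (sa i) (Tr (sb i *\<^sub>M m)) \<oplus>\<^bsub>PB\<^esub> T.pt (sa i) (Tr (sb i *\<^sub>M n)))"
    unfolding iota_def using assms
    by (intro PB.sum_cong PB.a_closed pt_closed) (simp_all add: scal_add Tr_add sa_closed sb_closed Tr_NC pt_add_right)
  also have "\<dots> = iota m \<oplus>\<^bsub>PB\<^esub> iota n"
    unfolding iota_def using assms by (intro PB.finsum_addf) (auto intro!: pt_closed simp: sa_closed sb_closed Tr_NC)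
  finally show ?thesis .
qed

text \<open>For invariant \<open>n\<close> the trace of b_i x n is tr(b_i x) n. This scalar lies in
  \<open>K\<close> and moves across the tensor sign, where \<open>expand_a\<close> adds up the left
  factors to \<open>x\<close>.\<close>

lemma iota_scal: assumes "x \<in> CL" "n \<in> NC" shows "iota (x *\<^sub>M n) = T.pt x n"
proof -
  note [simp] = assms sa_closed sb_closed NC_carrier tr_closed tr_K
  have "iota (x *\<^sub>M n) = (\<Oplus>\<^bsub>PB\<^esub>i\<in>{..<sn}. T.pt (sa i \<otimes> tr (sb i \<otimes> x)) n)"
    unfolding iota_def
  proof (rule PB.sum_cong)
    fix i assume i: "i < sn"
    have "Tr (sb i *\<^sub>M (x *\<^sub>M n)) = tr (sb i \<otimes> x) *\<^sub>M n"
      using i by (simp add: scal_mult[symmetric] Tr_scal)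
    then show "T.pt (sa i) (Tr (sb i *\<^sub>M x *\<^sub>M n)) = T.pt (sa i \<otimes> tr (sb i \<otimes> x)) n"
      using i by (simp add: pt_scal[symmetric] m_comm)
  qed (simp add: pt_closed)
  also have "\<dots> = T.pt (\<Oplus>i\<in>{..<sn}. sa i \<otimes> tr (sb i \<otimes> x)) n"
    by (rule pt_sum[symmetric]) simp_all
  also have "\<dots> = T.pt x n" using expand_a by simp
  finally show ?thesis .
qed

text \<open>\<tau> is the multiplication map x \<otimes> n \<mapsto> x n given by the universal
  property. One composite with \<open>iota\<close> is the identity by \<open>expand_M\<close>; for
  the other it suffices to look at pure tensors.\<close>

lemma exists_tau:
  "\<exists>\<tau>. \<tau> \<in> hom T.T (add_monoid M) \<and> (\<forall>m\<in>CM. \<tau> (iota m) = m) \<and> (\<forall>t\<in>carrier PB. iota (\<tau> t) = t)"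
proof -
  have "comm_group (add_monoid M)" by (rule D.M.a_comm_group)
  then obtain \<tau> where \<tau>: "\<tau> \<in> hom T.T (add_monoid M)" "\<And>x n. \<lbrakk>x \<in> CL; n \<in> NC\<rbrakk> \<Longrightarrow> \<tau> (T.pt x n) = x *\<^sub>M n"
    by (rule T.tensor_universal[where f = "\<lambda>x n. x *\<^sub>M n"])
      (auto simp: self_simps KN_simps NC_carrier scal_plus scal_add scal_mult[symmetric] K_carrier m_comm)
  have \<tau>_closed: "\<tau> t \<in> CM" if "t \<in> carrier PB" for t using hom_in_carrier[OF \<tau>(1)] that by (simp add: PB_simps)
  have \<tau>_one: "\<tau> \<one>\<^bsub>T.T\<^esub> = \<zero>\<^sub>M"
    using hom_one[OF \<tau>(1)] comm_group.axioms(2)[OF T.comm_group_T] D.M.a_group by simp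
  have inv1: "\<tau> (iota m) = m" if m: "m \<in> CM" for m
  proof -
    have "\<tau> \<in> hom (add_monoid PB) (add_monoid M)" using \<tau>(1) unfolding hom_PB .
    from PB.hom_sum[OF D.M.abelian_monoid_axioms this]
    have "\<tau> (iota m) = (\<Oplus>\<^bsub>M\<^esub>i\<in>{..<sn}. \<tau> (T.pt (sa i) (Tr (sb i *\<^sub>M m))))"
      unfolding iota_def using m by (simp add: PB_simps(3) \<tau>_one sa_closed sb_closed Tr_NC pt_closed)
    also have "\<dots> = (\<Oplus>\<^bsub>M\<^esub>i\<in>{..<sn}. sa i *\<^sub>M Tr (sb i *\<^sub>M m))"
      by (rule D.M.sum_cong) (use m in \<open>auto simp: \<tau>(2) sa_closed sb_closed Tr_NC\<close>)
    finally show ?thesis using expand_M[OF m] by simp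
  qed
  have "(\<lambda>t. iota (\<tau> t)) \<in> hom T.T T.T"
  proof (rule homI)
    show "iota (\<tau> t) \<in> carrier T.T" if "t \<in> carrier T.T" for t
      using iota_closed \<tau>_closed that by (simp add: PB_simps)
    show "iota (\<tau> (t \<otimes>\<^bsub>T.T\<^esub> u)) = iota (\<tau> t) \<otimes>\<^bsub>T.T\<^esub> iota (\<tau> u)" if "t \<in> carrier T.T" "u \<in> carrier T.T" for t u
      using hom_mult[OF \<tau>(1) that] iota_add \<tau>_closed that by (simp add: PB_simps)
  qed
  moreover have "(\<lambda>t. t) \<in> hom T.T T.T" by (simp add: hom_def)
  ultimately have "iota (\<tau> t) = t" if "t \<in> carrier T.T" for t
    using T.tensor_hom_eq[OF comm_group.axioms(2)[OF T.comm_group_T], of "\<lambda>t. iota (\<tau> t)" "\<lambda>t. t" t] that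
    by (simp add: self_simps KN_simps \<tau>(2) iota_scal)
  then show ?thesis using \<tau>(1) inv1 by (auto simp: PB_simps)
qed

text \<open>The expansion by the a_i, applied to the values on \<open>K\<close>, has the coordinates
  of \<open>tr_diff_ops\<close>. Existence of such a decomposition matters for uniqueness: otherwise
  the condition defining the action on a pure tensor could hold vacuously and determine
  nothing.\<close>

lemma corresponds_exists:
  assumes "P \<in> DL" "x \<in> CL"
  shows "\<exists>r l Q. corresponds L K k (compose CL P (mult_op L x)) r l Q"
proof -
  let ?Z = "compose CL P (mult_op L x)"
  have Z: "?Z \<in> DL" using assms by (intro diff_ops_compose mult_op_diff_ops)
  have "?Z y = (\<Oplus>i\<in>{..<sn}. sa i \<otimes> (\<lambda>y\<in>K. tr (sb i \<otimes> ?Z y)) y)" if y: "y \<in> K" for y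
    using expand_a[of "?Z y"] linD(2)[OF diff_ops_lin[OF Z] K_carrier[OF y]] y by simp
  then have "corresponds L K k ?Z sn sa (\<lambda>i. \<lambda>y\<in>K. tr (sb i \<otimes> ?Z y))"
    unfolding corresponds_def using sa_closed tr_diff_ops[OF Z sb_closed] by auto
  then show ?thesis by blast
qed

definition pullback_spec :: "('a \<Rightarrow> 'a) \<Rightarrow> (('a \<times> 'm \<Rightarrow>\<^sub>0 int) set \<Rightarrow> ('a \<times> 'm \<Rightarrow>\<^sub>0 int) set) \<Rightarrow> bool"
  where "pullback_spec P f \<longleftrightarrow> f \<in> extensional (carrier T.T) \<inter> hom T.T T.T \<and>
    (\<forall>x\<in>CL. \<forall>n\<in>NC. \<forall>r l Q. corresponds L K k (compose CL P (mult_op L x)) r l Q \<longrightarrow>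
      f (T.pt x n) = (\<Oplus>\<^bsub>PB\<^esub>i\<in>{..<r}. T.pt (l i) (lift (Q i) \<bullet> n)))"

lemma pullback_action_eq: "pullback_action L K k N P = (THE f. pullback_spec P f)"
  by (simp add: pullback_action_def pullback_spec_def base_change_eq finprod_PB N_simps)

lemma pullback_spec_unique:
  assumes P: "P \<in> DL" and "pullback_spec P f" "pullback_spec P f'"
  shows "f = f'"
proof (rule extensionalityI[of _ "carrier T.T"])
  show "f \<in> extensional (carrier T.T)" "f' \<in> extensional (carrier T.T)"
    using assms by (auto simp: pullback_spec_def)
  fix t assume t: "t \<in> carrier T.T"
  show "f t = f' t"
  proof (rule T.tensor_hom_eq[OF comm_group.axioms(2)[OF T.comm_group_T] _ _ _ t])
    show "f \<in> hom T.T T.T" "f' \<in> hom T.T T.T" using assms by (auto simp: pullback_spec_def)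
    fix x n assume "x \<in> carrier (self_module L)" "n \<in> carrier KN"
    then have xn: "x \<in> CL" "n \<in> NC" by (simp_all add: self_simps KN_simps)
    from corresponds_exists[OF P xn(1)] obtain r l Q
      where c: "corresponds L K k (compose CL P (mult_op L x)) r l Q" by blast
    have "h (T.pt x n) = (\<Oplus>\<^bsub>PB\<^esub>i\<in>{..<r}. T.pt (l i) (lift (Q i) \<bullet> n))" if "pullback_spec P h" for h
      using that[unfolded pullback_spec_def, THEN conjunct2, rule_format, OF xn c] .
    from this[OF assms(2)] this[OF assms(3)] show "f (T.pt x n) = f' (T.pt x n)" by simp
  qed
qed

text \<open>The action of \<open>P\<close> on \<open>M\<close>, transported along
  \<open>iota\<close> and \<tau>, satisfies the defining condition for every decomposition of the
  operator, since by \<open>act_decompose\<close> all of them give the same vector of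
  \<open>M\<close>. By uniqueness it is the action on the inverse image, and \<open>iota\<close> is
  an isomorphism by construction.\<close>

theorem module_iso_pullback: "modules_isomorphic (diff_ops L k) M PB"
proof -
  obtain \<tau> where \<tau>: "\<tau> \<in> hom T.T (add_monoid M)" "\<And>m. m \<in> CM \<Longrightarrow> \<tau> (iota m) = m"
    "\<And>t. t \<in> carrier PB \<Longrightarrow> iota (\<tau> t) = t" using exists_tau by blast
  have \<tau>_closed: "\<tau> t \<in> CM" if "t \<in> carrier T.T" for t using hom_in_carrier[OF \<tau>(1)] that by simp
  have \<tau>_pt: "\<tau> (T.pt x n) = x *\<^sub>M n" if "x \<in> CL" "n \<in> NC" for x n
    using \<tau>(2)[of "x *\<^sub>M n"] that NC_carrier by (simp add: iota_scal)
  have iota_zero: "iota \<zero>\<^sub>M = \<zero>\<^bsub>PB\<^esub>"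
    using iota_scal[OF zero_closed NC_zero] pt_zero[OF NC_zero] NC_carrier[OF NC_zero] by simp
  have spec: "pullback_spec P (\<lambda>t\<in>carrier T.T. iota (P \<bullet> \<tau> t))" (is "pullback_spec P ?f") if P: "P \<in> DL" for P
    unfolding pullback_spec_def
  proof (intro conjI ballI allI impI)
    interpret G: comm_group T.T by (rule T.comm_group_T)
    have "?f \<in> hom T.T T.T"
    proof (rule homI)
      show "?f t \<in> carrier T.T" if "t \<in> carrier T.T" for t
        using that iota_closed[OF act_closed[OF P \<tau>_closed[of t]]] by (simp add: PB_simps)
      show "?f (t \<otimes>\<^bsub>T.T\<^esub> u) = ?f t \<otimes>\<^bsub>T.T\<^esub> ?f u" if "t \<in> carrier T.T" "u \<in> carrier T.T" for t u
        using that hom_mult[OF \<tau>(1) that] iota_add[OF act_closed[OF P \<tau>_closed[of t]] act_closed[OF P \<tau>_closed[of u]]]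
        by (simp add: act_add P \<tau>_closed PB_simps(2))
    qed
    then show "?f \<in> extensional (carrier T.T) \<inter> hom T.T T.T" by simp
    fix x n r l Q assume x: "x \<in> CL" and n: "n \<in> NC"
      and c: "corresponds L K k (compose CL P (mult_op L x)) r l Q"
    have l: "l i \<in> CL" and Q: "Q i \<in> DK" if "i < r" for i
      using c that by (auto simp: corresponds_def)
    have nQ: "lift (Q i) \<bullet> n \<in> NC" if "i < r" for i using NC_act[OF Q[OF that] n] .
    have "P \<bullet> (x *\<^sub>M n) = compose CL P (mult_op L x) \<bullet> n"
      using act_compose[OF P mult_op_diff_ops[OF x] NC_carrier[OF n]] by (simp add: scal_def)
    also have "\<dots> = (\<Oplus>\<^bsub>M\<^esub>i\<in>{..<r}. l i *\<^sub>M (lift (Q i) \<bullet> n))"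
      using c by (intro act_decompose diff_ops_compose mult_op_diff_ops P x NC_carrier n l Q)
        (auto simp: corresponds_def)
    finally have "iota (P \<bullet> (x *\<^sub>M n)) = iota (\<Oplus>\<^bsub>M\<^esub>i\<in>{..<r}. l i *\<^sub>M (lift (Q i) \<bullet> n))" by simp
    also have "\<dots> = (\<Oplus>\<^bsub>PB\<^esub>i\<in>{..<r}. iota (l i *\<^sub>M (lift (Q i) \<bullet> n)))"
      by (rule D.M.hom_sum) (use l nQ NC_carrier in \<open>auto simp: hom_def iota_closed iota_add iota_zero PB.abelian_monoid_axioms\<close>)
    also have "\<dots> = (\<Oplus>\<^bsub>PB\<^esub>i\<in>{..<r}. T.pt (l i) (lift (Q i) \<bullet> n))"
      by (rule PB.sum_cong) (use l nQ in \<open>auto simp: iota_scal intro!: pt_closed\<close>)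
    finally show "?f (T.pt x n) = (\<Oplus>\<^bsub>PB\<^esub>i\<in>{..<r}. T.pt (l i) (lift (Q i) \<bullet> n))"
      using x n pt_closed[OF x n] by (simp add: \<tau>_pt PB_simps(1))
  qed
  have "iota \<in> module_iso (diff_ops L k) M PB"
    unfolding module_iso_def
  proof (intro CollectI conjI ballI)
    have "bij_betw iota CM (carrier PB)"
      by (rule bij_betwI[where g = \<tau>]) (use iota_closed \<tau> \<tau>_closed PB_simps(1) in auto)
    then show "iota \<in> Group.iso (add_monoid M) (add_monoid PB)"
      by (simp add: iso_def hom_def iota_closed iota_add)
    fix P m assume P: "P \<in> DL" and m: "m \<in> CM"
    have "pullback_action L K k N P = (\<lambda>t\<in>carrier T.T. iota (P \<bullet> \<tau> t))"
      unfolding pullback_action_eq using spec[OF P] pullback_spec_unique[OF P] by (intro the_equality) auto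
    then show "iota (P \<bullet> m) = P \<odot>\<^bsub>PB\<^esub> iota m"
      using \<tau>(2)[OF m] iota_closed[OF m] by (simp add: PB_simps(1,4))
  qed
  then show ?thesis by (auto simp: modules_isomorphic_def)
qed

end

section \<open>Cyclic Galois groups\<close>

lemma (in ring) restrict_ring_iso:
  assumes "h \<in> ring_iso R R" shows "restrict h (carrier R) \<in> ring_iso R R"
proof -
  have "bij_betw (restrict h (carrier R)) (carrier R) (carrier R)"
    using assms bij_betw_cong[of "carrier R" "restrict h (carrier R)" h] by (simp add: ring_iso_def)
  then show ?thesis using assms by (auto simp: ring_iso_def ring_hom_def)
qed

lemma (in ring) group_galois_group:
  assumes "K \<subseteq> carrier R"
  shows "group (galois_group R K)"
proof -
  let ?H = "{g \<in> ring_iso R R \<inter> extensional (carrier R). \<forall>x\<in>K. g x = x}"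
  have Bij: "g \<in> Bij (carrier R)" if "g \<in> ?H" for g using that by (auto simp: Bij_def ring_iso_def)
  have "subgroup ?H (BijGroup (carrier R))"
  proof (rule group.subgroupI[OF group_BijGroup])
    show "?H \<subseteq> carrier (BijGroup (carrier R))" using Bij by (auto simp: BijGroup_def)
    have "(\<lambda>x\<in>carrier R. x) \<in> ?H"
      using assms by (auto simp: ring_iso_def ring_hom_def bij_betw_def inj_on_def)
    then show "?H \<noteq> {}" by blast
    fix g h assume g: "g \<in> ?H"
    have gb: "bij_betw g (carrier R) (carrier R)" using Bij[OF g] by (simp add: Bij_def)
    let ?i = "restrict (inv_into (carrier R) g) (carrier R)"
    have "restrict (inv_into (carrier R) g) (carrier R) \<in> ring_iso R R"
    proof -
      have "inv_into (carrier R) g \<in> ring_iso R R" using g ring_iso_set_sym[OF ring_axioms] by blast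
      then show ?thesis by (rule restrict_ring_iso)
    qed
    moreover have "?i x = x" if "x \<in> K" for x
    proof -
      have "g x = x" "x \<in> carrier R" using g that assms by auto
      then show ?thesis using bij_betw_inv_into_left[OF gb, of x] by simp
    qed
    ultimately show "inv\<^bsub>BijGroup (carrier R)\<^esub> g \<in> ?H"
      using inv_BijGroup[OF Bij[OF g]] by simp
    assume h: "h \<in> ?H"
    have "compose (carrier R) g h \<in> ring_iso R R"
      using g h bij_betw_compose[of h "carrier R" "carrier R" g "carrier R"]
      by (auto simp: ring_iso_def ring_hom_def compose_def Pi_def)
    moreover have "compose (carrier R) g h x = x" if "x \<in> K" for x
      using g h that assms by (auto simp: compose_def)
    ultimately show "g \<otimes>\<^bsub>BijGroup (carrier R)\<^esub> h \<in> ?H"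
      using Bij[OF g] Bij[OF h] by (simp add: BijGroup_def)
  qed
  from subgroup.subgroup_is_group[OF this group_BijGroup] show ?thesis by (simp add: galois_group_def)
qed

lemma galois_group_simps:
  "g \<in> carrier (galois_group L K) \<longleftrightarrow> g \<in> ring_iso L L \<and> g \<in> extensional (carrier L) \<and> (\<forall>x\<in>K. g x = x)"
  "\<lbrakk>g \<in> carrier (galois_group L K); h \<in> carrier (galois_group L K)\<rbrakk> \<Longrightarrow>
    g \<otimes>\<^bsub>galois_group L K\<^esub> h = compose (carrier L) g h"
  "\<one>\<^bsub>galois_group L K\<^esub> = (\<lambda>x\<in>carrier L. x)"
  by (auto simp: galois_group_def BijGroup_def Bij_def ring_iso_def)

text \<open>\<open>x\<close> is a root of a nonzero polynomial over \<open>K\<close>, and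
  \<open>g\<close> maps roots to roots. So the orbit of \<open>x\<close> is finite, and injectivity
  of \<open>g\<close> turns a repetition in it into a return to \<open>x\<close>.\<close>

lemma (in ring) finite_order_vector:
  assumes "domain R" "subfield K R" and fd: "finite_dimension K (carrier R)"
    and g: "g \<in> ring_iso R R" "\<And>x. x \<in> K \<Longrightarrow> g x = x" and x: "x \<in> carrier R"
  shows "\<exists>n>0. (g ^^ n) x = x"
proof -
  interpret domain R by fact
  have gh: "\<And>y. y \<in> carrier R \<Longrightarrow> g y \<in> carrier R" "\<And>y z. \<lbrakk>y \<in> carrier R; z \<in> carrier R\<rbrakk> \<Longrightarrow> g (y \<oplus> z) = g y \<oplus> g z"
    "\<And>y z. \<lbrakk>y \<in> carrier R; z \<in> carrier R\<rbrakk> \<Longrightarrow> g (y \<otimes> z) = g y \<otimes> g z" "g \<one> = \<one>" "inj_on g (carrier R)"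
    using g(1) by (auto simp: ring_iso_def ring_hom_def bij_betw_def)
  note Ks = subringE[OF subfieldE(1)[OF assms(2)]]
  have "\<zero> \<in> K" using Ks(2) .
  then have g0: "g \<zero> = \<zero>" using g(2) by blast
  have gi: "(g ^^ i) x \<in> carrier R" for i using x by (induction i) (simp_all add: gh)
  have gpow: "g (y [^] n) = g y [^] n" if "y \<in> carrier R" for y and n :: nat
    using that by (induction n) (simp_all add: gh)
  have "(algebraic over K) x"
    using finite_dimension_imp_algebraic[OF assms(2) carrier_is_subring fd x] .
  then obtain p where p: "p \<in> carrier (K[X])" "p \<noteq> []" "eval p x = \<zero>"
    using algebraicE[OF subfieldE(1)[OF assms(2)] x] by blast
  have pK: "set p \<subseteq> K" and pR: "p \<in> carrier (poly_ring R)"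
    using p(1,2) Ks(1) by (auto simp: univ_poly_carrier[symmetric] polynomial_def)
  have geval: "g (eval q y) = eval q (g y)" if "y \<in> carrier R" "set q \<subseteq> K" for q y
    using that(2)
  proof (induction q)
    case (Cons c q)
    have "c \<in> carrier R" "eval q y \<in> carrier R" using Cons.prems Ks(1) that(1) by (auto intro!: eval_in_carrier)
    then show ?case using Cons that(1) g(2)[of c] by (simp add: gh gpow)
  qed (simp add: g0)
  have "is_root p ((g ^^ i) x)" for i
  proof (induction i)
    case (Suc i)
    then show ?case using geval[OF gi pK, of i] gi[of "Suc i"] p(2) g0 by (simp add: is_root_def)
  qed (use p x in \<open>simp add: is_root_def\<close>)
  then have "range (\<lambda>i. (g ^^ i) x) \<subseteq> {y. is_root p y}" by blast
  then have "finite (range (\<lambda>i. (g ^^ i) x))" using finite_number_of_roots[OF pR] finite_subset by blast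
  then have "\<not> inj (\<lambda>i. (g ^^ i) x)" using finite_imageD infinite_UNIV_nat by blast
  then obtain i j where ij: "i < j" "(g ^^ i) x = (g ^^ j) x" unfolding inj_on_def by (metis nat_neq_iff)
  have inj: "y = z" if "y \<in> carrier R" "z \<in> carrier R" "(g ^^ i) y = (g ^^ i) z" for y z i
    using that
  proof (induction i arbitrary: y z)
    case (Suc i)
    then have "g y = g z" using Suc.IH[of "g y" "g z"] gh(1) by (simp add: funpow_swap1)
    then show ?case using Suc.prems gh(5) by (simp add: inj_on_def)
  qed simp
  have "(g ^^ i) ((g ^^ (j - i)) x) = (g ^^ i) x"
    using ij by (metis add_diff_inverse_nat funpow_add less_imp_le not_less o_apply)
  then have "(g ^^ (j - i)) x = x" by (rule inj[OF gi x])
  then show ?thesis using ij(1) by (intro exI[of _ "j - i"]) simp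
qed

lemma funpow_mult_fixed: "(f ^^ n) x = x \<Longrightarrow> (f ^^ (m * n)) x = x"
  by (induction m) (simp_all add: funpow_add)

text \<open>A cyclic group could be infinite; finite dimension over \<open>K\<close> gives the
  generator a finite order. The period is a product of periods of spanning vectors, and it works
  everywhere because powers of \<open>g\<close> are \<open>K\<close>-linear.\<close>

lemma (in ring) finite_order:
  assumes "domain R" "subfield K R" and fd: "finite_dimension K (carrier R)"
    and g: "g \<in> ring_iso R R" "\<And>x. x \<in> K \<Longrightarrow> g x = x"
  shows "\<exists>n>0. \<forall>x\<in>carrier R. (g ^^ n) x = x"
proof -
  obtain m where "dimension m K (carrier R)" using fd by blast
  then obtain Us where Us: "set Us \<subseteq> carrier R" "Span K Us = carrier R"
    using exists_base[OF assms(2)] by blast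
  have gi: "(g ^^ i) x \<in> carrier R" "(g ^^ i) (x \<oplus> y) = (g ^^ i) x \<oplus> (g ^^ i) y"
    "(g ^^ i) (x \<otimes> y) = (g ^^ i) x \<otimes> (g ^^ i) y" if "x \<in> carrier R" "y \<in> carrier R" for i x y
  proof -
    have *: "(g ^^ i) x \<in> carrier R" if "x \<in> carrier R" for i x
      using that g(1) by (induction i) (auto simp: ring_iso_def ring_hom_def)
    show "(g ^^ i) x \<in> carrier R" using *[OF that(1)] .
    show "(g ^^ i) (x \<oplus> y) = (g ^^ i) x \<oplus> (g ^^ i) y" "(g ^^ i) (x \<otimes> y) = (g ^^ i) x \<otimes> (g ^^ i) y"
      using that * g(1) by (induction i) (simp_all add: ring_iso_def ring_hom_def)
  qed
  have gK: "(g ^^ i) c = c" if "c \<in> K" for i c using that g(2) by (induction i) simp_all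
  have "\<exists>n>0. \<forall>x\<in>set Us. (g ^^ n) x = x"
    using Us(1)
  proof (induction Us)
    case (Cons u Us)
    then obtain n where n: "n > 0" "\<forall>x\<in>set Us. (g ^^ n) x = x" by auto
    obtain n' where n': "n' > 0" "(g ^^ n') u = u" using finite_order_vector[OF assms(1-3) g] Cons.prems by auto
    have "(g ^^ (n' * n)) x = x" if "x \<in> set (u # Us)" for x
    proof (cases "x = u")
      case True
      then show ?thesis using funpow_mult_fixed[OF n'(2), of n] by (simp add: mult.commute)
    next
      case False
      then show ?thesis using funpow_mult_fixed[of n g x n'] n(2) that by simp
    qed
    then show ?case using n n' by (intro exI[of _ "n' * n"]) simp
  qed auto
  then obtain n where n: "n > 0" "\<And>x. x \<in> set Us \<Longrightarrow> (g ^^ n) x = x" by blast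
  have "(g ^^ n) x = x" if "x \<in> Span K Us" for x
    using that Us(1) n(2)
  proof (induction Us arbitrary: x)
    case Nil
    then show ?case using gK subringE(2)[OF subfieldE(1)[OF assms(2)]] by auto
  next
    case (Cons u Us)
    then obtain c v where cv: "c \<in> K" "v \<in> Span K Us" "x = c \<otimes> u \<oplus> v"
      by (auto simp: line_extension_mem_iff)
    have "v \<in> carrier R" "c \<in> carrier R" "u \<in> carrier R"
      using cv Cons.prems Span_subgroup_props(1)[OF assms(2), of Us] subringE(1)[OF subfieldE(1)[OF assms(2)]] by auto
    moreover have "(g ^^ n) v = v" using Cons cv(2) by simp
    ultimately show ?case using cv Cons.prems gi gK by simp
  qed
  then show ?thesis using n(1) Us(2) by blast
qed

theorem proposition3p12:
  fixes L :: "'a ring" and K k :: "'a set" and M :: "('a \<Rightarrow> 'a, 'm) module"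
  assumes "field L" and "subfield K L" and "subfield k L" and "k \<subseteq> K"
    and "algebraically_closed (L\<lparr>carrier := k\<rparr>)" and "char_zero (L\<lparr>carrier := k\<rparr>)"
    and "finitely_generated_field L k"
    and "finitely_generated_field (L\<lparr>carrier := K\<rparr>) k"
    and "finite_galois L K" and "cyclic_group (galois_group L K)"
    and "simple_module (diff_ops L k) M"
    and "vectorspace.fin_dim L (underlying_module L M)"
    and "inertia_group L K k M = carrier (galois_group L K)"
  shows "\<exists>N :: ('a \<Rightarrow> 'a, 'm) module.
           simple_module (diff_ops (L\<lparr>carrier := K\<rparr>) k) N \<and>
           modules_isomorphic (diff_ops L k) M (pullback L K k N)"
proof -
  interpret L: field L by fact
  let ?G = "galois_group L K"
  have K_sub: "K \<subseteq> carrier L" using subringE(1)[OF subfieldE(1)[OF assms(2)]] .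
  interpret G: group ?G by (rule L.group_galois_group[OF K_sub])
  have k_field: "k_field L k" using assms(1,3) subringE(1)[OF subfieldE(1)[OF assms(3)]]
    by (simp add: k_field_def k_field_axioms_def)
  obtain g where g: "g \<in> carrier ?G" "subgroup_generated ?G {g} = ?G"
    using assms(10) by (auto simp: cyclic_group_def)
  have gen: "carrier ?G = generate ?G {g}"
    using carrier_subgroup_generated[of ?G "{g}"] g by (simp add: Int_absorb1)
  have g_iso: "g \<in> ring_iso L L" and gK: "\<And>x. x \<in> K \<Longrightarrow> g x = x"
    using g(1) by (auto simp: galois_group_simps)
  have gc: "g x \<in> carrier L" if "x \<in> carrier L" for x
    using g_iso that by (auto simp: ring_iso_def ring_hom_def)
  define ig where "ig = inv\<^bsub>?G\<^esub> g"
  have ig: "ig \<in> carrier ?G" using g by (simp add: ig_def)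
  have ig_g: "ig (g x) = x" if "x \<in> carrier L" for x
  proof -
    have "compose (carrier L) ig g = (\<lambda>x\<in>carrier L. x)"
      using G.l_inv[OF g(1)] galois_group_simps(2)[OF ig g(1)] by (simp add: ig_def galois_group_simps(3))
    from fun_cong[OF this, of x] show ?thesis using that by (simp add: compose_def)
  qed
  have fixed: "{x \<in> carrier L. \<forall>h\<in>carrier ?G. h x = x} = K" and fd: "L.finite_dimension K (carrier L)"
    using assms(9) by (auto simp: finite_galois_def)
  \<comment> \<open>The Galois condition speaks of all automorphisms. An element fixed by the
    generator is fixed by the group it generates, which is seen by induction over that
    group.\<close>
  have K_eq: "K = {x \<in> carrier L. g x = x}"
  proof (intro equalityI subsetI)
    fix x assume "x \<in> {x \<in> carrier L. g x = x}"
    then have x: "x \<in> carrier L" "g x = x" by auto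
    have "h x = x" if "h \<in> generate ?G {g}" for h
      using that
    proof (induction h rule: generate.induct)
      case one
      then show ?case using x by (simp add: galois_group_simps)
    next
      case (incl h)
      then show ?case using x by simp
    next
      case (inv h)
      then show ?case using ig_g[OF x(1)] x by (simp add: ig_def)
    next
      case (eng h1 h2)
      then show ?case using x galois_group_simps(2)[of h1 L K h2] gen by (simp add: compose_def)
    qed
    then show "x \<in> K" using fixed gen x by blast
  qed (use gK K_sub in auto)
  define P where "P n \<longleftrightarrow> 0 < n \<and> (\<forall>x\<in>carrier L. (g ^^ n) x = x)" for n
  \<comment> \<open>The order of \<open>g\<close> as a map on \<open>L\<close>. Taking the least
    period makes every smaller positive power move some element.\<close>
  define d where "d = (LEAST n. P n)"
  have "\<exists>n. P n" unfolding P_def using L.finite_order[OF L.domain_axioms assms(2) fd g_iso gK] by blast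
  then have d: "P d" unfolding d_def by (rule LeastI_ex)
  have least: "\<not> P j" if "j < d" for j using that not_less_Least unfolding d_def by blast
  have cyc: "cyclic_extension L k K g d"
    using k_field assms(2,4) g_iso d least K_eq
    by (auto simp: cyclic_extension_def cyclic_extension_axioms_def P_def)
  interpret C: cyclic_extension L k K g d by (rule cyc)
  have lm: "left_module (diff_ops L k) M" using assms(11) by (simp add: simple_module_def)
  have dm: "diff_module L k M" using k_field lm by (simp add: diff_module_def diff_module_axioms_def)
  have sdm: "simple_diff_module L k M"
    using dm assms by (simp add: simple_diff_module_def simple_diff_module_axioms_def)
  interpret S: simple_diff_module L k M by (rule sdm)
  have "modules_isomorphic (diff_ops L k) (twist L K g M) M"
    using g(1) assms(13) by (auto simp: inertia_group_def)
  then obtain \<phi> where "\<phi> \<in> module_iso (diff_ops L k) (twist L K g M) M" by (auto simp: modules_isomorphic_def)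
  then have \<phi>: "bij_betw \<phi> (carrier M) (carrier M)"
    "\<And>x y. \<lbrakk>x \<in> carrier M; y \<in> carrier M\<rbrakk> \<Longrightarrow> \<phi> (x \<oplus>\<^bsub>M\<^esub> y) = \<phi> x \<oplus>\<^bsub>M\<^esub> \<phi> y"
    "\<And>P x. \<lbrakk>P \<in> carrier (diff_ops L k); x \<in> carrier M\<rbrakk> \<Longrightarrow>
      \<phi> (compose (carrier L) ig (compose (carrier L) P g) \<odot>\<^bsub>M\<^esub> x) = P \<odot>\<^bsub>M\<^esub> \<phi> x"
    by (auto simp: module_iso_def iso_def hom_def twist_def ig_def)
  have sl: "semilinear L k K g d M \<phi>"
  proof (intro semilinear.intro semilinear_axioms.intro cyc dm)
    show "\<phi> x \<in> carrier M" if "x \<in> carrier M" for x using \<phi>(1) that by (auto simp: bij_betw_def)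
    fix P x assume P: "P \<in> carrier (diff_ops L k)" and x: "x \<in> carrier M"
    \<comment> \<open>The isomorphism from the twist satisfies \<phi>((g^-1 P g) x) = P \<phi>(x).
      Inserting g P g^-1 for \<open>P\<close> gives the required semilinearity; here the group
      inverse \<open>ig\<close> has to cancel \<open>g\<close>, and \<open>g ^^ (d - 1)\<close> in
      \<open>conjn\<close> has to act as the inverse of \<open>g\<close>.\<close>
    have "compose (carrier L) ig (compose (carrier L) (C.conjn 1 P) g) = P"
    proof (rule extensionalityI[of _ "carrier L"])
      fix y assume y: "y \<in> carrier L"
      have "(g ^^ (d - 1)) (g y) = (g ^^ Suc (d - 1)) y" by (simp add: funpow_swap1)
      also have "Suc (d - 1) = d" using d by (simp add: P_def)
      finally have "(g ^^ (d - 1)) (g y) = y" using d y by (simp add: P_def)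
      then show "compose (carrier L) ig (compose (carrier L) (C.conjn 1 P) g) y = P y"
        using y gc ig_g C.linD(2)[OF C.diff_ops_lin[OF P]] by (simp add: compose_def C.conjn_def)
    qed (use C.linD(1)[OF C.diff_ops_lin[OF P]] in simp_all)
    then show "\<phi> (P \<odot>\<^bsub>M\<^esub> x) = C.conjn 1 P \<odot>\<^bsub>M\<^esub> \<phi> x"
      using \<phi>(3)[OF C.conjn_diff_ops[OF P, of 1] x] by simp
  qed (fact \<phi>(2))
  interpret SL: simple_semilinear L k K g d M \<phi> by (intro simple_semilinear.intro sl sdm)
  have "x = \<zero>\<^bsub>M\<^esub>" if "x \<in> carrier M" "\<phi> x = \<zero>\<^bsub>M\<^esub>" for x
    using \<phi>(1) that SL.ppow_zero[of 1] S.D.M.zero_closed by (auto simp: bij_betw_def inj_on_def)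
  from SL.exists_normalized[OF this] obtain \<phi>' where
    \<phi>': "semilinear L k K g d M \<phi>'" "\<forall>x\<in>carrier M. (\<phi>' ^^ d) x = x" by blast
  interpret E: simple_descent L k K g d M \<phi>'
    using \<phi>' sdm by (intro simple_descent.intro descent.intro descent_axioms.intro) auto
  show ?thesis using E.simple_N E.module_iso_pullback by blast
qed

end
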